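(* Let $\mathcal{M}^\varepsilon$ ($\varepsilon>0$) and $\mathcal{M}^0$, both contained in $(H^1_0(\Omega))^2$, be exponential attractors of the dynamical systems $(\mathcal{E},S_\varepsilon(t))$ and $(\mathcal{E},S_0(t))$ generated by problems $(P_\varepsilon)$ and $(P_0)$ with the following properties, where $M_0>0$ (a non-decreasing function where an argument is indicated), $\sigma>0$, $0<\varkappa<1$, $D\ge0$ are independent of $\varepsilon$: (1) $\|\operatorname{div}(a(\tfrac{\cdot}{\varepsilon})\nabla\xi^1)+g\|_{H^1_0(\Omega)}+\|\operatorname{div}(a(\tfrac{\cdot}{\varepsilon})\nabla\xi^2)\|+\|\xi\|_{(C^\alpha(\overline\Omega))^2}\le M_0(\|g\|)$ for all $\xi\in\mathcal{M}^\varepsilon$; (2) $\|\operatorname{div}(a^h\nabla\xi^1)+g\|_{H^1_0(\Omega)}+\|\operatorname{div}(a^h\nabla\xi^2)\|+\|\xi\|_{(H^2(\Omega))^2}\le M_0(\|g\|)$ for all $\xi\in\mathcal{M}^0$; (3) $\operatorname{dist}_{\mathcal{E}}(S_\varepsilon(t)B,\mathcal{M}^\varepsilon)+\operatorname{dist}_{\mathcal{E}}(S_0(t)B,\mathcal{M}^0)\le M_0(\|B\|_{\mathcal{E}})e^{-\sigma t}$, $t\ge0$, for every bounded $B\subset\mathcal{E}$; (4) $\dim_f(\mathcal{M}^\varepsilon,\mathcal{E})+\dim_f(\mathcal{M}^0,\mathcal{E})\le D$; (5) $\operatorname{dist}^s_{\mathcal{E}^{-1}}(\mathcal{M}^\varepsilon,\mathcal{M}^0)\le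 M_0\|A_\varepsilon^{-1}-A_0^{-1}\|^{\varkappa}_{\mathcal{L}(L^2(\Omega))}$. Let $0\le\beta<\alpha$. Then $$\operatorname{dist}^s_{(C^\beta(\overline\Omega))^2}(\mathcal{M}^\varepsilon,\mathcal{M}^0)\le M\,\|A_\varepsilon^{-1}-A_0^{-1}\|^{\theta\varkappa}_{\mathcal{L}(L^2(\Omega))},\qquad\theta=\frac{\alpha-\beta}{2+\alpha},$$ for some non-decreasing function $M=M(\|g\|)$ which is independent of $\varepsilon$.
   Context: Standing assumptions. $\Omega\subset\mathbb{R}^3$ is a bounded smooth domain, $\gamma>0$, $g\in L^2(\Omega)$. The matrix $a=\{a_{ij}\}_{i,j=1}^3$ satisfies $a_{ij}\in L^\infty(\mathbb{R}^3)$, $a_{ij}=a_{ji}$, $a_{ij}(\cdot+e_k)=a_{ij}(\cdot)$ for $k=1,2,3$ ($e_k$ the standard basis), and $\nu|\eta|^2\le a(y)\eta\cdot\eta\le\nu^{-1}|\eta|^2$ for all $y,\eta\in\mathbb{R}^3$ and some $\nu>0$. The function $f\in C^2(\mathbb{R})$ satisfies $f(s)s\ge-K_1$, $f'(s)\ge-K_2$, $|f''(s)|\le K_3(1+|s|)$ for all $s\in\mathbb{R}$, and $f(0)=0$, with positive constants $K_1,K_2,K_3$. Homogenised matrix. With $Q=[0,1)^3$, let $N_i$ be the $Q$-periodic, zero-mean solution of $-\operatorname{div}_y(a(y)\nabla_yN_i)=\operatorname{div}_y(a(y)e_i)$, and $a^h_{ij}=\int_Q\big(a_{ij}(y)+\sum_{k=1}^3a_{ik}(y)\partial_{y_k}N_j(y)\big)dy$.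 Operators. $A_\varepsilon u=-\operatorname{div}(a(\tfrac{\cdot}{\varepsilon})\nabla u)$ for $\varepsilon>0$ and $A_0u=-\operatorname{div}(a^h\nabla u)$, with Dirichlet boundary conditions; $A_\varepsilon^{-1},A_0^{-1}$ are bounded on $L^2(\Omega)$. $\|\cdot\|$ is the $L^2(\Omega)$ norm. Problems. $(P_\varepsilon)$, $\varepsilon>0$: $\partial_t^2u^\varepsilon+\gamma\partial_tu^\varepsilon+A_\varepsilon u^\varepsilon+f(u^\varepsilon)=g$ in $\Omega$, $t\ge0$, $u^\varepsilon|_{\partial\Omega}=0$, $(u^\varepsilon,\partial_tu^\varepsilon)|_{t=0}=\xi$. $(P_0)$: the same with $A_0$ in place of $A_\varepsilon$. Let $\mathcal{E}=H^1_0(\Omega)\times L^2(\Omega)$, $\|\xi\|_{\mathcal{E}}^2=\|\nabla\xi^1\|^2+\|\xi^2\|^2$, and $\mathcal{E}^{-1}=L^2(\Omega)\times H^{-1}(\Omega)$, $\|\xi\|^2_{\mathcal{E}^{-1}}=\|\xi^1\|^2+\|\xi^2\|^2_{H^{-1}(\Omega)}$. For each initial datum in $\mathcal{E}$ there is a unique energy solution with $(u,\partial_tu)\in C(\mathbb{R}_+;\mathcal{E})$; $S_\varepsilon(t)$ and $S_0(t)$ map the initial datum to $(u(t),\partial_tu(t))$ for $(P_\varepsilon)$ and $(P_0)$ respectively. Exponential attractor of $(\mathcal{E},S(t))$: a set $\mathcal{M}$ which is compact in $\mathcal{E}$ with finite fractal (box-counting) dimension $\dim_f(\mathcal{M},\mathcal{E})$,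 positively invariant ($S(t)\mathcal{M}\subset\mathcal{M}$ for all $t\ge0$), and such that $\operatorname{dist}_{\mathcal{E}}(S(t)B,\mathcal{M})\le M(\|B\|_{\mathcal{E}})e^{-\sigma t}$, $t\ge0$, for every bounded $B\subset\mathcal{E}$, for some non-decreasing $M$ and constant $\sigma>0$. $\operatorname{dist}_X(A,B)=\sup_{a\in A}\inf_{b\in B}\|a-b\|_X$, $\operatorname{dist}^s_X(A,B)=\max\{\operatorname{dist}_X(A,B),\operatorname{dist}_X(B,A)\}$; $\|B\|_{\mathcal{E}}=\sup_{b\in B}\|b\|_{\mathcal{E}}$. Exponent $\alpha$: $\alpha=\alpha(\nu)>0$ is a sufficiently small exponent for which $\|u\|_{C^\alpha(\overline\Omega)}\le C(\nu)\|\operatorname{div}(\tilde a\nabla u)\|$ holds for all $u\in H^1_0(\Omega)$ with $\operatorname{div}(\tilde a\nabla u)\in L^2(\Omega)$, for $\tilde a=a(\tfrac{\cdot}{\varepsilon})$ (any $\varepsilon>0$) and $\tilde a=a^h$. $C^\beta(\overline\Omega)$ is the usual Hölder space. *)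

theory Defs
  imports "HOL-Analysis.Analysis"
begin

text \<open>Elements of $L^2(\Omega)$ and of the spaces built from it are represented by functions on
  $\mathbb{R}^3$, of which only the restriction to $\Omega$ up to null sets matters.  All norms
  below are invariant under almost everywhere equality, so the ``metrics'' are pseudometrics on
  representatives and are metrics on the actual spaces.\<close>

type_synonym pt = "real^3"
type_synonym scal = "pt \<Rightarrow> real"
type_synonym coeff = "pt \<Rightarrow> real^3^3"
type_synonym state = "scal \<times> scal"


subsection \<open>Smooth functions and smooth domains\<close>

definition pd :: "3 \<Rightarrow> scal \<Rightarrow> scal" where
  "pd i \<phi> = (\<lambda>x. frechet_derivative \<phi> (at x) (axis i 1))"

primrec pds :: "3 list \<Rightarrow> scal \<Rightarrow> scal" where
  "pds [] \<phi> = \<phi>"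
| "pds (i # is) \<phi> = pd i (pds is \<phi>)"

definition smooth :: "scal \<Rightarrow> bool" where
  "smooth \<phi> \<longleftrightarrow> (\<forall>is x. pds is \<phi> differentiable (at x))"

definition smooth_bounded_domain :: "pt set \<Rightarrow> bool" where
  "smooth_bounded_domain \<Omega> \<longleftrightarrow>
     open \<Omega> \<and> connected \<Omega> \<and> bounded \<Omega> \<and> \<Omega> \<noteq> {} \<and>
     (\<forall>z\<in>frontier \<Omega>. \<exists>\<rho> r. smooth \<rho> \<and> 0 < r \<and> (\<exists>i. pd i \<rho> z \<noteq> 0) \<and>
        \<Omega> \<inter> ball z r = {x \<in> ball z r. \<rho> x < 0})"

definition test_fun :: "pt set \<Rightarrow> scal set" where
  "test_fun \<Omega> = {\<phi>. smooth \<phi> \<and> compact (closure {x. \<phi> x \<noteq> 0}) \<and> closure {x. \<phi> x \<noteq> 0} \<subseteq> \<Omega>}"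


subsection \<open>Lebesgue and Sobolev spaces\<close>

definition L2 :: "pt set \<Rightarrow> scal set" where
  "L2 \<Omega> = {u \<in> borel_measurable (lebesgue_on \<Omega>). integrable (lebesgue_on \<Omega>) (\<lambda>x. (u x)\<^sup>2)}"

definition L2_inner :: "pt set \<Rightarrow> scal \<Rightarrow> scal \<Rightarrow> real" where
  "L2_inner \<Omega> u v = (LINT x|lebesgue_on \<Omega>. u x * v x)"

definition L2_norm :: "pt set \<Rightarrow> scal \<Rightarrow> real" where
  "L2_norm \<Omega> u = sqrt (L2_inner \<Omega> u u)"

definition L2_enorm :: "pt set \<Rightarrow> scal \<Rightarrow> ennreal" where
  "L2_enorm \<Omega> u = (if u \<in> L2 \<Omega> then ennreal (L2_norm \<Omega> u) else \<infinity>)"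

definition L1_loc :: "pt set \<Rightarrow> scal set" where
  "L1_loc \<Omega> = {u. \<forall>K. compact K \<and> K \<subseteq> \<Omega> \<longrightarrow> set_integrable lebesgue K u}"

definition has_weak_pd :: "pt set \<Rightarrow> 3 \<Rightarrow> scal \<Rightarrow> scal \<Rightarrow> bool" where
  "has_weak_pd \<Omega> i u d \<longleftrightarrow> u \<in> L1_loc \<Omega> \<and> d \<in> L1_loc \<Omega> \<and>
     (\<forall>\<phi>\<in>test_fun \<Omega>. L2_inner \<Omega> u (pd i \<phi>) = - L2_inner \<Omega> d \<phi>)"

definition weak_pd :: "pt set \<Rightarrow> 3 \<Rightarrow> scal \<Rightarrow> scal" where
  "weak_pd \<Omega> i u = (SOME d. has_weak_pd \<Omega> i u d)"

definition grad :: "pt set \<Rightarrow> scal \<Rightarrow> pt \<Rightarrow> real^3" where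
  "grad \<Omega> u x = (\<chi> i. weak_pd \<Omega> i u x)"

definition has_weak_div :: "pt set \<Rightarrow> (pt \<Rightarrow> real^3) \<Rightarrow> scal \<Rightarrow> bool" where
  "has_weak_div \<Omega> F d \<longleftrightarrow> (\<forall>i. (\<lambda>x. F x $ i) \<in> L1_loc \<Omega>) \<and> d \<in> L1_loc \<Omega> \<and>
     (\<forall>\<phi>\<in>test_fun \<Omega>. (\<Sum>i\<in>UNIV. L2_inner \<Omega> (\<lambda>x. F x $ i) (pd i \<phi>)) = - L2_inner \<Omega> d \<phi>)"

definition H1 :: "pt set \<Rightarrow> scal set" where
  "H1 \<Omega> = {u \<in> L2 \<Omega>. \<forall>i. \<exists>d\<in>L2 \<Omega>. has_weak_pd \<Omega> i u d}"

definition grad_norm :: "pt set \<Rightarrow> scal \<Rightarrow> real" where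
  "grad_norm \<Omega> u = sqrt (\<Sum>i\<in>UNIV. (L2_norm \<Omega> (weak_pd \<Omega> i u))\<^sup>2)"

definition H1_norm :: "pt set \<Rightarrow> scal \<Rightarrow> real" where
  "H1_norm \<Omega> u = sqrt ((L2_norm \<Omega> u)\<^sup>2 + (grad_norm \<Omega> u)\<^sup>2)"

definition H10 :: "pt set \<Rightarrow> scal set" where
  "H10 \<Omega> = {u \<in> H1 \<Omega>. \<exists>\<phi>. (\<forall>n::nat. \<phi> n \<in> test_fun \<Omega>) \<and>
     (\<lambda>n. H1_norm \<Omega> (\<phi> n - u)) \<longlonglongrightarrow> 0}"

definition H10_enorm :: "pt set \<Rightarrow> scal \<Rightarrow> ennreal" where
  "H10_enorm \<Omega> u = (if u \<in> H10 \<Omega> then ennreal (grad_norm \<Omega> u) else \<infinity>)"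

definition H2 :: "pt set \<Rightarrow> scal set" where
  "H2 \<Omega> = {u \<in> H1 \<Omega>. \<forall>i. weak_pd \<Omega> i u \<in> H1 \<Omega>}"

definition H2_enorm :: "pt set \<Rightarrow> scal \<Rightarrow> ennreal" where
  "H2_enorm \<Omega> u = (if u \<in> H2 \<Omega>
     then ennreal (sqrt ((H1_norm \<Omega> u)\<^sup>2 + (\<Sum>i\<in>UNIV. (grad_norm \<Omega> (weak_pd \<Omega> i u))\<^sup>2)))
     else \<infinity>)"

text \<open>Only needed on $L^2(\Omega) \subset H^{-1}(\Omega)$: the norm of the functional
  $\varphi \mapsto \int_\Omega v \varphi$ on $H^1_0(\Omega)$ normed by $\|\nabla\varphi\|$.\<close>

definition Hm1_norm :: "pt set \<Rightarrow> scal \<Rightarrow> real" where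
  "Hm1_norm \<Omega> v = (SUP \<phi>\<in>{\<phi> \<in> H10 \<Omega>. grad_norm \<Omega> \<phi> \<le> 1}. \<bar>L2_inner \<Omega> v \<phi>\<bar>)"

text \<open>The norm of $C^\beta(\overline\Omega)$, evaluated at the (unique) representative of \<open>u\<close> that is
  continuous on the closure; it is infinite if there is none.  For $\beta = 0$ this is the maximum
  norm.  Meant for $0 \le \beta \le 1$.\<close>

definition Holder_enorm :: "pt set \<Rightarrow> real \<Rightarrow> scal \<Rightarrow> ennreal" where
  "Holder_enorm \<Omega> \<beta> u =
     (INF v\<in>{v. continuous_on (closure \<Omega>) v \<and> (AE x in lebesgue_on \<Omega>. v x = u x)}.
        (SUP x\<in>closure \<Omega>. ennreal \<bar>v x\<bar>) +
        (if \<beta> = 0 then 0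
         else SUP (x, y)\<in>{(x, y). x \<in> closure \<Omega> \<and> y \<in> closure \<Omega> \<and> x \<noteq> y}.
                ennreal (\<bar>v x - v y\<bar> / dist x y powr \<beta>)))"

definition Holder2_enorm :: "pt set \<Rightarrow> real \<Rightarrow> state \<Rightarrow> ennreal" where
  "Holder2_enorm \<Omega> \<beta> \<xi> = Holder_enorm \<Omega> \<beta> (fst \<xi>) + Holder_enorm \<Omega> \<beta> (snd \<xi>)"

definition H22_enorm :: "pt set \<Rightarrow> state \<Rightarrow> ennreal" where
  "H22_enorm \<Omega> \<xi> = H2_enorm \<Omega> (fst \<xi>) + H2_enorm \<Omega> (snd \<xi>)"

definition energy_space :: "pt set \<Rightarrow> state set" where
  "energy_space \<Omega> = H10 \<Omega> \<times> L2 \<Omega>"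

definition energy_norm :: "pt set \<Rightarrow> state \<Rightarrow> real" where
  "energy_norm \<Omega> \<xi> = sqrt ((grad_norm \<Omega> (fst \<xi>))\<^sup>2 + (L2_norm \<Omega> (snd \<xi>))\<^sup>2)"

definition energy_m1_norm :: "pt set \<Rightarrow> state \<Rightarrow> real" where
  "energy_m1_norm \<Omega> \<xi> = sqrt ((L2_norm \<Omega> (fst \<xi>))\<^sup>2 + (Hm1_norm \<Omega> (snd \<xi>))\<^sup>2)"


subsection \<open>Coefficients, homogenised matrix, operators\<close>

definition periodic :: "(pt \<Rightarrow> 'b) \<Rightarrow> bool" where
  "periodic F \<longleftrightarrow> (\<forall>k y. F (y + axis k 1) = F y)"

definition admissible_coeff :: "real \<Rightarrow> coeff \<Rightarrow> bool" where
  "admissible_coeff \<nu> a \<longleftrightarrow>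
     (\<forall>i j. (\<lambda>y. a y $ i $ j) \<in> borel_measurable lebesgue \<and>
            (\<exists>C. AE y in lebesgue. \<bar>a y $ i $ j\<bar> \<le> C)) \<and>
     (\<forall>y i j. a y $ i $ j = a y $ j $ i) \<and>
     periodic a \<and>
     (\<forall>y \<eta>. \<nu> * (norm \<eta>)\<^sup>2 \<le> (a y *v \<eta>) \<bullet> \<eta> \<and> (a y *v \<eta>) \<bullet> \<eta> \<le> inverse \<nu> * (norm \<eta>)\<^sup>2)"

definition unit_cell :: "pt set" where
  "unit_cell = {y. \<forall>i. 0 \<le> y $ i \<and> y $ i < 1}"

definition H1_per :: "scal set" where
  "H1_per = {u. periodic u \<and> u \<in> L2 unit_cell \<and> (\<forall>k. \<exists>d\<in>L2 unit_cell. has_weak_pd UNIV k u d)}"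

text \<open>Weak form of $-\mathrm{div}(a \nabla N_i) = \mathrm{div}(a e_i)$, tested with periodic functions.\<close>

definition cell_solution :: "coeff \<Rightarrow> (3 \<Rightarrow> scal) \<Rightarrow> bool" where
  "cell_solution a N \<longleftrightarrow>
     (\<forall>i. N i \<in> H1_per \<and> (LINT y|lebesgue_on unit_cell. N i y) = 0 \<and>
       (\<forall>\<phi>\<in>H1_per. (LINT y|lebesgue_on unit_cell. (a y *v grad UNIV (N i) y) \<bullet> grad UNIV \<phi> y)
                  = - (LINT y|lebesgue_on unit_cell. (a y *v axis i 1) \<bullet> grad UNIV \<phi> y)))"

definition hom_matrix :: "coeff \<Rightarrow> (3 \<Rightarrow> scal) \<Rightarrow> real^3^3" where
  "hom_matrix a N = (\<chi> i j. LINT y|lebesgue_on unit_cell.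
     a y $ i $ j + (\<Sum>k\<in>UNIV. a y $ i $ k * weak_pd UNIV k (N j) y))"

definition osc_coeff :: "coeff \<Rightarrow> real \<Rightarrow> coeff" where
  "osc_coeff a \<epsilon> = (\<lambda>x. a (x /\<^sub>R \<epsilon>))"

definition hom_coeff :: "coeff \<Rightarrow> (3 \<Rightarrow> scal) \<Rightarrow> coeff" where
  "hom_coeff a N = (\<lambda>x. hom_matrix a N)"

definition flux :: "pt set \<Rightarrow> coeff \<Rightarrow> scal \<Rightarrow> pt \<Rightarrow> real^3" where
  "flux \<Omega> b u = (\<lambda>x. b x *v grad \<Omega> u x)"

definition dirichlet_form :: "pt set \<Rightarrow> coeff \<Rightarrow> scal \<Rightarrow> scal \<Rightarrow> real" where
  "dirichlet_form \<Omega> b u \<phi> = (LINT x|lebesgue_on \<Omega>. flux \<Omega> b u x \<bullet> grad \<Omega> \<phi> x)"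

text \<open>The inverse of $u \mapsto -\mathrm{div}(b \nabla u)$ with Dirichlet boundary conditions.\<close>

definition dirichlet_inv :: "pt set \<Rightarrow> coeff \<Rightarrow> scal \<Rightarrow> scal" where
  "dirichlet_inv \<Omega> b h =
     (SOME u. u \<in> H10 \<Omega> \<and> (\<forall>\<phi>\<in>H10 \<Omega>. dirichlet_form \<Omega> b u \<phi> = L2_inner \<Omega> h \<phi>))"

definition L2_opnorm :: "pt set \<Rightarrow> (scal \<Rightarrow> scal) \<Rightarrow> real" where
  "L2_opnorm \<Omega> T = (SUP h\<in>{h \<in> L2 \<Omega>. L2_norm \<Omega> h \<le> 1}. L2_norm \<Omega> (T h))"

definition resolvent_gap :: "pt set \<Rightarrow> coeff \<Rightarrow> (3 \<Rightarrow> scal) \<Rightarrow> real \<Rightarrow> real" where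
  "resolvent_gap \<Omega> a N \<epsilon> = L2_opnorm \<Omega>
     (\<lambda>h. dirichlet_inv \<Omega> (osc_coeff a \<epsilon>) h - dirichlet_inv \<Omega> (hom_coeff a N) h)"

text \<open>The Hoelder estimate for $\mathrm{div}(\tilde a \nabla u) \in L^2(\Omega)$, with a constant
  that is uniform in the oscillation parameter.\<close>

definition Holder_regularity :: "pt set \<Rightarrow> coeff \<Rightarrow> (3 \<Rightarrow> scal) \<Rightarrow> real \<Rightarrow> bool" where
  "Holder_regularity \<Omega> a N \<alpha> \<longleftrightarrow>
     (\<exists>C. \<forall>b \<in> insert (hom_coeff a N) (osc_coeff a ` {0<..}). \<forall>u\<in>H10 \<Omega>. \<forall>d\<in>L2 \<Omega>.
        has_weak_div \<Omega> (flux \<Omega> b u) d \<longrightarrow> Holder_enorm \<Omega> \<alpha> u \<le> ennreal (C * L2_norm \<Omega> d))"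


subsection \<open>The damped wave equation and its solution semigroup\<close>

definition admissible_nonlinearity :: "(real \<Rightarrow> real) \<Rightarrow> real \<Rightarrow> real \<Rightarrow> real \<Rightarrow> bool" where
  "admissible_nonlinearity f K1 K2 K3 \<longleftrightarrow>
     0 < K1 \<and> 0 < K2 \<and> 0 < K3 \<and>
     (\<forall>s. f field_differentiable at s) \<and> (\<forall>s. deriv f field_differentiable at s) \<and>
     continuous_on UNIV (deriv (deriv f)) \<and>
     (\<forall>s. f s * s \<ge> - K1) \<and> (\<forall>s. deriv f s \<ge> - K2) \<and>
     (\<forall>s. \<bar>deriv (deriv f) s\<bar> \<le> K3 * (1 + \<bar>s\<bar>)) \<and> f 0 = 0"

text \<open>\<open>w t\<close> is the pair $(u(t), \partial_t u(t))$.  The equation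
  $\partial_t^2 u + \gamma \partial_t u - \mathrm{div}(b \nabla u) + f(u) = g$ is understood as an
  ordinary differential equation in time after testing with $\varphi \in C_c^\infty(\Omega)$; by
  continuity of \<open>w\<close> in the energy space all terms tested this way are continuous in time.\<close>

definition energy_solution ::
  "pt set \<Rightarrow> real \<Rightarrow> coeff \<Rightarrow> (real \<Rightarrow> real) \<Rightarrow> scal \<Rightarrow> state \<Rightarrow> (real \<Rightarrow> state) \<Rightarrow> bool" where
  "energy_solution \<Omega> \<gamma> b f g \<xi> w \<longleftrightarrow>
     (\<forall>t\<ge>0. w t \<in> energy_space \<Omega> \<and>
            ((\<lambda>s. energy_norm \<Omega> (w s - w t)) \<longlongrightarrow> 0) (at t within {0..})) \<and>
     energy_norm \<Omega> (w 0 - \<xi>) = 0 \<and>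
     (\<forall>\<phi>\<in>test_fun \<Omega>. \<forall>t\<ge>0.
        ((\<lambda>s. L2_inner \<Omega> (fst (w s)) \<phi>) has_real_derivative L2_inner \<Omega> (snd (w t)) \<phi>)
          (at t within {0..}) \<and>
        ((\<lambda>s. L2_inner \<Omega> (snd (w s)) \<phi>) has_real_derivative
          (L2_inner \<Omega> g \<phi> - \<gamma> * L2_inner \<Omega> (snd (w t)) \<phi>
            - dirichlet_form \<Omega> b (fst (w t)) \<phi> - L2_inner \<Omega> (f \<circ> fst (w t)) \<phi>))
          (at t within {0..}))"

definition semiflow ::
  "pt set \<Rightarrow> real \<Rightarrow> coeff \<Rightarrow> (real \<Rightarrow> real) \<Rightarrow> scal \<Rightarrow> real \<Rightarrow> state \<Rightarrow> state" where
  "semiflow \<Omega> \<gamma> b f g t \<xi> = (SOME w. energy_solution \<Omega> \<gamma> b f g \<xi> w) t"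


subsection \<open>Distances between sets, dimension, exponential attractors\<close>

definition hdist :: "('a::minus \<Rightarrow> ennreal) \<Rightarrow> 'a set \<Rightarrow> 'a set \<Rightarrow> ennreal" where
  "hdist nrm A B = (SUP x\<in>A. INF y\<in>B. nrm (x - y))"

definition sym_hdist :: "('a::minus \<Rightarrow> ennreal) \<Rightarrow> 'a set \<Rightarrow> 'a set \<Rightarrow> ennreal" where
  "sym_hdist nrm A B = max (hdist nrm A B) (hdist nrm B A)"

definition energy_hdist :: "pt set \<Rightarrow> state set \<Rightarrow> state set \<Rightarrow> ennreal" where
  "energy_hdist \<Omega> = hdist (\<lambda>\<zeta>. ennreal (energy_norm \<Omega> \<zeta>))"

definition energy_bounded :: "pt set \<Rightarrow> state set \<Rightarrow> bool" where
  "energy_bounded \<Omega> B \<longleftrightarrow> B \<subseteq> energy_space \<Omega> \<and> bdd_above (energy_norm \<Omega> ` B)"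

definition energy_set_norm :: "pt set \<Rightarrow> state set \<Rightarrow> real" where
  "energy_set_norm \<Omega> B = (SUP \<xi>\<in>B. energy_norm \<Omega> \<xi>)"

definition energy_compact :: "pt set \<Rightarrow> state set \<Rightarrow> bool" where
  "energy_compact \<Omega> A \<longleftrightarrow> A \<subseteq> energy_space \<Omega> \<and>
     (\<forall>x::nat \<Rightarrow> state. range x \<subseteq> A \<longrightarrow>
        (\<exists>l\<in>A. \<exists>r. strict_mono r \<and> (\<lambda>n. energy_norm \<Omega> (x (r n) - l)) \<longlonglongrightarrow> 0))"

text \<open>Upper box-counting dimension: $\limsup_{r \to 0} \ln N_r(A) / \ln(1/r)$, where $N_r(A)$ is the
  least number of $r$-balls covering \<open>A\<close>; it is infinite if \<open>A\<close> is not totally bounded.\<close>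

definition fractal_dim :: "pt set \<Rightarrow> state set \<Rightarrow> ereal" where
  "fractal_dim \<Omega> A = Limsup (at_right 0) (\<lambda>r::real.
     (INF F\<in>{F. finite F \<and> F \<subseteq> energy_space \<Omega> \<and> (\<forall>\<xi>\<in>A. \<exists>\<eta>\<in>F. energy_norm \<Omega> (\<xi> - \<eta>) < r)}.
        ereal (ln (real (card F)))) / ereal (ln (1 / r)))"

text \<open>Invariance is stated up to equality in the energy space, because \<open>A\<close> need not contain every
  representative of its elements.\<close>

definition exponential_attractor :: "pt set \<Rightarrow> (real \<Rightarrow> state \<Rightarrow> state) \<Rightarrow> state set \<Rightarrow> bool" where
  "exponential_attractor \<Omega> S A \<longleftrightarrow>
     energy_compact \<Omega> A \<and> fractal_dim \<Omega> A < \<infinity> \<and>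
     (\<forall>t\<ge>0. \<forall>\<xi>\<in>A. \<exists>\<eta>\<in>A. energy_norm \<Omega> (S t \<xi> - \<eta>) = 0) \<and>
     (\<exists>M \<sigma>. mono_on {0..} M \<and> 0 < \<sigma> \<and>
        (\<forall>B t. energy_bounded \<Omega> B \<and> 0 \<le> t \<longrightarrow>
           energy_hdist \<Omega> (S t ` B) A \<le> ennreal (M (energy_set_norm \<Omega> B) * exp (- \<sigma> * t))))"

end

theory Submission
  imports Defs
begin

text \<open>
  Fix $\xi \in \mathcal{M}^\varepsilon$ and $\eta \in \mathcal{M}^0$ that are close in
  $\mathcal{E}^{-1}$, at distance at most $x$ with $x \gtrsim \|A_\varepsilon^{-1} -
  A_0^{-1}\|^{\varkappa}$. Both are bounded in $C^\alpha$ by the Hoelder estimate. The corrector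
  $u = A_\varepsilon^{-1} A_0 \eta^2$ satisfies $\|u - \eta^2\| \lesssim x$, and for
  $v = \xi^2 - u$ the image $A_\varepsilon v$ is bounded in $L^2$, so that
  $\|\nabla v\|^2 \lesssim \|v\|$ and $\|v\|^2 \lesssim x \|\nabla v\|$, whence
  $\|\nabla v\|^3 \lesssim x$. A $C^\alpha$ function whose modulus is $h$ at a point stays of size
  $h/2$ on a ball of radius $r \sim h^{1/\alpha}$, a fixed part of which lies in the smooth domain;
  Hardy's inequality then gives $h^2 r \lesssim \|\nabla v\|^2$, and similarly
  $h^2 r^3 \lesssim \|w\|^2$ for $w = \xi^1 - \eta^1$ and $w = u - \eta^2$. For
  $\alpha \le 1/4$ both bounds yield $h \lesssim x^{\alpha/(2+\alpha)}$, and interpolation between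
  the maximum norm and $C^\alpha$ gives the exponent $(\alpha-\beta)/(2+\alpha)$ in $C^\beta$.
  That the resolvents are the true inverses, which the norm of their difference presupposes, uses
  the solvability of the Dirichlet problem, hence also the ellipticity of the homogenised matrix.
\<close>

subsection \<open>Smooth functions\<close>

text \<open>The difference of \<open>\<xi>2\<close> and \<open>\<eta>2\<close> resists a direct
  energy estimate: each is controlled by its own operator, and the oscillating operator applied to
  \<open>\<eta>2\<close> need not give an L2 function. The corrector trades one operator for the
  other at the price of one resolvent difference; what is left involves a single operator with data
  in L2. Hardy's inequality plays the part of a Sobolev embedding. Its weight, regularised at the
  scale of the ball on which the function is large, is bounded by the inverse radius, so one lemma
  with a parameter m yields both the gradient estimate (m = 1) and the L2 estimate (m = 3). Elements
  of all spaces are plain functions, and weak derivatives and resolvents are picked by choice.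
  Linearity therefore holds only almost everywhere, forms are only semidefinite, and every supremum
  of reals must first be shown to be bounded. The final function of the norm of \<open>g\<close> has
  to be fixed before \<open>g\<close>, \<epsilon> and the attractors; the pair estimate is therefore
  proved with one constant for each integer bound on the data.\<close>

lemma pds_append: "pds (is @ js) \<phi> = pds is (pds js \<phi>)"
  by (induction "is") auto

lemma smooth_imp_differentiable: "smooth \<phi> \<Longrightarrow> \<phi> differentiable (at x)"
  unfolding smooth_def by (metis pds.simps(1))

lemma smooth_pd: "smooth \<phi> \<Longrightarrow> smooth (pd i \<phi>)"
  unfolding smooth_def using pds_append[of _ "[i]" \<phi>] by (metis pds.simps)

text \<open>\<open>smooth\<close> quantifies over all lists of partial derivatives. An invariant
  class replaces formulas for the higher ones: iterated derivatives never leave \<open>P\<close>, so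
  differentiability within \<open>P\<close> suffices.\<close>

lemma smooth_coinduct:
  assumes "\<phi> \<in> P" "\<And>\<phi> x. \<phi> \<in> P \<Longrightarrow> \<phi> differentiable (at x)" "\<And>\<phi> i. \<phi> \<in> P \<Longrightarrow> pd i \<phi> \<in> P"
  shows "smooth \<phi>"
proof -
  have "pds is \<phi> \<in> P" for "is"
    by (induction "is") (use assms in auto)
  then show ?thesis
    unfolding smooth_def using assms(2) by blast
qed

lemma continuous_on_smooth: "smooth \<phi> \<Longrightarrow> continuous_on A \<phi>"
  by (meson continuous_at_imp_continuous_on differentiable_imp_continuous_within smooth_imp_differentiable)

lemma pd_eqI: "(\<phi> has_derivative D) (at x) \<Longrightarrow> pd i \<phi> x = D (axis i 1)"
  by (simp add: pd_def frechet_derivative_at[symmetric])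

lemma pd_add:
  assumes "\<And>x. f differentiable (at x)" "\<And>x. g differentiable (at x)"
  shows "pd i (\<lambda>x. f x + g x) = (\<lambda>x. pd i f x + pd i g x)"
  using assms unfolding frechet_derivative_works
  by (auto simp: fun_eq_iff pd_def[of i f] pd_def[of i g] intro!: pd_eqI has_derivative_add)

lemma pd_mult:
  assumes "f differentiable (at x)" "g differentiable (at x)"
  shows "pd i (\<lambda>x. f x * g x) x = f x * pd i g x + pd i f x * g x"
  using assms unfolding frechet_derivative_works pd_def[of i f] pd_def[of i g]
  by (rule pd_eqI[OF has_derivative_mult])

lemma pd_const: "pd i (\<lambda>x. c) = (\<lambda>x. 0)"
  by (auto simp: fun_eq_iff intro!: pd_eqI[where D="\<lambda>x. 0"])

lemma pd_cmult:
  assumes "f differentiable (at x)"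
  shows "pd i (\<lambda>x. c * f x) x = c * pd i f x"
  using pd_mult[of "\<lambda>x. c" x f i] assms by (simp add: pd_const)

text \<open>Constants count only if \<open>G\<close> contains them. The set is meant as an invariant
  class for \<open>smooth_coinduct\<close>.\<close>

inductive_set alg :: "scal set \<Rightarrow> scal set" for G where
  alg_base: "\<phi> \<in> G \<Longrightarrow> \<phi> \<in> alg G"
| alg_add: "\<phi> \<in> alg G \<Longrightarrow> \<psi> \<in> alg G \<Longrightarrow> (\<lambda>x. \<phi> x + \<psi> x) \<in> alg G"
| alg_mult: "\<phi> \<in> alg G \<Longrightarrow> \<psi> \<in> alg G \<Longrightarrow> (\<lambda>x. \<phi> x * \<psi> x) \<in> alg G"

text \<open>By the sum and product rules, partial derivatives preserve the algebra as soon as they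
  map its generators into it. With all smooth functions as generators this gives closure under sums
  and products; with explicit families it gives concrete smooth functions.\<close>

lemma smooth_alg:
  assumes "\<phi> \<in> alg G" and d: "\<And>g x. g \<in> G \<Longrightarrow> g differentiable (at x)"
    and p: "\<And>g i. g \<in> G \<Longrightarrow> pd i g \<in> alg G"
  shows "smooth \<phi>"
proof (rule smooth_coinduct[OF assms(1)])
  show D: "\<phi> differentiable (at x)" if "\<phi> \<in> alg G" for \<phi> x
    using that by induction (auto intro: d differentiable_add differentiable_mult)
  show "pd i \<phi> \<in> alg G" if "\<phi> \<in> alg G" for \<phi> i
    using that
  proof induction
    case (alg_add \<phi> \<psi>)
    then show ?case by (simp add: pd_add D alg.alg_add)
  next
    case (alg_mult \<phi> \<psi>)
    have "pd i (\<lambda>x. \<phi> x * \<psi> x) = (\<lambda>x. \<phi> x * pd i \<psi> x + pd i \<phi> x * \<psi> x)"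
      using alg_mult.hyps by (auto simp: pd_mult D)
    then show ?case using alg_mult by (simp add: alg.alg_add alg.alg_mult)
  qed (use p in auto)
qed

lemma smooth_const: "smooth (\<lambda>x. c)"
  by (rule smooth_coinduct[where P="range (\<lambda>c x. c)"]) (auto simp: pd_const)

lemma smooth_add: "smooth f \<Longrightarrow> smooth g \<Longrightarrow> smooth (\<lambda>x. f x + g x)"
  by (rule smooth_alg[where G="Collect smooth"])
    (simp_all add: alg.intros smooth_pd smooth_imp_differentiable)

lemma smooth_mult: "smooth f \<Longrightarrow> smooth g \<Longrightarrow> smooth (\<lambda>x. f x * g x)"
  by (rule smooth_alg[where G="Collect smooth"])
    (simp_all add: alg.intros smooth_pd smooth_imp_differentiable)

lemma smooth_cmult: "smooth f \<Longrightarrow> smooth (\<lambda>x. c * f x)"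
  by (simp add: smooth_const smooth_mult)

lemma smooth_prod: "finite I \<Longrightarrow> (\<And>i. i \<in> I \<Longrightarrow> smooth (f i)) \<Longrightarrow> smooth (\<lambda>x. \<Prod>i\<in>I. f i x)"
  by (induction I rule: finite_induct) (auto simp: smooth_const smooth_mult)

section \<open>Bump functions built from functions of one coordinate\<close>

lemma coordinate_composition:
  fixes f :: "real \<Rightarrow> real"
  assumes "(f has_real_derivative D) (at (c * x $ i + d))"
  shows "(\<lambda>x::pt. f (c * x $ i + d)) differentiable (at x)"
    and "pd j (\<lambda>x::pt. f (c * x $ i + d)) x = (if j = i then c * D else 0)"
proof -
  have "((\<lambda>x::pt. c * x $ i + d) has_derivative (\<lambda>h. c * h $ i)) (at x)"
    by (auto intro!: derivative_eq_intros bounded_linear_imp_has_derivative bounded_linear_vec_nth)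
  from has_derivative_compose[OF this assms[unfolded has_field_derivative_def]]
  have *: "((\<lambda>x::pt. f (c * x $ i + d)) has_derivative (\<lambda>h. D * (c * h $ i))) (at x)" .
  then show "(\<lambda>x::pt. f (c * x $ i + d)) differentiable (at x)"
    by (auto simp: differentiable_def)
  show "pd j (\<lambda>x::pt. f (c * x $ i + d)) x = (if j = i then c * D else 0)"
    using pd_eqI[OF *, of j] by (auto simp: axis_def)
qed

text \<open>The classical flat function exp(-1/t), with a power of 1/t attached so that the family
  is closed under differentiation up to linear combinations.\<close>

definition flat_exp :: "nat \<Rightarrow> real \<Rightarrow> real" where
  "flat_exp k t = (if t > 0 then exp (- 1 / t) / t ^ k else 0)"

lemma tendsto_flat_exp: "(flat_exp k \<longlongrightarrow> 0) (at_right 0)"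
proof -
  have "((\<lambda>t. (inverse t) ^ k / exp (inverse t)) \<longlongrightarrow> (0::real)) (at_right 0)"
    using filterlim_compose[OF tendsto_power_div_exp_0 filterlim_inverse_at_top_right] .
  then show ?thesis
    by (rule filterlim_cong[THEN iffD1, rotated 3])
      (auto simp: eventually_at_filter flat_exp_def exp_minus field_simps power_inverse)
qed

lemma DERIV_flat_exp:
  "(flat_exp k has_real_derivative flat_exp (k + 2) t - real k * flat_exp (k + 1) t) (at t)"
proof -
  consider "t > 0" | "t < 0" | "t = 0" by linarith
  then show ?thesis
  proof cases
    case 1
    have "((\<lambda>t. exp (- 1 / t) / t ^ k) has_real_derivative
        flat_exp (k + 2) t - real k * flat_exp (k + 1) t) (at t)"
    proof (cases k)
      case 0
      then show ?thesis using 1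
        by (auto intro!: derivative_eq_intros simp: flat_exp_def field_simps power2_eq_square)
    next
      case (Suc m)
      show ?thesis using 1 unfolding Suc
        by (auto intro!: derivative_eq_intros simp del: power_Suc simp: flat_exp_def divide_simps)
          (auto simp: field_simps power2_eq_square)
    qed
    then show ?thesis
      by (rule has_field_derivative_transform_within_open[where S="{0<..}"]) (use 1 in \<open>auto simp: flat_exp_def\<close>)
  next
    case 2
    have "((\<lambda>t. 0) has_real_derivative 0) (at t)" by simp
    then have "(flat_exp k has_real_derivative 0) (at t)"
      by (rule has_field_derivative_transform_within_open[where S="{..<0}"]) (use 2 in \<open>auto simp: flat_exp_def\<close>)
    then show ?thesis using 2 by (simp add: flat_exp_def)
  next
    case 3
    \<comment> \<open>From the right, the difference quotient at 0 is
      \<open>flat_exp (Suc k)\<close> itself, whose limit is already known.\<close>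
    have "((\<lambda>y. (flat_exp k y - flat_exp k 0) / (y - 0)) \<longlongrightarrow> 0) (at 0)"
    proof (rule filterlim_split_at)
      show "((\<lambda>y. (flat_exp k y - flat_exp k 0) / (y - 0)) \<longlongrightarrow> 0) (at_left 0)"
        by (rule tendsto_eventually) (auto simp: eventually_at_filter flat_exp_def)
      show "((\<lambda>y. (flat_exp k y - flat_exp k 0) / (y - 0)) \<longlongrightarrow> 0) (at_right 0)"
        using tendsto_flat_exp[of "Suc k"]
        by (rule filterlim_cong[THEN iffD1, rotated 3])
          (auto simp: eventually_at_filter flat_exp_def field_simps)
    qed
    then show ?thesis
      using 3 by (simp add: has_field_derivative_iff flat_exp_def)
  qed
qed

lemma smooth_flat_exp: "smooth (\<lambda>x. flat_exp k (c * x $ i + d))"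
proof -
  \<comment> \<open>Constants belong to \<open>G\<close> because the derivative of a generator
    carries the coefficients \<open>c\<close> and \<open>- real k\<close>.\<close>
  define G :: "scal set" where
    "G = {g. (\<exists>k c i d. g = (\<lambda>x. flat_exp k (c * x $ i + d))) \<or> (\<exists>c. g = (\<lambda>x. c))}"
  have F: "(\<lambda>x. flat_exp k (c * x $ i + d)) \<in> alg G" for k c i d
    by (rule alg_base) (unfold G_def mem_Collect_eq, blast)
  have C: "(\<lambda>x. c) \<in> alg G" for c
    by (rule alg_base) (unfold G_def mem_Collect_eq, blast)
  have P: "pd j (\<lambda>x. flat_exp k (c * x $ i + d)) \<in> alg G" for j k c i d
  proof -
    have "pd j (\<lambda>x. flat_exp k (c * x $ i + d)) =
       (\<lambda>x. (if j = i then c else 0) * (flat_exp (k + 2) (c * x $ i + d) + - real k * flat_exp (k + 1) (c * x $ i + d)))"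
      by (auto simp: fun_eq_iff coordinate_composition(2)[OF DERIV_flat_exp])
    then show ?thesis by (simp only:) (intro alg_mult alg_add C F)
  qed
  show ?thesis
  proof (rule smooth_alg[OF F])
    fix g x i assume g: "g \<in> G"
    show "g differentiable (at x)"
      using g coordinate_composition(1)[OF DERIV_flat_exp] unfolding G_def by fastforce
    show "pd i g \<in> alg G"
      using g P C unfolding G_def by (auto simp: pd_const)
  qed
qed

lemma flat_exp_0_bounds: "0 \<le> flat_exp 0 t" "flat_exp 0 t \<le> 1"
  by (auto simp: flat_exp_def)

lemma continuous_on_flat_exp: "continuous_on A (flat_exp k)"
  using DERIV_flat_exp DERIV_isCont continuous_at_imp_continuous_on by blast

lemma box_approximation:
  fixes a b :: pt
  obtains \<phi> :: "nat \<Rightarrow> scal" where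
    "\<And>n. smooth (\<phi> n)" "\<And>n x. 0 \<le> \<phi> n x" "\<And>n x. \<phi> n x \<le> 1"
    "\<And>n x. x \<notin> box a b \<Longrightarrow> \<phi> n x = 0" "\<And>x. x \<in> box a b \<Longrightarrow> (\<lambda>n. \<phi> n x) \<longlonglongrightarrow> 1"
proof
  \<comment> \<open>Inside the box every argument is n times a positive number, so the factors tend
    to 1; outside, some argument is nonpositive and its factor is 0. For n = 0 the whole function is
    0, which is harmless.\<close>
  define \<phi> :: "nat \<Rightarrow> scal" where "\<phi> n x = (\<Prod>i\<in>UNIV. flat_exp 0 (real n * x $ i + - real n * a $ i) *
      flat_exp 0 (- real n * x $ i + real n * b $ i))" for n x
  show "smooth (\<phi> n)" for n
    unfolding \<phi>_def by (intro smooth_prod smooth_mult smooth_flat_exp) auto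
  show "0 \<le> \<phi> n x" "\<phi> n x \<le> 1" for n x
    unfolding \<phi>_def by (auto intro!: prod_nonneg prod_le_1 mult_nonneg_nonneg mult_le_one flat_exp_0_bounds)
  show "\<phi> n x = 0" if "x \<notin> box a b" for n x
  proof -
    obtain i where "x $ i \<le> a $ i \<or> b $ i \<le> x $ i"
      using \<open>x \<notin> box a b\<close> by (auto simp: mem_box_cart not_less)
    then have "flat_exp 0 (real n * x $ i + - real n * a $ i) *
      flat_exp 0 (- real n * x $ i + real n * b $ i) = 0"
      by (auto simp: flat_exp_def algebra_simps mult_less_cancel_left)
    then show ?thesis unfolding \<phi>_def by (meson UNIV_I finite_class.finite_UNIV prod_zero)
  qed
  have lim: "(\<lambda>n. flat_exp 0 (real n * s)) \<longlonglongrightarrow> 1" if "s > 0" for s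
  proof -
    have "(\<lambda>n. exp (- 1 / s * inverse (real n))) \<longlonglongrightarrow> exp (- 1 / s * 0)"
      by (intro tendsto_intros lim_inverse_n)
    then have "(\<lambda>n. exp (- 1 / s * inverse (real n))) \<longlonglongrightarrow> 1" by simp
    then show ?thesis
      by (rule Lim_transform_eventually)
        (use that in \<open>auto simp: flat_exp_def field_simps intro!: eventually_sequentiallyI[of 1]\<close>)
  qed
  show "(\<lambda>n. \<phi> n x) \<longlonglongrightarrow> 1" if "x \<in> box a b" for x
  proof -
    have "(\<lambda>n. \<phi> n x) \<longlonglongrightarrow> (\<Prod>i\<in>(UNIV::3 set). 1 * 1)"
      unfolding \<phi>_def
    proof (intro tendsto_prod tendsto_mult)
      fix i
      show "(\<lambda>n. flat_exp 0 (real n * x $ i + - real n * a $ i)) \<longlonglongrightarrow> 1"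
        using lim[of "x $ i - a $ i"] that by (simp add: mem_box_cart algebra_simps)
      show "(\<lambda>n. flat_exp 0 (- real n * x $ i + real n * b $ i)) \<longlonglongrightarrow> 1"
        using lim[of "b $ i - x $ i"] that by (simp add: mem_box_cart algebra_simps)
    qed
    then show ?thesis by simp
  qed
qed

subsection \<open>Positive semidefinite forms on function spaces\<close>

text \<open>Vectors are functions, not classes modulo null sets, so the form can only be
  semidefinite. Closure and linearity are stated for \<open>c * u x + v x\<close>, which covers
  sums, multiples and differences at once. The L2 product and the Dirichlet form are the two
  instances.\<close>

locale psd_form =
  fixes V :: "('a \<Rightarrow> real) set" and B :: "('a \<Rightarrow> real) \<Rightarrow> ('a \<Rightarrow> real) \<Rightarrow> real"
  assumes zero_mem: "(\<lambda>x. 0) \<in> V"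
    and comb_mem: "u \<in> V \<Longrightarrow> v \<in> V \<Longrightarrow> (\<lambda>x. c * u x + v x) \<in> V"
    and comb: "u \<in> V \<Longrightarrow> v \<in> V \<Longrightarrow> w \<in> V \<Longrightarrow> B (\<lambda>x. c * u x + v x) w = c * B u w + B v w"
    and sym: "u \<in> V \<Longrightarrow> v \<in> V \<Longrightarrow> B u v = B v u"
    and nonneg: "u \<in> V \<Longrightarrow> 0 \<le> B u u"
begin

lemma scale_mem: "u \<in> V \<Longrightarrow> (\<lambda>x. c * u x) \<in> V"
  using comb_mem[OF _ zero_mem, of u c] by simp

lemma add_mem: "u \<in> V \<Longrightarrow> v \<in> V \<Longrightarrow> (\<lambda>x. u x + v x) \<in> V"
  using comb_mem[of u v 1] by simp

lemma diff_mem: "u \<in> V \<Longrightarrow> v \<in> V \<Longrightarrow> (\<lambda>x. u x - v x) \<in> V"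
  using comb_mem[of v u "-1"] by simp

lemma comb_right: "u \<in> V \<Longrightarrow> v \<in> V \<Longrightarrow> w \<in> V \<Longrightarrow> B w (\<lambda>x. c * u x + v x) = c * B w u + B w v"
  using comb[of u v w c] sym[of w "\<lambda>x. c * u x + v x"] comb_mem[of u v c] sym[of w u] sym[of w v] by simp

lemma diff_left: "u \<in> V \<Longrightarrow> v \<in> V \<Longrightarrow> w \<in> V \<Longrightarrow> B (\<lambda>x. u x - v x) w = B u w - B v w"
  using comb[of v u w "-1"] by simp

lemma zero_left: "w \<in> V \<Longrightarrow> B (\<lambda>x. 0) w = 0"
  using comb[OF zero_mem zero_mem, of w 1] by simp

lemma scale_left: "u \<in> V \<Longrightarrow> w \<in> V \<Longrightarrow> B (\<lambda>x. c * u x) w = c * B u w"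
  using comb[OF _ zero_mem, of u w c] by (simp add: zero_left)

lemma comb_square:
  assumes "u \<in> V" "v \<in> V"
  shows "B (\<lambda>x. c * u x + v x) (\<lambda>x. c * u x + v x) = c\<^sup>2 * B u u + 2 * c * B u v + B v v"
  using comb[OF assms comb_mem[OF assms], of c c] comb_right[OF assms, of u c] comb_right[OF assms, of v c] assms
  by (simp add: sym[of v u] power2_eq_square algebra_simps)

lemma cauchy_schwarz:
  assumes "u \<in> V" "v \<in> V"
  shows "\<bar>B u v\<bar> \<le> sqrt (B u u) * sqrt (B v v)"
proof -
  have q: "0 \<le> c\<^sup>2 * B u u + 2 * c * B u v + B v v" for c
    using nonneg[OF comb_mem[OF assms]] comb_square[OF assms] by metis
  have "(B u v)\<^sup>2 \<le> B u u * B v v"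
  proof (cases "B u u = 0")
    case True
    have "B u v = 0"
    proof (rule ccontr)
      assume "B u v \<noteq> 0"
      \<comment> \<open>If \<open>B u u = 0\<close>, the quadratic polynomial in c is linear, and
        this value of c turns it into -1.\<close>
      then show False
        using q[of "- (B v v + 1) / (2 * B u v)"] True by (simp add: field_simps)
    qed
    then show ?thesis using True by simp
  next
    case False
    then have "B u u > 0" using nonneg[OF assms(1)] by simp
    have "(- B u v / B u u)\<^sup>2 * B u u + 2 * (- B u v / B u u) * B u v + B v v
        = B v v - (B u v)\<^sup>2 / B u u"
      using False by (simp add: power2_eq_square field_simps)
    with q[of "- B u v / B u u"] have "(B u v)\<^sup>2 / B u u \<le> B v v" by simp
    then show ?thesis using \<open>B u u > 0\<close> by (simp add: field_simps)
  qed
  then show ?thesis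
    by (metis real_sqrt_abs real_sqrt_le_iff real_sqrt_mult)
qed

lemma triangle:
  assumes "u \<in> V" "v \<in> V"
  shows "sqrt (B (\<lambda>x. u x + v x) (\<lambda>x. u x + v x)) \<le> sqrt (B u u) + sqrt (B v v)"
proof -
  have "B (\<lambda>x. u x + v x) (\<lambda>x. u x + v x) = B u u + 2 * B u v + B v v"
    using comb_square[OF assms, of 1] by simp
  also have "\<dots> \<le> (sqrt (B u u) + sqrt (B v v))\<^sup>2"
    using cauchy_schwarz[OF assms] nonneg assms by (simp add: power2_sum)
  finally show ?thesis
    using real_le_lsqrt real_sqrt_le_iff nonneg assms
    by (metis abs_of_nonneg add_nonneg_nonneg real_sqrt_abs real_sqrt_ge_zero)
qed

lemma triangle_diff:
  assumes "u \<in> V" "v \<in> V" "w \<in> V"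
  shows "sqrt (B (\<lambda>x. u x - w x) (\<lambda>x. u x - w x)) \<le>
    sqrt (B (\<lambda>x. u x - v x) (\<lambda>x. u x - v x)) + sqrt (B (\<lambda>x. v x - w x) (\<lambda>x. v x - w x))"
  using triangle[OF diff_mem[OF assms(1,2)] diff_mem[OF assms(2,3)]] by simp

lemma parallelogram:
  assumes "u \<in> V" "v \<in> V"
  shows "B (\<lambda>x. u x - v x) (\<lambda>x. u x - v x) = 2 * B u u + 2 * B v v - B (\<lambda>x. u x + v x) (\<lambda>x. u x + v x)"
proof -
  have "(\<lambda>x. v x + u x) = (\<lambda>x. u x + v x)" by (auto simp: add.commute)
  then show ?thesis
    using comb_square[of v u "-1"] comb_square[of v u 1] assms by simp
qed

text \<open>Direct method: the bound on \<open>L\<close> bounds \<open>J\<close> from below, the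
  parallelogram identity makes a minimising sequence Cauchy, and the vanishing first variation at
  its limit is the representation. Completeness is a hypothesis about the form itself, with limits
  unique only up to null vectors.\<close>

theorem riesz_representation:
  assumes complete: "\<And>X. (\<And>n::nat. X n \<in> V) \<Longrightarrow>
      (\<And>e. e > 0 \<Longrightarrow> \<exists>N. \<forall>m\<ge>N. \<forall>n\<ge>N. B (\<lambda>x. X m x - X n x) (\<lambda>x. X m x - X n x) < e) \<Longrightarrow>
      \<exists>u\<in>V. (\<lambda>n. B (\<lambda>x. X n x - u x) (\<lambda>x. X n x - u x)) \<longlonglongrightarrow> 0"
    and L: "\<And>u v c. u \<in> V \<Longrightarrow> v \<in> V \<Longrightarrow> L (\<lambda>x. c * u x + v x) = c * L u + L v"
    and bound: "\<And>v. v \<in> V \<Longrightarrow> \<bar>L v\<bar> \<le> C * sqrt (B v v)"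
  shows "\<exists>u\<in>V. \<forall>v\<in>V. B u v = L v"
proof -
  define J where "J v = B v v - 2 * L v" for v
  have J_comb: "J (\<lambda>x. c * v x + u x) = J u + 2 * c * (B u v - L v) + c\<^sup>2 * B v v"
    if "u \<in> V" "v \<in> V" for u v c
    unfolding J_def L[OF that(2,1)] comb_square[OF that(2,1)] sym[OF that(2,1)]
    by (simp add: algebra_simps)
  have low: "- C\<^sup>2 \<le> J v" if "v \<in> V" for v
  proof -
    have "0 \<le> (sqrt (B v v) - C)\<^sup>2" by simp
    then have "- C\<^sup>2 \<le> (sqrt (B v v))\<^sup>2 - 2 * (C * sqrt (B v v))"
      by (simp add: power2_diff mult.commute)
    then show ?thesis
      using bound[OF that] nonneg[OF that] unfolding J_def by (simp add: abs_le_iff)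
  qed
  define m where "m = (INF v\<in>V. J v)"
  have bdd: "bdd_below (J ` V)" using low by (auto intro!: bdd_belowI2)
  have m_le: "m \<le> J v" if "v \<in> V" for v
    unfolding m_def using bdd that by (rule cINF_lower)
  have "\<exists>v\<in>V. J v < m + inverse (real (Suc n))" for n
    using cInf_lessD[of "J ` V" "m + inverse (real (Suc n))"] zero_mem unfolding m_def by auto
  then obtain X where X: "\<And>n. X n \<in> V" "\<And>n. J (X n) < m + inverse (real (Suc n))"
    by metis
  \<comment> \<open>At the midpoint \<open>J\<close> is still at least \<open>m\<close>; the
    parallelogram identity turns the excess of \<open>J\<close> over \<open>m\<close> at both points
    into a bound on their distance.\<close>
  have close: "B (\<lambda>x. X k x - X n x) (\<lambda>x. X k x - X n x) \<le> 2 * (inverse (real (Suc k)) + inverse (real (Suc n)))" for k n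
  proof -
    let ?h = "\<lambda>x. 1/2 * (X k x + X n x)"
    have h: "?h \<in> V" by (intro scale_mem add_mem X)
    have "4 * J ?h = B (\<lambda>x. X k x + X n x) (\<lambda>x. X k x + X n x) - 4 * (L (X k) + L (X n))"
    proof -
      have s: "(\<lambda>x. X k x + X n x) \<in> V" by (intro add_mem X)
      have "B ?h ?h = 1/2 * (1/2 * B (\<lambda>x. X k x + X n x) (\<lambda>x. X k x + X n x))"
        using scale_left[OF s h, of "1/2"] scale_left[OF s s, of "1/2"] sym[OF s h] by simp
      moreover have "L (\<lambda>x. 0) = 0" using L[OF zero_mem zero_mem, of 1] by simp
      then have "L ?h = 1/2 * L (\<lambda>x. X k x + X n x)"
        using L[OF s zero_mem, of "1/2"] by simp
      moreover have "L (\<lambda>x. X k x + X n x) = L (X k) + L (X n)"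
        using L[OF X(1) X(1), of 1 k n] by simp
      ultimately show ?thesis by (simp add: J_def)
    qed
    with m_le[OF h] X(2)[of k] X(2)[of n] show ?thesis
      unfolding parallelogram[OF X(1) X(1)] J_def by simp
  qed
  have "\<exists>u\<in>V. (\<lambda>n. B (\<lambda>x. X n x - u x) (\<lambda>x. X n x - u x)) \<longlonglongrightarrow> 0"
  proof (rule complete[OF X(1)])
    fix e :: real assume "e > 0"
    then obtain N where N: "inverse (real (Suc N)) < e / 4"
      using reals_Archimedean[of "e / 4"] by auto
    have "B (\<lambda>x. X k x - X n x) (\<lambda>x. X k x - X n x) < e" if "k \<ge> N" "n \<ge> N" for k n
    proof -
      have "inverse (real (Suc k)) \<le> inverse (real (Suc N))" "inverse (real (Suc n)) \<le> inverse (real (Suc N))"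
        using that by (auto intro!: le_imp_inverse_le)
      then have "2 * (inverse (real (Suc k)) + inverse (real (Suc n))) \<le> 4 * inverse (real (Suc N))"
        unfolding distrib_left by linarith
      also have "\<dots> < e" using N by (simp del: of_nat_Suc)
      finally show ?thesis using close[of k n] by (rule order.strict_trans1[rotated])
    qed
    then show "\<exists>N. \<forall>m\<ge>N. \<forall>n\<ge>N. B (\<lambda>x. X m x - X n x) (\<lambda>x. X m x - X n x) < e" by blast
  qed
  then obtain u where u: "u \<in> V" "(\<lambda>n. B (\<lambda>x. X n x - u x) (\<lambda>x. X n x - u x)) \<longlonglongrightarrow> 0" by auto
  show ?thesis
  proof (intro bexI[OF _ u(1)] ballI)
    fix v assume v: "v \<in> V"
    have "(\<lambda>n. B (X n) v - B u v) \<longlonglongrightarrow> 0"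
    proof (rule Lim_null_comparison)
      show "\<forall>\<^sub>F n in sequentially. norm (B (X n) v - B u v) \<le>
          sqrt (B (\<lambda>x. X n x - u x) (\<lambda>x. X n x - u x)) * sqrt (B v v)"
        using cauchy_schwarz[OF diff_mem[OF X(1) u(1)] v] by (simp add: diff_left X u v)
      show "(\<lambda>n. sqrt (B (\<lambda>x. X n x - u x) (\<lambda>x. X n x - u x)) * sqrt (B v v)) \<longlonglongrightarrow> 0"
        using tendsto_mult[OF tendsto_real_sqrt[OF u(2)] tendsto_const] by simp
    qed
    then have lim: "(\<lambda>n. B (X n) v) \<longlonglongrightarrow> B u v" by (simp add: LIM_zero_iff)
    \<comment> \<open>\<open>J\<close> is never evaluated at the limit: the inequality between
      \<open>m\<close> and \<open>J\<close> at c v + X n is expanded around \<open>X n\<close>, and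
      only \<open>B (X n) v\<close> passes to the limit.\<close>
    have q: "0 \<le> 2 * c * (B u v - L v) + c\<^sup>2 * B v v" for c
    proof (rule LIMSEQ_le)
      show "(\<lambda>n. - inverse (real (Suc n))) \<longlonglongrightarrow> 0"
        using tendsto_minus[OF LIMSEQ_inverse_real_of_nat] by simp
      show "(\<lambda>n. 2 * c * (B (X n) v - L v) + c\<^sup>2 * B v v) \<longlonglongrightarrow> 2 * c * (B u v - L v) + c\<^sup>2 * B v v"
        by (intro tendsto_intros lim)
      have "- inverse (real (Suc n)) \<le> 2 * c * (B (X n) v - L v) + c\<^sup>2 * B v v" for n
        using m_le[OF comb_mem[OF v X(1)], of c n] X(2)[of n] by (simp add: J_comb X v)
      then show "\<exists>N. \<forall>n\<ge>N. - inverse (real (Suc n)) \<le> 2 * c * (B (X n) v - L v) + c\<^sup>2 * B v v" by blast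
    qed
    show "B u v = L v"
    proof (rule ccontr)
      assume "B u v \<noteq> L v"
      define r where "r = B u v - L v"
      \<comment> \<open>The added 1 keeps the divisor positive when \<open>v\<close> is a null
        vector.\<close>
      define b where "b = B v v + 1"
      have "b > 0" "r \<noteq> 0" using nonneg[OF v] \<open>B u v \<noteq> L v\<close> by (auto simp: b_def r_def)
      have "0 \<le> 2 * (- r / b) * r + (- r / b)\<^sup>2 * b"
        using q[of "- r / b"] mult_left_mono[of "B v v" b "(- r / b)\<^sup>2"] by (simp add: b_def r_def)
      also have "\<dots> = - r\<^sup>2 / b"
        using \<open>b > 0\<close> by (simp add: power2_eq_square field_simps)
      also have "\<dots> < 0" using \<open>b > 0\<close> \<open>r \<noteq> 0\<close> by simp
      finally show False by simp
    qed
  qed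
qed

end

subsection \<open>The space $L^2$\<close>

lemma L2_integrable_mult:
  assumes "u \<in> L2 S" "v \<in> L2 S"
  shows "integrable (lebesgue_on S) (\<lambda>x. u x * v x)"
proof (rule Bochner_Integration.integrable_bound)
  show "integrable (lebesgue_on S) (\<lambda>x. (u x)\<^sup>2 + (v x)\<^sup>2)"
    using assms by (auto simp: L2_def)
  show "(\<lambda>x. u x * v x) \<in> borel_measurable (lebesgue_on S)"
    using assms by (auto simp: L2_def)
  have "\<bar>a * b\<bar> \<le> a\<^sup>2 + b\<^sup>2" for a b :: real
  proof -
    have "2 * \<bar>a * b\<bar> \<le> a\<^sup>2 + b\<^sup>2"
      using sum_squares_bound[of "\<bar>a\<bar>" "\<bar>b\<bar>"] by (simp add: abs_mult)
    then show ?thesis by (smt (verit) zero_le_power2)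
  qed
  then show "AE x in lebesgue_on S. norm (u x * v x) \<le> norm ((u x)\<^sup>2 + (v x)\<^sup>2)"
    by (simp add: abs_mult)
qed

lemma L2_comb:
  assumes "u \<in> L2 S" "v \<in> L2 S"
  shows "(\<lambda>x. c * u x + v x) \<in> L2 S"
proof -
  have "(\<lambda>x. (c * u x + v x)\<^sup>2) = (\<lambda>x. c\<^sup>2 * (u x)\<^sup>2 + 2 * c * (u x * v x) + (v x)\<^sup>2)"
    by (auto simp: power2_eq_square algebra_simps)
  then show ?thesis
    using assms L2_integrable_mult[OF assms] by (auto simp: L2_def)
qed

interpretation L2: psd_form "L2 S" "L2_inner S" for S
proof
  show "(\<lambda>x. 0) \<in> L2 S" by (simp add: L2_def)
  show "(\<lambda>x. c * u x + v x) \<in> L2 S" if "u \<in> L2 S" "v \<in> L2 S" for u v c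
    using that by (rule L2_comb)
  show "L2_inner S (\<lambda>x. c * u x + v x) w = c * L2_inner S u w + L2_inner S v w"
    if "u \<in> L2 S" "v \<in> L2 S" "w \<in> L2 S" for u v w c
    using that by (simp add: L2_inner_def distrib_right mult.assoc L2_integrable_mult)
qed (simp_all add: L2_inner_def mult.commute)

lemma L2_norm_nonneg: "0 \<le> L2_norm S u"
  by (simp add: L2_norm_def L2_inner_def)

lemma L2_norm_power2: "(L2_norm S u)\<^sup>2 = L2_inner S u u"
  by (simp add: L2_norm_def L2_inner_def)

lemma L2_cauchy_schwarz: "u \<in> L2 S \<Longrightarrow> v \<in> L2 S \<Longrightarrow> \<bar>L2_inner S u v\<bar> \<le> L2_norm S u * L2_norm S v"
  unfolding L2_norm_def by (rule L2.cauchy_schwarz)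

lemma L2_triangle: "u \<in> L2 S \<Longrightarrow> v \<in> L2 S \<Longrightarrow> L2_norm S (\<lambda>x. u x + v x) \<le> L2_norm S u + L2_norm S v"
  unfolding L2_norm_def by (rule L2.triangle)

lemma L2_norm_scale: "L2_norm S (\<lambda>x. c * u x) = \<bar>c\<bar> * L2_norm S u"
proof -
  have "(\<lambda>x. c * u x * (c * u x)) = (\<lambda>x. c\<^sup>2 * (u x * u x))" by (auto simp: power2_eq_square)
  then have "L2_inner S (\<lambda>x. c * u x) (\<lambda>x. c * u x) = c\<^sup>2 * L2_inner S u u" by (simp add: L2_inner_def)
  then show ?thesis by (simp add: L2_norm_def real_sqrt_mult)
qed

lemma L2_norm_minus_commute: "L2_norm S (\<lambda>x. u x - v x) = L2_norm S (\<lambda>x. v x - u x)"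
proof -
  have "(\<lambda>x. (u x - v x) * (u x - v x)) = (\<lambda>x. (v x - u x) * (v x - u x))"
    by (auto simp: algebra_simps)
  then show ?thesis by (simp add: L2_norm_def L2_inner_def)
qed

lemma L2_inner_cong_AE:
  assumes "AE x in lebesgue_on S. u x = u' x" "AE x in lebesgue_on S. v x = v' x"
    "u \<in> borel_measurable (lebesgue_on S)" "u' \<in> borel_measurable (lebesgue_on S)"
    "v \<in> borel_measurable (lebesgue_on S)" "v' \<in> borel_measurable (lebesgue_on S)"
  shows "L2_inner S u v = L2_inner S u' v'"
  unfolding L2_inner_def using assms by (intro integral_cong_AE) auto

lemma L2_norm_cong_AE:
  assumes "AE x in lebesgue_on S. u x = u' x"
    "u \<in> borel_measurable (lebesgue_on S)" "u' \<in> borel_measurable (lebesgue_on S)"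
  shows "L2_norm S u = L2_norm S u'"
  using L2_inner_cong_AE[OF assms(1,1) assms(2,3,2,3)] by (simp add: L2_norm_def)

lemma L2_cong_AE:
  assumes "u \<in> L2 S" "AE x in lebesgue_on S. u x = u' x" "u' \<in> borel_measurable (lebesgue_on S)"
  shows "u' \<in> L2 S"
proof -
  have "AE x in lebesgue_on S. (u x)\<^sup>2 = (u' x)\<^sup>2"
    using assms(2) by eventually_elim simp
  moreover have "(\<lambda>x. (u' x)\<^sup>2) \<in> borel_measurable (lebesgue_on S)"
    using assms(3) by simp
  moreover have "integrable (lebesgue_on S) (\<lambda>x. (u x)\<^sup>2)"
    using assms(1) by (simp add: L2_def)
  ultimately have "integrable (lebesgue_on S) (\<lambda>x. (u' x)\<^sup>2)"
    using integrable_cong_AE_imp by blast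
  then show ?thesis using assms(3) by (simp add: L2_def)
qed

lemma L2_measurable: "u \<in> L2 S \<Longrightarrow> u \<in> borel_measurable (lebesgue_on S)"
  by (simp add: L2_def)

lemma L2_bounded_mult:
  assumes "u \<in> L2 S" "m \<in> borel_measurable (lebesgue_on S)" "\<And>x. x \<in> S \<Longrightarrow> \<bar>m x\<bar> \<le> K"
  shows "(\<lambda>x. m x * u x) \<in> L2 S" "L2_norm S (\<lambda>x. m x * u x) \<le> K * L2_norm S u"
proof -
  \<comment> \<open>A negative \<open>K\<close> is compatible with the bound only on an empty
    set.\<close>
  consider "S = {}" | "0 \<le> K" using assms(3) by fastforce
  then have "(\<lambda>x. m x * u x) \<in> L2 S \<and> L2_norm S (\<lambda>x. m x * u x) \<le> K * L2_norm S u"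
  proof cases
    case 1
    then show ?thesis by (simp add: L2_def L2_norm_def L2_inner_def measurable_def)
  next
    case 2
    have le: "(m x * u x)\<^sup>2 \<le> K\<^sup>2 * (u x)\<^sup>2" if "x \<in> S" for x
      using power_mono[OF assms(3)[OF that], of 2] by (simp add: power_mult_distrib mult_right_mono)
    have i: "integrable (lebesgue_on S) (\<lambda>x. K\<^sup>2 * (u x)\<^sup>2)" using assms(1) by (simp add: L2_def)
    have i': "integrable (lebesgue_on S) (\<lambda>x. (m x * u x)\<^sup>2)"
      by (rule Bochner_Integration.integrable_bound[OF i])
        (use assms le in \<open>auto simp: L2_def\<close>)
    have "integral\<^sup>L (lebesgue_on S) (\<lambda>x. (m x * u x)\<^sup>2) \<le> integral\<^sup>L (lebesgue_on S) (\<lambda>x. K\<^sup>2 * (u x)\<^sup>2)"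
      by (rule integral_mono[OF i' i]) (use le in auto)
    then have "L2_norm S (\<lambda>x. m x * u x) \<le> sqrt (K\<^sup>2 * L2_inner S u u)"
      unfolding L2_norm_def L2_inner_def power2_eq_square by simp
    also have "\<dots> = K * L2_norm S u" using 2 by (simp add: real_sqrt_mult L2_norm_def)
    finally show ?thesis using i' assms by (auto simp: L2_def)
  qed
  then show "(\<lambda>x. m x * u x) \<in> L2 S" "L2_norm S (\<lambda>x. m x * u x) \<le> K * L2_norm S u" by auto
qed

lemma L2_sum: "finite I \<Longrightarrow> (\<And>i. i \<in> I \<Longrightarrow> u i \<in> L2 S) \<Longrightarrow> (\<lambda>x. \<Sum>i\<in>I. u i x) \<in> L2 S"
  by (induction I rule: finite_induct) (auto simp: L2.zero_mem L2.add_mem)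

lemma L2_const: "S \<in> lmeasurable \<Longrightarrow> (\<lambda>x. c) \<in> L2 S"
proof -
  assume S: "S \<in> lmeasurable"
  interpret finite_measure "lebesgue_on S" using S by (rule finite_measure_lebesgue_on)
  show ?thesis by (simp add: L2_def)
qed

text \<open>Riesz-Fischer: a subsequence with increments at most 2^-k in norm converges almost
  everywhere because the increments are summable in L1, and Fatou's lemma carries the Cauchy bound
  over to the limit. The finite measure of \<open>S\<close> lets L2 norms control L1 norms, by
  Cauchy-Schwarz against the constant 1.\<close>

theorem L2_complete:
  assumes S: "S \<in> lmeasurable" and X: "\<And>n::nat. X n \<in> L2 S"
    and cauchy: "\<And>e. e > 0 \<Longrightarrow> \<exists>N. \<forall>m\<ge>N. \<forall>n\<ge>N. L2_norm S (\<lambda>x. X m x - X n x) < e"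
  shows "\<exists>u\<in>L2 S. (\<lambda>n. L2_norm S (\<lambda>x. X n x - u x)) \<longlonglongrightarrow> 0"
proof -
  let ?M = "lebesgue_on S"
  have [measurable]: "X n \<in> borel_measurable ?M" for n using X by (rule L2_measurable)
  have "\<forall>k. \<exists>N. \<forall>m\<ge>N. \<forall>n\<ge>N. L2_norm S (\<lambda>x. X m x - X n x) < (1/2) ^ k"
    by (intro allI cauchy) simp
  from choice[OF this] obtain N where
    N: "\<And>k m n. m \<ge> N k \<Longrightarrow> n \<ge> N k \<Longrightarrow> L2_norm S (\<lambda>x. X m x - X n x) < (1/2) ^ k"
    by blast
  define r where "r k = (\<Sum>j\<le>k. N j)" for k
  have rN: "N k \<le> r k" "r k \<le> r (Suc k)" for k
    unfolding r_def by (auto intro!: member_le_sum)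
  have r_mono: "r k \<le> r j" if "k \<le> j" for k j
    using lift_Suc_mono_le[of r, OF rN(2) that] .
  define Y where "Y k x = X (r (Suc k)) x - X (r k) x" for k x
  have Y: "Y k \<in> L2 S" for k unfolding Y_def by (intro L2.diff_mem X)
  have [measurable]: "Y k \<in> borel_measurable ?M" for k using Y by (rule L2_measurable)
  have Y_norm: "L2_norm S (Y k) \<le> (1/2) ^ k" for k
    unfolding Y_def using N[OF order_trans[OF rN] rN(1), of k] by simp
  have c1: "(\<lambda>x. 1) \<in> L2 S" using L2_const[OF S] .
  have Yi: "integrable ?M (Y k)" for k using L2_integrable_mult[OF Y c1] by simp
  have Yn: "(\<integral>\<^sup>+x. ennreal \<bar>Y k x\<bar> \<partial>?M) \<le> ennreal (L2_norm S (\<lambda>x. 1) * (1/2) ^ k)" for k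
  proof -
    have absY: "(\<lambda>x. \<bar>Y k x\<bar>) \<in> L2 S" using Y[of k] by (auto simp: L2_def)
    have "(\<integral>\<^sup>+x. ennreal \<bar>Y k x\<bar> \<partial>?M) = ennreal (L2_inner S (\<lambda>x. \<bar>Y k x\<bar>) (\<lambda>x. 1))"
      unfolding L2_inner_def using Yi by (simp add: nn_integral_eq_integral)
    also have "\<dots> \<le> ennreal (L2_norm S (\<lambda>x. \<bar>Y k x\<bar>) * L2_norm S (\<lambda>x. 1))"
      using L2_cauchy_schwarz[OF absY c1] by (intro ennreal_leI) linarith
    also have "L2_norm S (\<lambda>x. \<bar>Y k x\<bar>) = L2_norm S (Y k)" by (simp add: L2_norm_def L2_inner_def)
    also have "ennreal (L2_norm S (Y k) * L2_norm S (\<lambda>x. 1)) \<le> ennreal ((1/2) ^ k * L2_norm S (\<lambda>x. 1))"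
      using Y_norm[of k] by (intro ennreal_leI mult_right_mono L2_norm_nonneg)
    finally show ?thesis by (simp add: mult.commute)
  qed
  have "(\<integral>\<^sup>+x. (\<Sum>k. ennreal \<bar>Y k x\<bar>) \<partial>?M) = (\<Sum>k. \<integral>\<^sup>+x. ennreal \<bar>Y k x\<bar> \<partial>?M)"
    by (rule nn_integral_suminf) simp
  also have "\<dots> \<le> (\<Sum>k. ennreal (L2_norm S (\<lambda>x. 1) * (1/2) ^ k))"
    by (intro suminf_le Yn) auto
  also have "\<dots> < \<infinity>"
    by (subst suminf_ennreal2) (auto intro!: mult_nonneg_nonneg L2_norm_nonneg summable_mult)
  finally have "(\<integral>\<^sup>+x. (\<Sum>k. ennreal \<bar>Y k x\<bar>) \<partial>?M) \<noteq> \<infinity>" by simp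
  then have "AE x in ?M. (\<Sum>k. ennreal \<bar>Y k x\<bar>) \<noteq> \<infinity>"
    by (rule nn_integral_noteq_infinite[rotated]) simp
  then have conv: "AE x in ?M. (\<lambda>k. X (r k) x) \<longlonglongrightarrow> lim (\<lambda>k. X (r k) x)"
  proof eventually_elim
    case (elim x)
    then have "summable (\<lambda>k. \<bar>Y k x\<bar>)"
      by (intro summable_suminf_not_top) (auto simp: top_ennreal_def)
    then have "summable (\<lambda>k. Y k x)" by (rule summable_rabs_cancel)
    then have "convergent (\<lambda>n. \<Sum>k<n. Y k x)" by (simp add: summable_iff_convergent)
    moreover have "(\<Sum>k<n. Y k x) = X (r n) x - X (r 0) x" for n
      unfolding Y_def by (rule sum_lessThan_telescope)
    ultimately have "convergent (\<lambda>n. X (r n) x - X (r 0) x + X (r 0) x)"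
      by (intro convergent_add) (auto simp: convergent_const)
    then show ?case by (simp add: convergent_LIMSEQ_iff)
  qed
  \<comment> \<open>Where the subsequence diverges, \<open>lim\<close> has an unspecified value;
    that set is null, and \<open>u\<close> is measurable all the same.\<close>
  define u where "u x = lim (\<lambda>k. X (r k) x)" for x
  have u_meas[measurable]: "u \<in> borel_measurable ?M" unfolding u_def by simp
  have fatou: "(\<integral>\<^sup>+x. ennreal ((X n x - u x)\<^sup>2) \<partial>?M) \<le> ennreal (((1/2) ^ k)\<^sup>2)" if n: "n \<ge> N k" for n k
  proof -
    have "(\<integral>\<^sup>+x. ennreal ((X n x - u x)\<^sup>2) \<partial>?M) = (\<integral>\<^sup>+x. liminf (\<lambda>j. ennreal ((X n x - X (r j) x)\<^sup>2)) \<partial>?M)"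
    proof (rule nn_integral_cong_AE)
      show "AE x in ?M. ennreal ((X n x - u x)\<^sup>2) = liminf (\<lambda>j. ennreal ((X n x - X (r j) x)\<^sup>2))"
        using conv
      proof eventually_elim
        case (elim x)
        then have "(\<lambda>j. ennreal ((X n x - X (r j) x)\<^sup>2)) \<longlonglongrightarrow> ennreal ((X n x - u x)\<^sup>2)"
          unfolding u_def by (intro tendsto_intros tendsto_ennrealI)
        from lim_imp_Liminf[OF _ this] show ?case by simp
      qed
    qed
    also have "\<dots> \<le> liminf (\<lambda>j. \<integral>\<^sup>+x. ennreal ((X n x - X (r j) x)\<^sup>2) \<partial>?M)"
      by (rule nn_integral_liminf) simp
    also have "\<dots> \<le> ennreal (((1/2) ^ k)\<^sup>2)"
    proof (rule Liminf_le)
      show "\<forall>\<^sub>F j in sequentially. (\<integral>\<^sup>+x. ennreal ((X n x - X (r j) x)\<^sup>2) \<partial>?M) \<le> ennreal (((1/2) ^ k)\<^sup>2)"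
      proof (rule eventually_sequentiallyI[of k])
        fix j assume "k \<le> j"
        have d: "(\<lambda>x. X n x - X (r j) x) \<in> L2 S" by (intro L2.diff_mem X)
        have "L2_norm S (\<lambda>x. X n x - X (r j) x) < (1/2) ^ k"
          using N[OF n, of "r j"] rN(1)[of k] r_mono[OF \<open>k \<le> j\<close>] by linarith
        then have "(L2_norm S (\<lambda>x. X n x - X (r j) x))\<^sup>2 \<le> ((1/2) ^ k)\<^sup>2"
          by (intro power_mono) (auto simp: L2_norm_nonneg)
        moreover have "(\<integral>\<^sup>+x. ennreal ((X n x - X (r j) x)\<^sup>2) \<partial>?M) = ennreal ((L2_norm S (\<lambda>x. X n x - X (r j) x))\<^sup>2)"
          unfolding L2_norm_power2 L2_inner_def using d
          by (simp add: nn_integral_eq_integral L2_def power2_eq_square)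
        ultimately show "(\<integral>\<^sup>+x. ennreal ((X n x - X (r j) x)\<^sup>2) \<partial>?M) \<le> ennreal (((1/2) ^ k)\<^sup>2)"
          by (simp add: ennreal_leI)
      qed
    qed simp
    finally show ?thesis .
  qed
  have d: "(\<lambda>x. X n x - u x) \<in> L2 S" if "n \<ge> N k" for n k
    using fatou[OF that] unfolding L2_def
    by (auto simp: integrable_iff_bounded intro: order.strict_trans1[OF _ ennreal_less_top])
  have "(\<lambda>x. X (N 0) x - (X (N 0) x - u x)) \<in> L2 S"
    by (intro L2.diff_mem X d[of 0]) simp
  then have u: "u \<in> L2 S" by simp
  have small: "L2_norm S (\<lambda>x. X n x - u x) \<le> (1/2) ^ k" if "n \<ge> N k" for n k
  proof -
    have "ennreal ((L2_norm S (\<lambda>x. X n x - u x))\<^sup>2) \<le> ennreal (((1/2) ^ k)\<^sup>2)"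
      using fatou[OF that] d[OF that] unfolding L2_norm_power2 L2_inner_def
      by (simp add: nn_integral_eq_integral L2_def power2_eq_square)
    then show ?thesis by (simp add: ennreal_le_iff abs_le_square_iff[symmetric] L2_norm_nonneg)
  qed
  have "(\<lambda>n. L2_norm S (\<lambda>x. X n x - u x)) \<longlonglongrightarrow> 0"
  proof (rule LIMSEQ_I)
    fix e :: real assume "e > 0"
    then obtain k where "(1/2::real) ^ k < e" using real_arch_pow_inv[of e "1/2"] by auto
    then show "\<exists>n0. \<forall>n\<ge>n0. norm (L2_norm S (\<lambda>x. X n x - u x) - 0) < e"
      using small by (intro exI[of _ "N k"]) (auto simp: L2_norm_nonneg intro: order.strict_trans1)
  qed
  with u show ?thesis by blast
qed

subsection \<open>Translation invariance and integration by parts\<close>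

lemma lebesgue_translation:
  fixes c :: "'a::euclidean_space"
  shows "(\<lambda>x. c + x) \<in> lebesgue \<rightarrow>\<^sub>M lebesgue" "distr lebesgue lebesgue (\<lambda>x. c + x) = lebesgue"
proof -
  have T: "(\<lambda>x::'a. c + (\<Sum>j\<in>Basis. (1 * (x \<bullet> j)) *\<^sub>R j)) = (\<lambda>x. c + x)"
    by (simp add: euclidean_representation)
  show "(\<lambda>x. c + x) \<in> lebesgue \<rightarrow>\<^sub>M lebesgue"
    using lebesgue_affine_measurable[of "\<lambda>_::'a. 1" c] unfolding T by simp
  show "distr lebesgue lebesgue (\<lambda>x. c + x) = lebesgue"
    using lebesgue_affine_euclidean[of "\<lambda>_::'a. 1" c] unfolding T by (simp add: density_1)
qed

lemma integral_lebesgue_translation: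
  fixes f :: "'a::euclidean_space \<Rightarrow> real"
  assumes "f \<in> borel_measurable lebesgue"
  shows "(LINT x|lebesgue. f (c + x)) = (LINT x|lebesgue. f x)"
  using integral_distr[OF lebesgue_translation(1) assms, of c] by (simp add: lebesgue_translation(2))

lemma open_sets_lebesgue: "open S \<Longrightarrow> S \<in> sets lebesgue"
  by (simp add: borel_open sets_completionI_sets)

lemma integrable_indicator_lmeasurable: "S \<in> lmeasurable \<Longrightarrow> integrable lebesgue (indicat_real S)"
  by (rule integrable_real_indicator) (auto simp: fmeasurable_def)

lemma borel_measurable_lebesgue_continuous:
  fixes f :: "pt \<Rightarrow> real"
  shows "continuous_on UNIV f \<Longrightarrow> f \<in> borel_measurable lebesgue"
  by (simp add: borel_measurable_continuous_onI measurable_completion)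

lemma continuous_compact_support_bounded:
  fixes f :: "pt \<Rightarrow> real"
  assumes "continuous_on UNIV f" "compact K" "\<And>x. x \<notin> K \<Longrightarrow> f x = 0"
  obtains B where "0 \<le> B" "\<And>x. \<bar>f x\<bar> \<le> B"
proof -
  have "bounded (f ` K)"
    by (intro compact_imp_bounded compact_continuous_image continuous_on_subset[OF assms(1)] assms(2)) simp
  then obtain B where "\<And>x. x \<in> K \<Longrightarrow> norm (f x) \<le> B" by (auto simp: bounded_iff)
  then have "\<bar>f x\<bar> \<le> max B 0" for x
    using assms(3)[of x] by (cases "x \<in> K") (auto simp: le_max_iff_disj)
  then show ?thesis using that[of "max B 0"] by simp
qed

lemma pd_line:
  assumes "f differentiable (at (x + t *\<^sub>R axis i 1))"
  shows "((\<lambda>t. f (x + t *\<^sub>R axis i 1)) has_real_derivative pd i f (x + t *\<^sub>R axis i 1)) (at t)"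
proof -
  let ?D = "frechet_derivative f (at (x + t *\<^sub>R axis i 1))"
  have D: "(f has_derivative ?D) (at (x + t *\<^sub>R axis i 1))"
    using assms frechet_derivative_works by blast
  have "((\<lambda>t. x + t *\<^sub>R axis i 1) has_derivative (\<lambda>h. h *\<^sub>R axis i 1)) (at t)"
    by (auto intro!: derivative_eq_intros)
  from has_derivative_compose[OF this D]
  have "((\<lambda>t. f (x + t *\<^sub>R axis i 1)) has_derivative (\<lambda>h. ?D (h *\<^sub>R axis i 1))) (at t)" .
  moreover have "?D (h *\<^sub>R axis i 1) = pd i f (x + t *\<^sub>R axis i 1) * h" for h
    using linear_scale[OF has_derivative_linear[OF D], of h] by (simp add: pd_def)
  ultimately show ?thesis by (simp add: has_field_derivative_def)
qed

lemma pd_zero_outside: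
  assumes "closed K" "\<And>x. x \<notin> K \<Longrightarrow> f x = 0" "x \<notin> K"
  shows "pd i f x = 0"
proof -
  have "((\<lambda>x. 0) has_derivative (\<lambda>x. 0)) (at x)" by simp
  then have "(f has_derivative (\<lambda>x. 0)) (at x)"
    by (rule has_derivative_transform_within_open[where s="- K"]) (use assms in auto)
  then show ?thesis by (simp add: pd_eqI)
qed

text \<open>Translation invariance makes the integral of every difference quotient in direction i
  vanish, and dominated convergence passes to the derivative. Integration by parts follows without
  iterated integrals.\<close>

theorem integral_pd_eq_0:
  assumes diff: "\<And>x. f differentiable (at x)" and cont: "continuous_on UNIV (pd i f)"
    and K: "compact K" "\<And>x. x \<notin> K \<Longrightarrow> f x = 0"
  shows "(LINT x|lebesgue. pd i f x) = 0"
proof -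
  have f_cont: "continuous_on UNIV f"
    by (simp add: continuous_at_imp_continuous_on diff differentiable_imp_continuous_within)
  obtain B where B: "0 \<le> B" "\<And>x. \<bar>pd i f x\<bar> \<le> B"
    using continuous_compact_support_bounded[OF cont K(1) pd_zero_outside[OF compact_imp_closed[OF K(1)] K(2)]]
    by blast
  obtain R where R: "\<And>x. x \<in> K \<Longrightarrow> norm x \<le> R"
    using compact_imp_bounded[OF K(1)] by (auto simp: bounded_iff)
  define t where "t n = inverse (real (Suc n))" for n
  have t: "0 < t n" "t n \<le> 1" for n unfolding t_def by (auto simp: inverse_le_1_iff)
  define s where "s n x = (f (t n *\<^sub>R axis i 1 + x) - f x) / t n" for n x
  have shift_meas: "(\<lambda>x. f (c + x)) \<in> borel_measurable lebesgue" for c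
    by (intro borel_measurable_lebesgue_continuous continuous_on_compose2[OF f_cont] continuous_intros) auto
  have f_int: "integrable lebesgue f"
  proof -
    obtain C where C: "\<And>x. \<bar>f x\<bar> \<le> C" using continuous_compact_support_bounded[OF f_cont K] by blast
    show ?thesis
    proof (rule Bochner_Integration.integrable_bound)
      show "integrable lebesgue (\<lambda>x. C * indicator K x)"
        by (intro integrable_mult_right integrable_indicator_lmeasurable lmeasurable_compact K)
      show "AE x in lebesgue. norm (f x) \<le> norm (C * indicator K x)"
        using C K(2) by (auto simp: indicator_def intro: order_trans[OF _ abs_ge_self])
    qed (use borel_measurable_lebesgue_continuous[OF f_cont] in auto)
  qed
  have shift_int: "integrable lebesgue (\<lambda>x. f (c + x))" for c
    using integrable_distr[OF lebesgue_translation(1)[of c], of f] f_int by (simp add: lebesgue_translation(2))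
  have s0: "(LINT x|lebesgue. s n x) = 0" for n
    unfolding s_def using integral_lebesgue_translation[OF borel_measurable_lebesgue_continuous[OF f_cont]]
    by (simp add: f_int shift_int)
  have "(\<lambda>n. LINT x|lebesgue. s n x) \<longlonglongrightarrow> (LINT x|lebesgue. pd i f x)"
  proof (rule integral_dominated_convergence)
    show "pd i f \<in> borel_measurable lebesgue" using cont by (rule borel_measurable_lebesgue_continuous)
    show "s n \<in> borel_measurable lebesgue" for n
      unfolding s_def using shift_meas[of "t n *\<^sub>R axis i 1"] shift_meas[of 0] by simp
    \<comment> \<open>The steps \<open>t n\<close> are at most 1, so all difference quotients vanish
      outside the ball enlarged by 1; inside, the bound \<open>B\<close> on the derivative bounds
      them too.\<close>
    show "integrable lebesgue (\<lambda>x. B * indicator (cball 0 (R + 1)) x)"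
      by (intro integrable_mult_right integrable_indicator_lmeasurable lmeasurable_cball)
    show "AE x in lebesgue. (\<lambda>n. s n x) \<longlonglongrightarrow> pd i f x"
    proof (rule AE_I2)
      fix x
      have "((\<lambda>h. (f (x + h *\<^sub>R axis i 1) - f x) / h) \<longlongrightarrow> pd i f x) (at 0)"
        using pd_line[of f x 0 i] diff by (simp add: DERIV_def)
      moreover have "filterlim t (at 0) sequentially"
        unfolding filterlim_at using t(1) LIMSEQ_inverse_real_of_nat[folded t_def]
        by (auto simp: less_imp_neq[symmetric])
      ultimately show "(\<lambda>n. s n x) \<longlonglongrightarrow> pd i f x"
        unfolding s_def by (simp add: add.commute filterlim_compose[where g="\<lambda>h. (f (x + h *\<^sub>R axis i 1) - f x) / h" and f=t])
    qed
    show "AE x in lebesgue. norm (s n x) \<le> B * indicator (cball 0 (R + 1)) x" for n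
    proof (rule AE_I2)
      fix x
      show "norm (s n x) \<le> B * indicator (cball 0 (R + 1)) x"
      proof (cases "x \<in> cball 0 (R + 1)")
        case True
        have "norm (f (x + t n *\<^sub>R axis i 1) - f (x + 0 *\<^sub>R axis i 1)) \<le> B * norm (t n - 0)"
          by (rule field_differentiable_bound[where S=UNIV and f'="\<lambda>h. pd i f (x + h *\<^sub>R axis i 1)"])
            (use B pd_line diff in auto)
        then show ?thesis using True t(1)[of n] by (simp add: s_def field_simps)
      next
        case False
        then have "R + 1 < norm x" by simp
        moreover have "norm x - norm (t n *\<^sub>R axis i 1 :: pt) \<le> norm (t n *\<^sub>R axis i 1 + x)"
          by (metis add.commute norm_diff_ineq)
        ultimately have "R < norm (t n *\<^sub>R axis i 1 + x)" "R < norm x" using t[of n] by auto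
        then have "x \<notin> K" "t n *\<^sub>R axis i 1 + x \<notin> K" using R by force+
        then show ?thesis using False K(2) by (simp add: s_def)
      qed
    qed
  qed
  then show ?thesis by (simp add: s0 LIMSEQ_const_iff)
qed

subsection \<open>Test functions and weak derivatives\<close>

lemma test_funI:
  assumes "smooth \<phi>" "compact K" "K \<subseteq> \<Omega>" "\<And>x. x \<notin> K \<Longrightarrow> \<phi> x = 0"
  shows "\<phi> \<in> test_fun \<Omega>"
proof -
  have "closure {x. \<phi> x \<noteq> 0} \<subseteq> K"
    by (rule closure_minimal) (use assms compact_imp_closed in auto)
  moreover have "compact (closure {x. \<phi> x \<noteq> 0})"
    using bounded_subset[OF compact_imp_bounded[OF assms(2)], of "{x. \<phi> x \<noteq> 0}"] assms(4)
    by (auto simp: compact_closure)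
  ultimately show ?thesis using assms unfolding test_fun_def by auto
qed

lemma test_funE:
  assumes "\<phi> \<in> test_fun \<Omega>"
  obtains K where "smooth \<phi>" "compact K" "K \<subseteq> \<Omega>" "\<And>x. x \<notin> K \<Longrightarrow> \<phi> x = 0"
proof (rule that[of "closure {x. \<phi> x \<noteq> 0}"])
  show "\<phi> x = 0" if "x \<notin> closure {x. \<phi> x \<noteq> 0}" for x
    using that closure_subset[of "{x. \<phi> x \<noteq> 0}"] by blast
qed (use assms in \<open>auto simp: test_fun_def\<close>)

lemma test_fun_smooth: "\<phi> \<in> test_fun \<Omega> \<Longrightarrow> smooth \<phi>"
  by (simp add: test_fun_def)

lemma test_fun_comb:
  assumes "\<phi> \<in> test_fun \<Omega>" "\<psi> \<in> test_fun \<Omega>"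
  shows "(\<lambda>x. c * \<phi> x + \<psi> x) \<in> test_fun \<Omega>"
proof -
  obtain K where K: "smooth \<phi>" "compact K" "K \<subseteq> \<Omega>" "\<And>x. x \<notin> K \<Longrightarrow> \<phi> x = 0"
    using test_funE[OF assms(1)] by blast
  obtain L where L: "smooth \<psi>" "compact L" "L \<subseteq> \<Omega>" "\<And>x. x \<notin> L \<Longrightarrow> \<psi> x = 0"
    using test_funE[OF assms(2)] by blast
  show ?thesis
    by (rule test_funI[of _ "K \<union> L"]) (use K L in \<open>auto intro: smooth_add smooth_cmult\<close>)
qed

lemma test_fun_pd: "\<phi> \<in> test_fun \<Omega> \<Longrightarrow> pd i \<phi> \<in> test_fun \<Omega>"
proof -
  assume t: "\<phi> \<in> test_fun \<Omega>"
  obtain K where K: "smooth \<phi>" "compact K" "K \<subseteq> \<Omega>" "\<And>x. x \<notin> K \<Longrightarrow> \<phi> x = 0"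
    using test_funE[OF t] by blast
  show ?thesis
    by (rule test_funI[OF smooth_pd[OF K(1)] K(2,3) pd_zero_outside[OF compact_imp_closed[OF K(2)] K(4)]])
qed

lemma L1_loc_mult_integrable:
  assumes "d \<in> L1_loc \<Omega>" "\<phi> \<in> test_fun \<Omega>" "\<Omega> \<in> sets lebesgue"
  shows "integrable (lebesgue_on \<Omega>) (\<lambda>x. d x * \<phi> x)" "integrable lebesgue (\<lambda>x. d x * \<phi> x)"
    "L2_inner \<Omega> d \<phi> = (LINT x|lebesgue. d x * \<phi> x)"
proof -
  obtain K where K: "smooth \<phi>" "compact K" "K \<subseteq> \<Omega>" "\<And>x. x \<notin> K \<Longrightarrow> \<phi> x = 0"
    using test_funE[OF assms(2)] by blast
  obtain B where B: "0 \<le> B" "\<And>x. \<bar>\<phi> x\<bar> \<le> B"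
    using continuous_compact_support_bounded[OF continuous_on_smooth[OF K(1)] K(2,4)] by blast
  have d: "integrable lebesgue (\<lambda>x. indicator K x *\<^sub>R d x)"
    using assms(1) K by (auto simp: L1_loc_def set_integrable_def)
  have eq: "(\<lambda>x. indicator K x *\<^sub>R d x * \<phi> x) = (\<lambda>x. d x * \<phi> x)"
  proof
    fix x show "indicator K x *\<^sub>R d x * \<phi> x = d x * \<phi> x"
      using K(4)[of x] by (cases "x \<in> K") auto
  qed
  have i: "integrable lebesgue (\<lambda>x. indicator K x *\<^sub>R d x * \<phi> x)"
  proof (rule Bochner_Integration.integrable_bound[OF integrable_mult_left[OF d, of B]])
    show "(\<lambda>x. indicator K x *\<^sub>R d x * \<phi> x) \<in> borel_measurable lebesgue"
      using borel_measurable_integrable[OF d] borel_measurable_lebesgue_continuous[OF continuous_on_smooth[OF K(1)]]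
      by (rule borel_measurable_times)
    show "AE x in lebesgue. norm (indicator K x *\<^sub>R d x * \<phi> x) \<le> norm (indicator K x *\<^sub>R d x * B)"
      using B by (auto simp: abs_mult intro!: mult_left_mono)
  qed
  then show "integrable lebesgue (\<lambda>x. d x * \<phi> x)" unfolding eq .
  have eq2: "(\<lambda>x. indicator \<Omega> x *\<^sub>R (d x * \<phi> x)) = (\<lambda>x. d x * \<phi> x)"
  proof
    fix x show "indicator \<Omega> x *\<^sub>R (d x * \<phi> x) = d x * \<phi> x"
      using K(3) K(4)[of x] by (cases "x \<in> K") auto
  qed
  show "integrable (lebesgue_on \<Omega>) (\<lambda>x. d x * \<phi> x)"
    using i assms(3) eq2 unfolding eq by (simp add: integrable_restrict_space)
  show "L2_inner \<Omega> d \<phi> = (LINT x|lebesgue. d x * \<phi> x)"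
    unfolding L2_inner_def using assms(3) eq2 by (simp add: integral_restrict_space)
qed

lemma continuous_L1_loc:
  assumes "continuous_on UNIV u"
  shows "u \<in> L1_loc \<Omega>"
proof -
  have "set_integrable lebesgue K u" if "compact K" for K
  proof -
    obtain a b where ab: "K \<subseteq> cbox a b"
      using bounded_subset_cbox_symmetric[OF compact_imp_bounded[OF \<open>compact K\<close>]] by blast
    have "u absolutely_integrable_on cbox a b"
      using assms by (intro absolutely_integrable_continuous continuous_on_subset[OF assms]) auto
    then show ?thesis
      by (rule set_integrable_subset) (use ab that in \<open>auto intro: lmeasurable_compact fmeasurableD\<close>)
  qed
  then show ?thesis by (simp add: L1_loc_def)
qed

lemma L1_loc_comb:
  assumes "u \<in> L1_loc \<Omega>" "v \<in> L1_loc \<Omega>"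
  shows "(\<lambda>x. c * u x + v x) \<in> L1_loc \<Omega>"
  using assms unfolding L1_loc_def by (auto intro!: set_integral_add(1) set_integrable_mult_right)

lemma L2_imp_L1_loc:
  assumes "u \<in> L2 \<Omega>" "\<Omega> \<in> sets lebesgue"
  shows "u \<in> L1_loc \<Omega>"
  unfolding L1_loc_def
proof (intro CollectI allI impI, elim conjE)
  fix K assume K: "compact K" "K \<subseteq> \<Omega>"
  have Km: "K \<in> lmeasurable" using K(1) by (rule lmeasurable_compact)
  have [measurable]: "indicat_real K \<in> borel_measurable (lebesgue_on \<Omega>)"
    using Km by (intro measurable_restrict_space1) (auto simp: fmeasurable_def)
  have "integrable (lebesgue_on \<Omega>) (\<lambda>x. (indicat_real K x)\<^sup>2)"
  proof -
    have "(\<lambda>x. indicator \<Omega> x *\<^sub>R (indicat_real K x)\<^sup>2) = indicat_real K"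
      using K(2) by (auto simp: indicator_def fun_eq_iff)
    then show ?thesis using Km assms(2) by (simp add: integrable_restrict_space integrable_indicator_lmeasurable)
  qed
  then have "indicat_real K \<in> L2 \<Omega>" by (simp add: L2_def)
  from L2_integrable_mult[OF assms(1) this] have "integrable (lebesgue_on \<Omega>) (\<lambda>x. u x * indicat_real K x)" .
  moreover have "(\<lambda>x. indicator \<Omega> x *\<^sub>R (u x * indicat_real K x)) = (\<lambda>x. indicator K x *\<^sub>R u x)"
    using K(2) by (auto simp: indicator_def fun_eq_iff)
  ultimately show "set_integrable lebesgue K u"
    using assms(2) by (simp add: integrable_restrict_space set_integrable_def)
qed

section \<open>The fundamental lemma of the calculus of variations\<close>

lemma integral_cbox_eq_0:
  assumes d: "d \<in> L1_loc \<Omega>" and z: "\<And>\<phi>. \<phi> \<in> test_fun \<Omega> \<Longrightarrow> L2_inner \<Omega> d \<phi> = 0"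
    and \<Omega>: "\<Omega> \<in> sets lebesgue" and ab: "cbox a b \<subseteq> \<Omega>"
  shows "integral (cbox a b) d = 0"
proof -
  obtain \<phi> where \<phi>: "\<And>n. smooth (\<phi> n)" "\<And>n x. 0 \<le> \<phi> n x" "\<And>n x. \<phi> n x \<le> 1"
    "\<And>n x. x \<notin> box a b \<Longrightarrow> \<phi> n x = 0" "\<And>x. x \<in> box a b \<Longrightarrow> (\<lambda>n. \<phi> n x) \<longlonglongrightarrow> 1"
    using box_approximation[of a b] by blast
  have t: "\<phi> n \<in> test_fun \<Omega>" for n
  proof (rule test_funI[OF \<phi>(1) compact_cbox ab])
    show "\<phi> n x = 0" if "x \<notin> cbox a b" for x
      using \<phi>(4) that box_subset_cbox by blast
  qed
  have dK: "integrable lebesgue (\<lambda>x. indicator (cbox a b) x *\<^sub>R d x)"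
    using d ab by (auto simp: L1_loc_def set_integrable_def)
  have dB: "set_integrable lebesgue (box a b) d"
    by (rule set_integrable_subset[of _ "cbox a b"]) (use dK box_subset_cbox in \<open>auto simp: set_integrable_def\<close>)
  have "(\<lambda>n. LINT x|lebesgue. d x * \<phi> n x) \<longlonglongrightarrow> (LINT x|lebesgue. indicator (box a b) x *\<^sub>R d x)"
  proof (rule integral_dominated_convergence)
    show "(\<lambda>x. indicator (box a b) x *\<^sub>R d x) \<in> borel_measurable lebesgue"
      using dB by (simp add: set_integrable_def borel_measurable_integrable)
    show "(\<lambda>x. d x * \<phi> n x) \<in> borel_measurable lebesgue" for n
      using L1_loc_mult_integrable(2)[OF d t \<Omega>] by (rule borel_measurable_integrable)
    show "integrable lebesgue (\<lambda>x. norm (indicator (cbox a b) x *\<^sub>R d x))" using dK by (rule integrable_norm)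
    show "AE x in lebesgue. (\<lambda>n. d x * \<phi> n x) \<longlonglongrightarrow> indicator (box a b) x *\<^sub>R d x"
    proof (rule AE_I2)
      fix x show "(\<lambda>n. d x * \<phi> n x) \<longlonglongrightarrow> indicator (box a b) x *\<^sub>R d x"
        using tendsto_mult[OF tendsto_const \<phi>(5), of x "d x"] \<phi>(4)[of x] by (cases "x \<in> box a b") auto
    qed
    show "AE x in lebesgue. norm (d x * \<phi> n x) \<le> norm (indicator (cbox a b) x *\<^sub>R d x)" for n
    proof (rule AE_I2)
      fix x show "norm (d x * \<phi> n x) \<le> norm (indicator (cbox a b) x *\<^sub>R d x)"
        using \<phi>(2,3)[of n x] \<phi>(4)[of x n] subsetD[OF box_subset_cbox[of a b], of x]
        by (cases "x \<in> box a b") (auto simp: abs_mult mult_left_le)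
    qed
  qed
  moreover have "(LINT x|lebesgue. d x * \<phi> n x) = 0" for n
    using z[OF t] L1_loc_mult_integrable(3)[OF d t \<Omega>] by simp
  ultimately have "(LINT x|lebesgue. indicator (box a b) x *\<^sub>R d x) = 0"
    by (simp add: LIMSEQ_const_iff)
  then have "integral (box a b) d = 0"
    using set_lebesgue_integral_eq_integral(2)[OF dB] by (simp add: set_lebesgue_integral_def)
  then show ?thesis by (simp add: integral_open_interval)
qed

text \<open>Lebesgue differentiation reduces the claim to integrals over boxes, whose indicators are
  limits of test functions.\<close>

theorem fundamental_lemma:
  assumes d: "d \<in> L1_loc \<Omega>" and z: "\<And>\<phi>. \<phi> \<in> test_fun \<Omega> \<Longrightarrow> L2_inner \<Omega> d \<phi> = 0"
    and \<Omega>: "open \<Omega>"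
  shows "AE x in lebesgue_on \<Omega>. d x = 0"
proof -
  have \<Omega>m: "\<Omega> \<in> sets lebesgue" using \<Omega> by (rule open_sets_lebesgue)
  have box: "AE x in lebesgue. x \<in> box a b \<longrightarrow> d x = 0" if ab: "cbox a b \<subseteq> \<Omega>" for a b
  proof -
    define f where "f = (\<lambda>x. if x \<in> cbox a b then d x else 0)"
    have dK: "set_integrable lebesgue (cbox a b) d"
      using d ab by (auto simp: L1_loc_def)
    have f_int: "f integrable_on cbox p q" for p q
    proof -
      have "set_integrable lebesgue (cbox a b \<inter> cbox p q) d"
        by (rule set_integrable_subset[OF dK]) auto
      then have "d integrable_on (cbox a b \<inter> cbox p q)"
        by (rule set_lebesgue_integral_eq_integral(1))
      then show ?thesis unfolding f_def
        by (simp add: integrable_restrict_Int Int_commute)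
    qed
    obtain N where N: "negligible N" "\<And>x e. x \<notin> N \<Longrightarrow> 0 < e \<Longrightarrow>
               \<exists>r>0. \<forall>h. 0 < h \<and> h < r \<longrightarrow>
                  norm (integral (cbox x (x + h *\<^sub>R One)) f /\<^sub>R h ^ DIM(pt) - f x) < e"
      using integrable_ccontinuous_explicit[OF f_int] by blast
    have "d x = 0" if x: "x \<in> box a b" "x \<notin> N" for x
    proof (rule ccontr)
      assume "d x \<noteq> 0"
      have xc: "x \<in> cbox a b" using x(1) box_subset_cbox by blast
      \<comment> \<open>All averages over small cubes at \<open>x\<close> will turn out to be 0, so
        the precision \<open>\<bar>d x\<bar>\<close> already contradicts
        \<open>d x \<noteq> 0\<close>.\<close>
      obtain r where r: "r > 0" "\<And>h. 0 < h \<Longrightarrow> h < r \<Longrightarrow>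
                  norm (integral (cbox x (x + h *\<^sub>R One)) f /\<^sub>R h ^ DIM(pt) - f x) < \<bar>d x\<bar>"
        using N(2)[OF x(2), of "\<bar>d x\<bar>"] \<open>d x \<noteq> 0\<close> by auto
      obtain s where s: "s > 0" "ball x s \<subseteq> box a b"
        using open_box[of a b] x(1) by (meson openE)
      \<comment> \<open>The far corner of the cube of side \<open>h\<close> must stay within
        distance \<open>s\<close> of \<open>x\<close>, hence the division by the length of the
        diagonal.\<close>
      define h where "h = min (r / 2) (s / (2 * norm (One::pt)))"
      have n0: "norm (One::pt) > 0" by simp
      have h: "0 < h" "h < r" "h * norm (One::pt) < s"
        using r(1) s(1) n0 by (auto simp: h_def min_def field_simps)
      have corner: "x + h *\<^sub>R One \<in> ball x s" using h by (simp add: dist_norm)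
      have sub: "cbox x (x + h *\<^sub>R One) \<subseteq> cbox a b"
      proof -
        have "x + h *\<^sub>R One \<in> cbox a b" using corner s(2) box_subset_cbox by blast
        then show ?thesis using xc by (auto simp: mem_box subset_box)
      qed
      have "integral (cbox x (x + h *\<^sub>R One)) f = integral (cbox x (x + h *\<^sub>R One)) d"
        by (rule Henstock_Kurzweil_Integration.integral_cong) (use sub in \<open>auto simp: f_def\<close>)
      also have "\<dots> = 0"
        by (rule integral_cbox_eq_0[OF d z \<Omega>m]) (use sub ab in auto)
      finally show False using r(2)[OF h(1,2)] xc by (simp add: f_def)
    qed
    moreover have "N \<in> null_sets lebesgue" using N(1) by (simp add: negligible_iff_null_sets)
    ultimately show ?thesis by (auto intro!: AE_I'[of N])
  qed
  \<comment> \<open>The open domain is a countable union of closed boxes; passing from open to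
    closed boxes costs a null set.\<close>
  have cbox: "AE x in lebesgue. x \<in> cbox a b \<longrightarrow> d x = 0" if "cbox a b \<subseteq> \<Omega>" for a b
  proof -
    have "cbox a b - box a b \<in> null_sets lebesgue"
      using negligible_frontier_interval by (simp add: negligible_iff_null_sets)
    then have "AE x in lebesgue. x \<notin> cbox a b - box a b" by (rule AE_not_in)
    with box[OF that] show ?thesis by eventually_elim auto
  qed
  obtain \<D> where D: "countable \<D>" "\<D> \<subseteq> Pow \<Omega>" "\<And>X. X \<in> \<D> \<Longrightarrow> \<exists>a b. X = cbox a b" "\<Union>\<D> = \<Omega>"
    using open_countable_Union_open_cbox[OF \<Omega>] by blast
  have "AE x in lebesgue. x \<in> X \<longrightarrow> d x = 0" if X: "X \<in> \<D>" for X
  proof -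
    obtain a b where "X = cbox a b" using D(3)[OF X] by blast
    then show ?thesis using cbox[of a b] D(2) X by auto
  qed
  then have "AE x in lebesgue. \<forall>X\<in>\<D>. x \<in> X \<longrightarrow> d x = 0"
    unfolding AE_ball_countable[OF D(1)] by blast
  then have "AE x in lebesgue. x \<in> \<Omega> \<longrightarrow> d x = 0"
    by eventually_elim (use D(4) in auto)
  then show ?thesis using \<Omega>m by (simp add: AE_restrict_space_iff)
qed

lemma L2_inner_comb_test:
  assumes "u \<in> L1_loc \<Omega>" "v \<in> L1_loc \<Omega>" "\<phi> \<in> test_fun \<Omega>" "\<Omega> \<in> sets lebesgue"
  shows "L2_inner \<Omega> (\<lambda>x. c * u x + v x) \<phi> = c * L2_inner \<Omega> u \<phi> + L2_inner \<Omega> v \<phi>"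
  using L1_loc_mult_integrable(1)[OF assms(1,3,4)] L1_loc_mult_integrable(1)[OF assms(2,3,4)]
  by (simp add: L2_inner_def distrib_right mult.assoc)

lemma has_weak_pd_unique:
  assumes "has_weak_pd \<Omega> i u d" "has_weak_pd \<Omega> i u d'" "open \<Omega>"
  shows "AE x in lebesgue_on \<Omega>. d x = d' x"
proof -
  have m: "\<Omega> \<in> sets lebesgue" using assms(3) by (rule open_sets_lebesgue)
  have l: "d \<in> L1_loc \<Omega>" "d' \<in> L1_loc \<Omega>" using assms by (auto simp: has_weak_pd_def)
  have "AE x in lebesgue_on \<Omega>. -1 * d x + d' x = 0"
  proof (rule fundamental_lemma[OF L1_loc_comb[OF l] _ assms(3)])
    fix \<phi> assume t: "\<phi> \<in> test_fun \<Omega>"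
    show "L2_inner \<Omega> (\<lambda>x. - 1 * d x + d' x) \<phi> = 0"
      unfolding L2_inner_comb_test[OF l t m] using assms(1,2) t by (auto simp: has_weak_pd_def)
  qed
  then show ?thesis by eventually_elim simp
qed

lemma has_weak_pd_comb:
  assumes "has_weak_pd \<Omega> i u d" "has_weak_pd \<Omega> i v e" "open \<Omega>"
  shows "has_weak_pd \<Omega> i (\<lambda>x. c * u x + v x) (\<lambda>x. c * d x + e x)"
proof -
  have m: "\<Omega> \<in> sets lebesgue" using assms(3) by (rule open_sets_lebesgue)
  have l: "d \<in> L1_loc \<Omega>" "e \<in> L1_loc \<Omega>" "u \<in> L1_loc \<Omega>" "v \<in> L1_loc \<Omega>"
    using assms by (auto simp: has_weak_pd_def)
  show ?thesis
    using assms(1,2) unfolding has_weak_pd_def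
    by (auto simp: L1_loc_comb L2_inner_comb_test[OF _ _ _ m] test_fun_pd)
qed

lemma has_weak_pd_smooth:
  assumes "smooth u" "open \<Omega>"
  shows "has_weak_pd \<Omega> i u (pd i u)"
  unfolding has_weak_pd_def
proof (intro conjI ballI)
  have m: "\<Omega> \<in> sets lebesgue" using assms(2) by (rule open_sets_lebesgue)
  show l: "u \<in> L1_loc \<Omega>" "pd i u \<in> L1_loc \<Omega>"
    using assms smooth_pd by (auto intro!: continuous_L1_loc continuous_on_smooth)
  fix \<phi> assume t: "\<phi> \<in> test_fun \<Omega>"
  obtain K where K: "smooth \<phi>" "compact K" "K \<subseteq> \<Omega>" "\<And>x. x \<notin> K \<Longrightarrow> \<phi> x = 0"
    using test_funE[OF t] by blast
  have s: "smooth (\<lambda>x. u x * \<phi> x)" using assms(1) K(1) by (rule smooth_mult)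
  have "(LINT x|lebesgue. pd i (\<lambda>x. u x * \<phi> x) x) = 0"
    by (rule integral_pd_eq_0[where K=K])
      (use s K in \<open>auto intro!: smooth_imp_differentiable continuous_on_smooth smooth_pd\<close>)
  moreover have "pd i (\<lambda>x. u x * \<phi> x) = (\<lambda>x. u x * pd i \<phi> x + pd i u x * \<phi> x)"
    using assms(1) K(1) by (auto simp: pd_mult smooth_imp_differentiable)
  ultimately show "L2_inner \<Omega> u (pd i \<phi>) = - L2_inner \<Omega> (pd i u) \<phi>"
    using L1_loc_mult_integrable[OF l(1) test_fun_pd[OF t] m] L1_loc_mult_integrable[OF l(2) t m]
    by simp
qed

lemma test_fun_L2:
  assumes "\<phi> \<in> test_fun \<Omega>" "\<Omega> \<in> sets lebesgue"
  shows "\<phi> \<in> L2 \<Omega>"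
proof -
  have "\<phi> \<in> L1_loc \<Omega>"
    using assms test_fun_smooth by (intro continuous_L1_loc continuous_on_smooth) 
  from L1_loc_mult_integrable(1)[OF this assms] have "integrable (lebesgue_on \<Omega>) (\<lambda>x. (\<phi> x)\<^sup>2)"
    by (simp add: power2_eq_square)
  moreover have "\<phi> \<in> borel_measurable (lebesgue_on \<Omega>)"
    using assms test_fun_smooth
    by (intro measurable_restrict_space1 borel_measurable_lebesgue_continuous continuous_on_smooth)
  ultimately show ?thesis by (simp add: L2_def)
qed

subsection \<open>Sobolev spaces on a bounded open set\<close>

text \<open>Completeness of Lebesgue measure. Chosen weak derivatives are known only up to null
  sets, so even their measurability has to be inherited from an almost everywhere equal
  function.\<close>

lemma borel_measurable_lebesgue_on_AE:
  fixes f g :: "pt \<Rightarrow> real"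
  assumes "f \<in> borel_measurable (lebesgue_on S)" "AE x in lebesgue_on S. f x = g x" "S \<in> sets lebesgue"
  shows "g \<in> borel_measurable (lebesgue_on S)"
proof -
  have "(\<lambda>x. indicator S x *\<^sub>R f x) \<in> borel_measurable lebesgue"
    using assms by (simp add: borel_measurable_restrict_space_iff)
  moreover have "AE x in lebesgue. indicator S x *\<^sub>R f x = indicator S x *\<^sub>R g x"
  proof -
    have "AE x in lebesgue. x \<in> S \<longrightarrow> f x = g x"
      using assms(2,3) by (simp add: AE_restrict_space_iff)
    then show ?thesis by eventually_elim (auto simp: indicator_def)
  qed
  ultimately have "(\<lambda>x. indicator S x *\<^sub>R g x) \<in> borel_measurable lebesgue"
    by (rule borel_measurable_AE)
  then show ?thesis
    using assms(3) by (simp add: borel_measurable_restrict_space_iff)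
qed

lemma L2_AE_closed:
  assumes "u \<in> L2 S" "AE x in lebesgue_on S. u x = u' x" "S \<in> sets lebesgue"
  shows "u' \<in> L2 S"
  by (rule L2_cong_AE[OF assms(1,2) borel_measurable_lebesgue_on_AE[OF L2_measurable[OF assms(1)] assms(2,3)]])

lemma has_weak_pd_weak_pd: "has_weak_pd \<Omega> i u d \<Longrightarrow> has_weak_pd \<Omega> i u (weak_pd \<Omega> i u)"
  using someI[of "has_weak_pd \<Omega> i u" d] by (simp add: weak_pd_def)

lemma weak_pd_AE:
  assumes "has_weak_pd \<Omega> i u d" "open \<Omega>"
  shows "AE x in lebesgue_on \<Omega>. weak_pd \<Omega> i u x = d x"
  by (rule has_weak_pd_unique[OF has_weak_pd_weak_pd[OF assms(1)] assms])

lemma tendsto_L2_inner: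
  assumes "\<And>n. u n \<in> L2 S" "v \<in> L2 S" "w \<in> L2 S" "(\<lambda>n. L2_norm S (\<lambda>x. u n x - v x)) \<longlonglongrightarrow> 0"
  shows "(\<lambda>n. L2_inner S (u n) w) \<longlonglongrightarrow> L2_inner S v w"
proof -
  have "(\<lambda>n. L2_inner S (u n) w - L2_inner S v w) \<longlonglongrightarrow> 0"
  proof (rule Lim_null_comparison)
    show "\<forall>\<^sub>F n in sequentially. norm (L2_inner S (u n) w - L2_inner S v w) \<le>
        L2_norm S (\<lambda>x. u n x - v x) * L2_norm S w"
      using L2_cauchy_schwarz[OF L2.diff_mem[OF assms(1,2)] assms(3)]
      by (simp add: L2.diff_left assms)
    show "(\<lambda>n. L2_norm S (\<lambda>x. u n x - v x) * L2_norm S w) \<longlonglongrightarrow> 0"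
      using tendsto_mult[OF assms(4) tendsto_const] by simp
  qed
  then show ?thesis by (simp add: LIM_zero_iff)
qed

locale bounded_open =
  fixes \<Omega> :: "pt set"
  assumes open_domain: "open \<Omega>" and bounded_domain: "bounded \<Omega>"
begin

lemma measurable_domain: "\<Omega> \<in> sets lebesgue"
  by (rule open_sets_lebesgue[OF open_domain])

lemma lmeasurable_domain: "\<Omega> \<in> lmeasurable"
  using bounded_domain measurable_domain by (rule bounded_set_imp_lmeasurable)

lemma H1_L2: "u \<in> H1 \<Omega> \<Longrightarrow> u \<in> L2 \<Omega>"
  by (simp add: H1_def)

lemma H1_has_weak_pd: "u \<in> H1 \<Omega> \<Longrightarrow> has_weak_pd \<Omega> i u (weak_pd \<Omega> i u)"
proof -
  assume "u \<in> H1 \<Omega>"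
  then obtain d where "has_weak_pd \<Omega> i u d" by (auto simp: H1_def)
  then show ?thesis by (rule has_weak_pd_weak_pd)
qed

lemma weak_pd_L2:
  assumes "u \<in> H1 \<Omega>"
  shows "weak_pd \<Omega> i u \<in> L2 \<Omega>"
proof -
  obtain d where d: "d \<in> L2 \<Omega>" "has_weak_pd \<Omega> i u d" using assms by (auto simp: H1_def)
  have "AE x in lebesgue_on \<Omega>. d x = weak_pd \<Omega> i u x"
    using weak_pd_AE[OF d(2) open_domain] by eventually_elim simp
  from L2_AE_closed[OF d(1) this measurable_domain] show ?thesis .
qed

lemma H1I: "u \<in> L2 \<Omega> \<Longrightarrow> (\<And>i. d i \<in> L2 \<Omega>) \<Longrightarrow> (\<And>i. has_weak_pd \<Omega> i u (d i)) \<Longrightarrow> u \<in> H1 \<Omega>"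
  by (auto simp: H1_def)

lemma weak_pd_norm_eq:
  assumes "has_weak_pd \<Omega> i u d" "d \<in> L2 \<Omega>"
  shows "L2_norm \<Omega> (weak_pd \<Omega> i u) = L2_norm \<Omega> d"
proof -
  have *: "AE x in lebesgue_on \<Omega>. d x = weak_pd \<Omega> i u x"
    using weak_pd_AE[OF assms(1) open_domain] by eventually_elim simp
  from L2_norm_cong_AE[OF * L2_measurable[OF assms(2)] L2_measurable[OF L2_AE_closed[OF assms(2) * measurable_domain]]]
  show ?thesis by simp
qed

lemma H1_comb:
  assumes "u \<in> H1 \<Omega>" "v \<in> H1 \<Omega>"
  shows "(\<lambda>x. c * u x + v x) \<in> H1 \<Omega>"
  by (rule H1I[OF L2_comb[OF H1_L2 H1_L2] L2_comb[OF weak_pd_L2 weak_pd_L2]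
        has_weak_pd_comb[OF H1_has_weak_pd H1_has_weak_pd open_domain]]) (use assms in auto)

lemma weak_pd_comb_AE:
  assumes "u \<in> H1 \<Omega>" "v \<in> H1 \<Omega>"
  shows "AE x in lebesgue_on \<Omega>. weak_pd \<Omega> i (\<lambda>x. c * u x + v x) x = c * weak_pd \<Omega> i u x + weak_pd \<Omega> i v x"
  by (rule weak_pd_AE[OF has_weak_pd_comb[OF H1_has_weak_pd H1_has_weak_pd open_domain] open_domain]) (use assms in auto)

lemma test_fun_H1: "\<phi> \<in> test_fun \<Omega> \<Longrightarrow> \<phi> \<in> H1 \<Omega>"
  by (rule H1I[of _ "\<lambda>i. pd i \<phi>"])
    (auto intro: test_fun_L2 test_fun_pd has_weak_pd_smooth test_fun_smooth open_domain measurable_domain)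

lemma weak_pd_diff_norm:
  assumes "u \<in> H1 \<Omega>" "v \<in> H1 \<Omega>"
  shows "L2_norm \<Omega> (weak_pd \<Omega> i (\<lambda>x. u x - v x)) = L2_norm \<Omega> (\<lambda>x. weak_pd \<Omega> i u x - weak_pd \<Omega> i v x)"
proof -
  have "has_weak_pd \<Omega> i (\<lambda>x. -1 * v x + u x) (\<lambda>x. -1 * weak_pd \<Omega> i v x + weak_pd \<Omega> i u x)"
    using assms by (intro has_weak_pd_comb H1_has_weak_pd open_domain)
  then have "has_weak_pd \<Omega> i (\<lambda>x. u x - v x) (\<lambda>x. weak_pd \<Omega> i u x - weak_pd \<Omega> i v x)"
    by simp
  from weak_pd_norm_eq[OF this L2.diff_mem[OF weak_pd_L2 weak_pd_L2]] assms show ?thesis by blast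
qed

lemma weak_pd_test_diff_norm:
  assumes "\<phi> \<in> test_fun \<Omega>" "u \<in> H1 \<Omega>"
  shows "L2_norm \<Omega> (weak_pd \<Omega> i (\<lambda>x. \<phi> x - u x)) = L2_norm \<Omega> (\<lambda>x. pd i \<phi> x - weak_pd \<Omega> i u x)"
proof -
  have "has_weak_pd \<Omega> i (\<lambda>x. -1 * u x + \<phi> x) (\<lambda>x. -1 * weak_pd \<Omega> i u x + pd i \<phi> x)"
    using assms by (intro has_weak_pd_comb H1_has_weak_pd open_domain has_weak_pd_smooth test_fun_smooth)
  then have "has_weak_pd \<Omega> i (\<lambda>x. \<phi> x - u x) (\<lambda>x. pd i \<phi> x - weak_pd \<Omega> i u x)"
    by simp
  moreover have "(\<lambda>x. pd i \<phi> x - weak_pd \<Omega> i u x) \<in> L2 \<Omega>"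
    using assms by (intro L2.diff_mem weak_pd_L2 test_fun_L2 test_fun_pd measurable_domain)
  ultimately show ?thesis by (rule weak_pd_norm_eq)
qed

lemma component_le_grad_norm: "L2_norm \<Omega> (weak_pd \<Omega> i u) \<le> grad_norm \<Omega> u"
proof -
  have "(L2_norm \<Omega> (weak_pd \<Omega> i u))\<^sup>2 \<le> (\<Sum>i\<in>UNIV. (L2_norm \<Omega> (weak_pd \<Omega> i u))\<^sup>2)"
    by (rule member_le_sum) auto
  then show ?thesis
    unfolding grad_norm_def by (rule real_le_rsqrt)
qed

lemma H10_approximation:
  assumes "u \<in> H10 \<Omega>"
  obtains \<phi> where "\<And>n::nat. \<phi> n \<in> test_fun \<Omega>" "(\<lambda>n. L2_norm \<Omega> (\<lambda>x. \<phi> n x - u x)) \<longlonglongrightarrow> 0"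
    "\<And>i. (\<lambda>n. L2_norm \<Omega> (\<lambda>x. pd i (\<phi> n) x - weak_pd \<Omega> i u x)) \<longlonglongrightarrow> 0"
proof -
  obtain \<phi> where \<phi>: "\<And>n::nat. \<phi> n \<in> test_fun \<Omega>" "(\<lambda>n. H1_norm \<Omega> (\<phi> n - u)) \<longlonglongrightarrow> 0"
    using assms by (auto simp: H10_def)
  have u: "u \<in> H1 \<Omega>" using assms by (simp add: H10_def)
  have le: "L2_norm \<Omega> w \<le> H1_norm \<Omega> w" "grad_norm \<Omega> w \<le> H1_norm \<Omega> w" for w
    unfolding H1_norm_def by (rule real_le_rsqrt, simp)+
  show ?thesis
  proof (rule that[OF \<phi>(1)])
    show "(\<lambda>n. L2_norm \<Omega> (\<lambda>x. \<phi> n x - u x)) \<longlonglongrightarrow> 0"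
      by (rule Lim_null_comparison[OF _ \<phi>(2)])
        (use le(1)[of "\<phi> _ - u"] in \<open>simp add: fun_diff_def L2_norm_nonneg\<close>)
    show "(\<lambda>n. L2_norm \<Omega> (\<lambda>x. pd i (\<phi> n) x - weak_pd \<Omega> i u x)) \<longlonglongrightarrow> 0" for i
    proof (rule Lim_null_comparison[OF _ \<phi>(2)])
      have "L2_norm \<Omega> (\<lambda>x. pd i (\<phi> n) x - weak_pd \<Omega> i u x) \<le> H1_norm \<Omega> (\<phi> n - u)" for n
        using component_le_grad_norm[of i "\<phi> n - u"] le(2)[of "\<phi> n - u"]
          weak_pd_test_diff_norm[OF \<phi>(1) u, of i n] by (simp add: fun_diff_def)
      then show "\<forall>\<^sub>F n in sequentially. norm (L2_norm \<Omega> (\<lambda>x. pd i (\<phi> n) x - weak_pd \<Omega> i u x)) \<le> H1_norm \<Omega> (\<phi> n - u)"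
        by (simp add: L2_norm_nonneg)
    qed
  qed
qed

text \<open>The weak derivative is a closed operator: for a fixed test function both sides of its
  defining identity are continuous in L2.\<close>

lemma weak_pd_limit:
  assumes "\<And>n. u n \<in> L2 \<Omega>" "\<And>n. d n \<in> L2 \<Omega>" "\<And>n::nat. has_weak_pd \<Omega> i (u n) (d n)" "v \<in> L2 \<Omega>" "e \<in> L2 \<Omega>"
    "(\<lambda>n. L2_norm \<Omega> (\<lambda>x. u n x - v x)) \<longlonglongrightarrow> 0" "(\<lambda>n. L2_norm \<Omega> (\<lambda>x. d n x - e x)) \<longlonglongrightarrow> 0"
  shows "has_weak_pd \<Omega> i v e"
  unfolding has_weak_pd_def
proof (intro conjI ballI)
  show "v \<in> L1_loc \<Omega>" "e \<in> L1_loc \<Omega>" using assms(4,5) measurable_domain by (auto intro: L2_imp_L1_loc)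
  fix \<phi> assume \<phi>: "\<phi> \<in> test_fun \<Omega>"
  have t: "\<phi> \<in> L2 \<Omega>" "pd i \<phi> \<in> L2 \<Omega>" using \<phi> by (auto intro: test_fun_L2 test_fun_pd measurable_domain)
  have "(\<lambda>n. L2_inner \<Omega> (u n) (pd i \<phi>)) \<longlonglongrightarrow> L2_inner \<Omega> v (pd i \<phi>)"
    by (rule tendsto_L2_inner[OF assms(1,4) t(2) assms(6)])
  moreover have "(\<lambda>n. - L2_inner \<Omega> (d n) \<phi>) \<longlonglongrightarrow> - L2_inner \<Omega> e \<phi>"
    by (intro tendsto_minus tendsto_L2_inner[OF assms(2,5) t(1) assms(7)])
  moreover have "L2_inner \<Omega> (u n) (pd i \<phi>) = - L2_inner \<Omega> (d n) \<phi>" for n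
    using assms(3) \<phi> by (auto simp: has_weak_pd_def)
  ultimately show "L2_inner \<Omega> v (pd i \<phi>) = - L2_inner \<Omega> e \<phi>"
    using LIMSEQ_unique by simp
qed

text \<open>The limits \<open>d i\<close> of the gradients are given as mere L2 functions and
  closedness identifies them as weak derivatives. Membership in H10 is thereby reduced to L2
  convergence, with no reference to the chosen \<open>weak_pd\<close>.\<close>

lemma H10I:
  assumes u: "u \<in> L2 \<Omega>" and d: "\<And>i. d i \<in> L2 \<Omega>" and \<phi>: "\<And>n::nat. \<phi> n \<in> test_fun \<Omega>"
    and lim: "(\<lambda>n. L2_norm \<Omega> (\<lambda>x. \<phi> n x - u x)) \<longlonglongrightarrow> 0"
    "\<And>i. (\<lambda>n. L2_norm \<Omega> (\<lambda>x. pd i (\<phi> n) x - d i x)) \<longlonglongrightarrow> 0"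
  shows "u \<in> H10 \<Omega>" "\<And>i. has_weak_pd \<Omega> i u (d i)"
proof -
  show w: "has_weak_pd \<Omega> i u (d i)" for i
    by (rule weak_pd_limit[OF _ _ _ u d lim(1) lim(2)])
      (use \<phi> in \<open>auto intro: test_fun_L2 test_fun_pd measurable_domain has_weak_pd_smooth test_fun_smooth open_domain\<close>)
  have H: "u \<in> H1 \<Omega>" by (rule H1I[OF u d w])
  have eq: "L2_norm \<Omega> (weak_pd \<Omega> i (\<lambda>x. \<phi> n x - u x)) = L2_norm \<Omega> (\<lambda>x. pd i (\<phi> n) x - d i x)" for i n
  proof -
    have "has_weak_pd \<Omega> i (\<lambda>x. -1 * u x + \<phi> n x) (\<lambda>x. -1 * d i x + pd i (\<phi> n) x)"
      using \<phi> by (intro has_weak_pd_comb w open_domain has_weak_pd_smooth test_fun_smooth)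
    then have "has_weak_pd \<Omega> i (\<lambda>x. \<phi> n x - u x) (\<lambda>x. pd i (\<phi> n) x - d i x)"
      by simp
    moreover have "(\<lambda>x. pd i (\<phi> n) x - d i x) \<in> L2 \<Omega>"
      by (intro L2.diff_mem d test_fun_L2 test_fun_pd measurable_domain \<phi>)
    ultimately show ?thesis by (rule weak_pd_norm_eq)
  qed
  have "(\<lambda>n. H1_norm \<Omega> (\<phi> n - u)) \<longlonglongrightarrow> sqrt (0\<^sup>2 + (sqrt (\<Sum>i\<in>(UNIV::3 set). 0\<^sup>2))\<^sup>2)"
    unfolding H1_norm_def grad_norm_def fun_diff_def eq by (intro tendsto_intros lim)
  then show "u \<in> H10 \<Omega>" using \<phi> H by (auto simp: H10_def)
qed

lemma H10_H1: "u \<in> H10 \<Omega> \<Longrightarrow> u \<in> H1 \<Omega>"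
  by (simp add: H10_def)

lemma H10_L2: "u \<in> H10 \<Omega> \<Longrightarrow> u \<in> L2 \<Omega>"
  by (simp add: H10_def H1_L2)

lemma H10_weak_pd_L2: "u \<in> H10 \<Omega> \<Longrightarrow> weak_pd \<Omega> i u \<in> L2 \<Omega>"
  by (simp add: H10_H1 weak_pd_L2)

lemma L2_norm_0: "L2_norm \<Omega> (\<lambda>x. 0) = 0"
  by (simp add: L2_norm_def L2_inner_def)

lemma test_fun_H10: "\<phi> \<in> test_fun \<Omega> \<Longrightarrow> \<phi> \<in> H10 \<Omega>"
  by (rule H10I(1)[of \<phi> "\<lambda>i. pd i \<phi>" "\<lambda>n. \<phi>"])
    (auto intro: test_fun_L2 test_fun_pd measurable_domain simp: L2_norm_0)

lemma L2_comb_limit: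
  assumes "\<And>n. u n \<in> L2 \<Omega>" "\<And>n. v n \<in> L2 \<Omega>" "u' \<in> L2 \<Omega>" "v' \<in> L2 \<Omega>"
    "(\<lambda>n. L2_norm \<Omega> (\<lambda>x. u n x - u' x)) \<longlonglongrightarrow> 0" "(\<lambda>n. L2_norm \<Omega> (\<lambda>x. v n x - v' x)) \<longlonglongrightarrow> 0"
  shows "(\<lambda>n. L2_norm \<Omega> (\<lambda>x. (c * u n x + v n x) - (c * u' x + v' x))) \<longlonglongrightarrow> 0"
proof (rule Lim_null_comparison)
  have "L2_norm \<Omega> (\<lambda>x. (c * u n x + v n x) - (c * u' x + v' x))
      \<le> \<bar>c\<bar> * L2_norm \<Omega> (\<lambda>x. u n x - u' x) + L2_norm \<Omega> (\<lambda>x. v n x - v' x)" for n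
  proof -
    have "(\<lambda>x. (c * u n x + v n x) - (c * u' x + v' x)) = (\<lambda>x. c * (u n x - u' x) + (v n x - v' x))"
      by (auto simp: algebra_simps)
    then show ?thesis
      using L2_triangle[OF L2.scale_mem[OF L2.diff_mem[OF assms(1,3)]] L2.diff_mem[OF assms(2,4)], of c n n]
      by (simp add: L2_norm_scale)
  qed
  then show "\<forall>\<^sub>F n in sequentially. norm (L2_norm \<Omega> (\<lambda>x. (c * u n x + v n x) - (c * u' x + v' x)))
      \<le> \<bar>c\<bar> * L2_norm \<Omega> (\<lambda>x. u n x - u' x) + L2_norm \<Omega> (\<lambda>x. v n x - v' x)"
    by (simp add: L2_norm_nonneg)
  show "(\<lambda>n. \<bar>c\<bar> * L2_norm \<Omega> (\<lambda>x. u n x - u' x) + L2_norm \<Omega> (\<lambda>x. v n x - v' x)) \<longlonglongrightarrow> 0"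
    using tendsto_add[OF tendsto_mult[OF tendsto_const assms(5)] assms(6), of "\<bar>c\<bar>"] by simp
qed

lemma H10_comb:
  assumes "u \<in> H10 \<Omega>" "v \<in> H10 \<Omega>"
  shows "(\<lambda>x. c * u x + v x) \<in> H10 \<Omega>"
proof -
  obtain \<phi> where \<phi>: "\<And>n::nat. \<phi> n \<in> test_fun \<Omega>" "(\<lambda>n. L2_norm \<Omega> (\<lambda>x. \<phi> n x - u x)) \<longlonglongrightarrow> 0"
    "\<And>i. (\<lambda>n. L2_norm \<Omega> (\<lambda>x. pd i (\<phi> n) x - weak_pd \<Omega> i u x)) \<longlonglongrightarrow> 0"
    using H10_approximation[OF assms(1)] by blast
  obtain \<psi> where \<psi>: "\<And>n::nat. \<psi> n \<in> test_fun \<Omega>" "(\<lambda>n. L2_norm \<Omega> (\<lambda>x. \<psi> n x - v x)) \<longlonglongrightarrow> 0"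
    "\<And>i. (\<lambda>n. L2_norm \<Omega> (\<lambda>x. pd i (\<psi> n) x - weak_pd \<Omega> i v x)) \<longlonglongrightarrow> 0"
    using H10_approximation[OF assms(2)] by blast
  have pd_eq: "pd i (\<lambda>x. c * \<phi> n x + \<psi> n x) = (\<lambda>x. c * pd i (\<phi> n) x + pd i (\<psi> n) x)" for i n
  proof -
    have s: "smooth (\<phi> n)" "smooth (\<psi> n)" using \<phi>(1) \<psi>(1) by (auto intro: test_fun_smooth)
    show ?thesis
      using s smooth_cmult[OF s(1)] by (simp add: pd_add pd_cmult smooth_imp_differentiable)
  qed
  have t: "\<phi> n \<in> L2 \<Omega>" "\<psi> n \<in> L2 \<Omega>" "pd i (\<phi> n) \<in> L2 \<Omega>" "pd i (\<psi> n) \<in> L2 \<Omega>" for i n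
    using \<phi>(1) \<psi>(1) by (auto intro: test_fun_L2 test_fun_pd measurable_domain)
  show ?thesis
  proof (rule H10I(1))
    show "(\<lambda>x. c * u x + v x) \<in> L2 \<Omega>" using assms by (intro L2_comb H10_L2)
    show "(\<lambda>x. c * weak_pd \<Omega> i u x + weak_pd \<Omega> i v x) \<in> L2 \<Omega>" for i
      using assms by (intro L2_comb H10_weak_pd_L2)
    show "(\<lambda>x. c * \<phi> n x + \<psi> n x) \<in> test_fun \<Omega>" for n using \<phi>(1) \<psi>(1) by (rule test_fun_comb)
    show "(\<lambda>n. L2_norm \<Omega> (\<lambda>x. (c * \<phi> n x + \<psi> n x) - (c * u x + v x))) \<longlonglongrightarrow> 0"
      by (rule L2_comb_limit[OF t(1,2) H10_L2[OF assms(1)] H10_L2[OF assms(2)] \<phi>(2) \<psi>(2)])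
    show "(\<lambda>n. L2_norm \<Omega> (\<lambda>x. pd i (\<lambda>x. c * \<phi> n x + \<psi> n x) x - (c * weak_pd \<Omega> i u x + weak_pd \<Omega> i v x))) \<longlonglongrightarrow> 0" for i
      unfolding pd_eq
      by (rule L2_comb_limit[OF t(3,4) H10_weak_pd_L2[OF assms(1)] H10_weak_pd_L2[OF assms(2)] \<phi>(3) \<psi>(3)])
  qed
qed

lemma H10_zero: "(\<lambda>x. 0) \<in> H10 \<Omega>"
  by (intro test_fun_H10 test_funI[of _ "{}"]) (auto simp: smooth_const)

end

subsection \<open>Hardy and Poincare inequalities\<close>

text \<open>The vector field behind Hardy's inequality, regularised by \<open>s\<close> so that it
  is differentiable at \<open>x0\<close> as well and can be multiplied by any test function.\<close>

lemma hardy_field: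
  fixes x0 :: pt assumes s: "s > 0"
  defines "\<rho> \<equiv> \<lambda>x. 1 / ((x - x0) \<bullet> (x - x0) + s\<^sup>2)"
  shows "((\<lambda>x. (x - x0) $ i * \<rho> x) has_derivative
    (\<lambda>h. h $ i * \<rho> x - (x - x0) $ i * (2 * ((x - x0) \<bullet> h)) * (\<rho> x)\<^sup>2)) (at x)"
proof -
  have pos: "(x - x0) \<bullet> (x - x0) + s\<^sup>2 \<noteq> 0"
    using s inner_ge_zero[of "x - x0"] zero_less_power[of s 2] by linarith
  have c: "((\<lambda>x. (x - x0) $ i) has_derivative (\<lambda>h. h $ i)) (at x)"
    by (auto intro!: derivative_eq_intros bounded_linear_imp_has_derivative bounded_linear_vec_nth)
  have q: "((\<lambda>x. (x - x0) \<bullet> (x - x0) + s\<^sup>2) has_derivative (\<lambda>h. 2 * ((x - x0) \<bullet> h))) (at x)"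
    by (auto intro!: derivative_eq_intros simp: inner_commute)
  have "((\<lambda>x. (x - x0) $ i / ((x - x0) \<bullet> (x - x0) + s\<^sup>2)) has_derivative
      (\<lambda>h. (h $ i * ((x - x0) \<bullet> (x - x0) + s\<^sup>2) - (x - x0) $ i * (2 * ((x - x0) \<bullet> h))) /
        (((x - x0) \<bullet> (x - x0) + s\<^sup>2) * ((x - x0) \<bullet> (x - x0) + s\<^sup>2)))) (at x)"
    by (rule has_derivative_divide'[OF c q pos])
  moreover have "(A * B - C) / (B * B) = A * (1 / B) - C * (1 / B)\<^sup>2" if "B \<noteq> 0" for A B C :: real
    using that by (simp add: field_simps power2_eq_square)
  ultimately show ?thesis using pos by (simp add: \<rho>_def)
qed

lemma integrable_continuous_compact_support:
  fixes f :: "pt \<Rightarrow> real"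
  assumes "continuous_on UNIV f" "compact K" "\<And>x. x \<notin> K \<Longrightarrow> f x = 0"
  shows "integrable lebesgue f"
proof -
  have "set_integrable lebesgue K f"
    using continuous_L1_loc[OF assms(1), of UNIV] assms(2) by (simp add: L1_loc_def)
  moreover have "(\<lambda>x. indicator K x *\<^sub>R f x) = f"
  proof
    fix x show "indicator K x *\<^sub>R f x = f x" using assms(3)[of x] by (cases "x \<in> K") auto
  qed
  ultimately show ?thesis by (simp add: set_integrable_def)
qed

text \<open>The divergence of $\varphi^2 (x - x_0) \rho$ integrates to zero, and the field
  $(x - x_0) \rho$ has divergence at least $\rho$.\<close>

lemma hardy_smooth:
  assumes s: "s > 0" and \<phi>: "smooth \<phi>" "compact K" "\<And>x. x \<notin> K \<Longrightarrow> \<phi> x = 0"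
  shows "(LINT x|lebesgue. (\<phi> x)\<^sup>2 / ((dist x x0)\<^sup>2 + s\<^sup>2)) \<le> 4 * (\<Sum>i\<in>UNIV. LINT x|lebesgue. (pd i \<phi> x)\<^sup>2)"
proof -
  define \<rho> where "\<rho> x = 1 / ((x - x0) \<bullet> (x - x0) + s\<^sup>2)" for x
  have pos: "(x - x0) \<bullet> (x - x0) + s\<^sup>2 > 0" for x
    using s inner_ge_zero[of "x - x0"] zero_less_power[of s 2] by linarith
  have \<rho>_eq: "1 / ((dist x x0)\<^sup>2 + s\<^sup>2) = \<rho> x" for x
    by (simp add: \<rho>_def dist_norm power2_norm_eq_inner)
  have \<rho>_cont: "continuous_on UNIV \<rho>"
    unfolding \<rho>_def using pos by (intro continuous_intros) (metis less_irrefl)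
  have \<phi>_cont: "continuous_on UNIV \<phi>" "\<And>i. continuous_on UNIV (pd i \<phi>)"
    using \<phi> by (auto intro: continuous_on_smooth smooth_pd)
  have pd0: "pd i \<phi> x = 0" if "x \<notin> K" for i x
    by (rule pd_zero_outside[OF compact_imp_closed[OF \<phi>(2)] \<phi>(3) that])
  define g where "g i = (\<lambda>x. (x - x0) $ i * \<rho> x)" for i
  define f where "f i = (\<lambda>x. \<phi> x * \<phi> x * g i x)" for i
  define G where "G i x = \<rho> x - 2 * ((x - x0) $ i)\<^sup>2 * (\<rho> x)\<^sup>2" for i x
  have g_der: "(g i has_derivative (\<lambda>h. h $ i * \<rho> x - (x - x0) $ i * (2 * ((x - x0) \<bullet> h)) * (\<rho> x)\<^sup>2)) (at x)" for i x
    unfolding g_def \<rho>_def by (rule hardy_field[OF s])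
  have g_pd: "pd i (g i) x = G i x" for i x
    using pd_eqI[OF g_der[of i x], of i]
    by (simp add: G_def inner_axis power2_eq_square)
  have g_diff: "g i differentiable (at x)" for i x using g_der by (auto simp: differentiable_def)
  have \<phi>_diff: "\<phi> differentiable (at x)" for x using \<phi>(1) by (rule smooth_imp_differentiable)
  have f_diff: "f i differentiable (at x)" for i x
    unfolding f_def by (intro differentiable_mult \<phi>_diff g_diff)
  have f_pd: "pd i (f i) = (\<lambda>x. (\<phi> x)\<^sup>2 * G i x + 2 * \<phi> x * pd i \<phi> x * g i x)" for i
  proof
    fix x
    have "pd i (f i) x = \<phi> x * \<phi> x * pd i (g i) x + pd i (\<lambda>x. \<phi> x * \<phi> x) x * g i x"
      unfolding f_def by (intro pd_mult differentiable_mult \<phi>_diff g_diff)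
    also have "pd i (\<lambda>x. \<phi> x * \<phi> x) x = \<phi> x * pd i \<phi> x + pd i \<phi> x * \<phi> x"
      by (intro pd_mult \<phi>_diff)
    finally show "pd i (f i) x = (\<phi> x)\<^sup>2 * G i x + 2 * \<phi> x * pd i \<phi> x * g i x"
      by (simp add: g_pd power2_eq_square algebra_simps)
  qed
  have comp_cont: "continuous_on UNIV (\<lambda>x::pt. (x - x0) $ i)" for i
    by (intro continuous_intros)
  have pd_cont: "continuous_on UNIV (pd i (f i))" for i
    unfolding f_pd G_def g_def by (intro continuous_intros \<phi>_cont \<rho>_cont comp_cont)
  have z: "(LINT x|lebesgue. pd i (f i) x) = 0" for i
    by (rule integral_pd_eq_0[OF f_diff pd_cont \<phi>(2)]) (simp add: f_def \<phi>(3))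
  have int_pd: "integrable lebesgue (pd i (f i))" for i
    by (rule integrable_continuous_compact_support[OF pd_cont \<phi>(2)]) (simp add: f_pd \<phi>(3))
  have int_sq: "integrable lebesgue (\<lambda>x. (pd i \<phi> x)\<^sup>2)" for i
    by (rule integrable_continuous_compact_support[OF _ \<phi>(2)])
      (auto intro!: continuous_intros \<phi>_cont simp: pd0)
  have int_w: "integrable lebesgue (\<lambda>x. (\<phi> x)\<^sup>2 * \<rho> x)"
    by (rule integrable_continuous_compact_support[OF _ \<phi>(2)])
      (auto intro!: continuous_intros \<phi>_cont \<rho>_cont simp: \<phi>(3))
  have pointwise: "(\<phi> x)\<^sup>2 * \<rho> x \<le> 2 * (\<Sum>i\<in>UNIV. pd i (f i) x) + 4 * (\<Sum>i\<in>UNIV. (pd i \<phi> x)\<^sup>2)" for x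
  proof -
    define y where "y = x - x0"
    define r where "r = \<rho> x"
    define v :: pt where "v = (\<chi> i. pd i \<phi> x)"
    have r: "r > 0" "(y \<bullet> y) * r \<le> 1"
      using pos[of x] zero_le_power2[of s] by (auto simp: r_def \<rho>_def y_def divide_simps)
    have sq: "(\<Sum>i\<in>UNIV. (y $ i)\<^sup>2) = y \<bullet> y" "(\<Sum>i\<in>UNIV. (pd i \<phi> x)\<^sup>2) = v \<bullet> v"
      by (simp_all add: inner_vec_def power2_eq_square v_def)
    have cross: "(\<Sum>i\<in>UNIV. pd i \<phi> x * y $ i) = v \<bullet> y" by (simp add: inner_vec_def v_def)
    have "(\<Sum>i\<in>UNIV. pd i (f i) x) = (\<Sum>i\<in>UNIV. (\<phi> x)\<^sup>2 * r - 2 * (\<phi> x)\<^sup>2 * r\<^sup>2 * (y $ i)\<^sup>2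
        + 2 * \<phi> x * r * (pd i \<phi> x * y $ i))"
      by (intro sum.cong) (auto simp: f_pd G_def g_def r_def y_def algebra_simps)
    also have "\<dots> = 3 * (\<phi> x)\<^sup>2 * r - 2 * (\<phi> x)\<^sup>2 * r\<^sup>2 * (y \<bullet> y) + 2 * \<phi> x * r * (v \<bullet> y)"
      unfolding sum.distrib sum_subtractf sum_distrib_left[symmetric] sq cross by simp
    finally have div: "(\<Sum>i\<in>UNIV. pd i (f i) x) =
        3 * ((\<phi> x)\<^sup>2 * r) - 2 * ((\<phi> x)\<^sup>2 * r * ((y \<bullet> y) * r)) + 2 * \<phi> x * r * (v \<bullet> y)"
      by (simp add: power2_eq_square algebra_simps)
    have "((\<phi> x)\<^sup>2 * r) * ((y \<bullet> y) * r) \<le> ((\<phi> x)\<^sup>2 * r) * 1"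
      using r by (intro mult_left_mono) auto
    with div have 1: "(\<phi> x)\<^sup>2 * r \<le> (\<Sum>i\<in>UNIV. pd i (f i) x) - 2 * \<phi> x * r * (v \<bullet> y)" by linarith
    have "(v \<bullet> y)\<^sup>2 * r \<le> (v \<bullet> v) * (y \<bullet> y) * r"
      using r Cauchy_Schwarz_ineq[of v y] by (intro mult_right_mono) auto
    also have "\<dots> \<le> (v \<bullet> v) * 1"
      using r(2) unfolding mult.assoc by (intro mult_left_mono) auto
    finally have 2: "(v \<bullet> y)\<^sup>2 * r \<le> v \<bullet> v" by simp
    \<comment> \<open>Young's inequality: half of the left-hand side absorbs the cross term, which
      produces the constant 4.\<close>
    have "0 \<le> r * (\<phi> x + 2 * (v \<bullet> y))\<^sup>2" using r by simp
    then have "- 4 * \<phi> x * r * (v \<bullet> y) \<le> (\<phi> x)\<^sup>2 * r + 4 * ((v \<bullet> y)\<^sup>2 * r)"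
      by (simp add: power2_eq_square algebra_simps)
    with 1 2 sq(2) show ?thesis unfolding r_def by linarith
  qed
  have "(LINT x|lebesgue. (\<phi> x)\<^sup>2 * \<rho> x) \<le>
      (LINT x|lebesgue. 2 * (\<Sum>i\<in>UNIV. pd i (f i) x) + 4 * (\<Sum>i\<in>UNIV. (pd i \<phi> x)\<^sup>2))"
    by (rule integral_mono[OF int_w]) (use int_pd int_sq pointwise in auto)
  also have "\<dots> = 4 * (\<Sum>i\<in>UNIV. LINT x|lebesgue. (pd i \<phi> x)\<^sup>2)"
    using int_pd int_sq by (simp add: z)
  finally show ?thesis
    using \<rho>_eq by (simp add: divide_inverse flip: inverse_eq_divide)
qed

lemma tendsto_zero_scaled:
  fixes f g :: "nat \<Rightarrow> real"
  assumes "\<And>n. 0 \<le> f n" "\<And>n. f n \<le> c * g n" "g \<longlonglongrightarrow> 0"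
  shows "f \<longlonglongrightarrow> 0"
proof (rule Lim_null_comparison)
  show "\<forall>\<^sub>F n in sequentially. norm (f n) \<le> c * g n" using assms(1,2) by simp
  show "(\<lambda>n. c * g n) \<longlonglongrightarrow> 0" using tendsto_mult[OF tendsto_const assms(3), of c] by simp
qed

lemma tendsto_L2_norm:
  assumes "\<And>n. u n \<in> L2 S" "v \<in> L2 S" "(\<lambda>n. L2_norm S (\<lambda>x. u n x - v x)) \<longlonglongrightarrow> 0"
  shows "(\<lambda>n. L2_norm S (u n)) \<longlonglongrightarrow> L2_norm S v"
proof -
  have "\<bar>L2_norm S (u n) - L2_norm S v\<bar> \<le> L2_norm S (\<lambda>x. u n x - v x)" for n
    using L2_triangle[OF L2.diff_mem[OF assms(1,2)] assms(2), of n]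
      L2_triangle[OF L2.diff_mem[OF assms(2,1)] assms(1), of n n] L2_norm_minus_commute[of S v "u n"]
    by simp
  then have "(\<lambda>n. L2_norm S (u n) - L2_norm S v) \<longlonglongrightarrow> 0"
    by (intro Lim_null_comparison[OF _ assms(3)]) simp
  then show ?thesis by (simp add: LIM_zero_iff)
qed

context bounded_open
begin

lemma test_grad_norm: "\<phi> \<in> test_fun \<Omega> \<Longrightarrow> grad_norm \<Omega> \<phi> = sqrt (\<Sum>i\<in>UNIV. (L2_norm \<Omega> (pd i \<phi>))\<^sup>2)"
  unfolding grad_norm_def
  by (subst weak_pd_norm_eq[OF has_weak_pd_smooth[OF test_fun_smooth open_domain]])
    (auto intro: test_fun_L2 test_fun_pd measurable_domain)

text \<open>The weight never exceeds 1/s. This makes it a bounded multiplier in limits, and it later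
  takes the place of Hardy's inequality for functions that are small only in L2.\<close>

lemma hardy_weight_L2:
  assumes "s > 0" "u \<in> L2 \<Omega>"
  shows "(\<lambda>x. u x / sqrt ((dist x x0)\<^sup>2 + s\<^sup>2)) \<in> L2 \<Omega>"
    "L2_norm \<Omega> (\<lambda>x. u x / sqrt ((dist x x0)\<^sup>2 + s\<^sup>2)) \<le> 1 / s * L2_norm \<Omega> u"
proof -
  have m: "(\<lambda>x::pt. 1 / sqrt ((dist x x0)\<^sup>2 + s\<^sup>2)) \<in> borel_measurable (lebesgue_on \<Omega>)"
    using assms(1)
    by (intro measurable_restrict_space1 borel_measurable_lebesgue_continuous continuous_intros)
      (auto simp: add_nonneg_eq_0_iff)
  have le: "\<bar>1 / sqrt ((dist x x0)\<^sup>2 + s\<^sup>2)\<bar> \<le> 1 / s" for x :: pt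
  proof -
    have "s \<le> sqrt ((dist x x0)\<^sup>2 + s\<^sup>2)" by (rule real_le_rsqrt) simp
    then show ?thesis using assms(1) by (simp add: frac_le)
  qed
  show "(\<lambda>x. u x / sqrt ((dist x x0)\<^sup>2 + s\<^sup>2)) \<in> L2 \<Omega>"
    "L2_norm \<Omega> (\<lambda>x. u x / sqrt ((dist x x0)\<^sup>2 + s\<^sup>2)) \<le> 1 / s * L2_norm \<Omega> u"
    using L2_bounded_mult[OF assms(2) m le] by simp_all
qed

lemma hardy_test:
  assumes "s > 0" "\<phi> \<in> test_fun \<Omega>"
  shows "L2_norm \<Omega> (\<lambda>x. \<phi> x / sqrt ((dist x x0)\<^sup>2 + s\<^sup>2)) \<le> 2 * grad_norm \<Omega> \<phi>"
proof -
  obtain K where K: "smooth \<phi>" "compact K" "K \<subseteq> \<Omega>" "\<And>x. x \<notin> K \<Longrightarrow> \<phi> x = 0"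
    using test_funE[OF assms(2)] by blast
  have restrict: "L2_inner \<Omega> f f = (LINT x|lebesgue. (f x)\<^sup>2)" if "\<And>x. x \<notin> K \<Longrightarrow> f x = 0" for f
  proof -
    have "(\<lambda>x. indicator \<Omega> x *\<^sub>R (f x * f x)) = (\<lambda>x. (f x)\<^sup>2)"
    proof
      fix x show "indicator \<Omega> x *\<^sub>R (f x * f x) = (f x)\<^sup>2"
        using that[of x] K(3) by (cases "x \<in> K") (auto simp: power2_eq_square)
    qed
    then show ?thesis using measurable_domain by (simp add: L2_inner_def integral_restrict_space)
  qed
  have "(\<phi> x / sqrt ((dist x x0)\<^sup>2 + s\<^sup>2))\<^sup>2 = (\<phi> x)\<^sup>2 / ((dist x x0)\<^sup>2 + s\<^sup>2)" for x
    by (simp add: power_divide)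
  then have "L2_inner \<Omega> (\<lambda>x. \<phi> x / sqrt ((dist x x0)\<^sup>2 + s\<^sup>2)) (\<lambda>x. \<phi> x / sqrt ((dist x x0)\<^sup>2 + s\<^sup>2))
      \<le> 4 * (\<Sum>i\<in>UNIV. LINT x|lebesgue. (pd i \<phi> x)\<^sup>2)"
    using hardy_smooth[OF assms(1) K(1,2,4)] K(4) by (subst restrict) auto
  also have "\<dots> = 4 * (\<Sum>i\<in>UNIV. (L2_norm \<Omega> (pd i \<phi>))\<^sup>2)"
    unfolding L2_norm_power2
    by (simp add: restrict[OF pd_zero_outside[OF compact_imp_closed[OF K(2)] K(4)]])
  finally have "L2_norm \<Omega> (\<lambda>x. \<phi> x / sqrt ((dist x x0)\<^sup>2 + s\<^sup>2))
      \<le> sqrt (4 * (\<Sum>i\<in>UNIV. (L2_norm \<Omega> (pd i \<phi>))\<^sup>2))"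
    unfolding L2_norm_def[of \<Omega> "\<lambda>x. \<phi> x / sqrt ((dist x x0)\<^sup>2 + s\<^sup>2)"] by simp
  then show ?thesis
    using test_grad_norm[OF assms(2)] by (simp add: real_sqrt_mult)
qed

text \<open>Density of test functions: for fixed \<open>s\<close> the weight is a bounded
  multiplier, so both sides pass to the limit. The constant depends neither on \<open>s\<close> nor
  on \<open>x0\<close>, so the weight can be adapted to any ball.\<close>

theorem hardy:
  assumes "s > 0" "u \<in> H10 \<Omega>"
  shows "L2_norm \<Omega> (\<lambda>x. u x / sqrt ((dist x x0)\<^sup>2 + s\<^sup>2)) \<le> 2 * grad_norm \<Omega> u"
proof -
  obtain \<phi> where \<phi>: "\<And>n::nat. \<phi> n \<in> test_fun \<Omega>" "(\<lambda>n. L2_norm \<Omega> (\<lambda>x. \<phi> n x - u x)) \<longlonglongrightarrow> 0"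
    "\<And>i. (\<lambda>n. L2_norm \<Omega> (\<lambda>x. pd i (\<phi> n) x - weak_pd \<Omega> i u x)) \<longlonglongrightarrow> 0"
    using H10_approximation[OF assms(2)] by blast
  let ?w = "\<lambda>u x. u x / sqrt ((dist x x0)\<^sup>2 + s\<^sup>2)"
  have t: "\<phi> n \<in> L2 \<Omega>" "pd i (\<phi> n) \<in> L2 \<Omega>" for n i
    using \<phi>(1) by (auto intro: test_fun_L2 test_fun_pd measurable_domain)
  have u: "u \<in> L2 \<Omega>" using assms(2) by (rule H10_L2)
  have lim1: "(\<lambda>n. L2_norm \<Omega> (?w (\<phi> n))) \<longlonglongrightarrow> L2_norm \<Omega> (?w u)"
  proof (rule tendsto_L2_norm[where u="\<lambda>n. ?w (\<phi> n)" and v="?w u"])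
    show "?w (\<phi> n) \<in> L2 \<Omega>" "?w u \<in> L2 \<Omega>" for n
      by (intro hardy_weight_L2(1) assms(1) t u)+
    have eq: "(\<lambda>x. ?w (\<phi> n) x - ?w u x) = ?w (\<lambda>x. \<phi> n x - u x)" for n
      unfolding diff_divide_distrib ..
    have "L2_norm \<Omega> (\<lambda>x. ?w (\<phi> n) x - ?w u x) \<le> 1 / s * L2_norm \<Omega> (\<lambda>x. \<phi> n x - u x)" for n
      unfolding eq by (rule hardy_weight_L2(2)[OF assms(1) L2.diff_mem[OF t(1) u]])
    then show "(\<lambda>n. L2_norm \<Omega> (\<lambda>x. ?w (\<phi> n) x - ?w u x)) \<longlonglongrightarrow> 0"
      by (rule tendsto_zero_scaled[OF L2_norm_nonneg _ \<phi>(2)])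
  qed
  have "(\<lambda>n. grad_norm \<Omega> (\<phi> n)) \<longlonglongrightarrow> grad_norm \<Omega> u"
    unfolding test_grad_norm[OF \<phi>(1)] unfolding grad_norm_def
    by (intro tendsto_intros tendsto_L2_norm[OF t(2) H10_weak_pd_L2[OF assms(2)] \<phi>(3)])
  then have lim2: "(\<lambda>n. 2 * grad_norm \<Omega> (\<phi> n)) \<longlonglongrightarrow> 2 * grad_norm \<Omega> u"
    by (intro tendsto_intros)
  show ?thesis
    by (rule LIMSEQ_le[OF lim1 lim2]) (intro exI allI impI hardy_test assms(1) \<phi>(1))
qed

text \<open>Hardy's inequality centred at the origin with \<open>s = 1\<close>: on a bounded domain
  the weight is bounded below.\<close>

theorem poincare:
  obtains C where "C > 0" "\<And>u. u \<in> H10 \<Omega> \<Longrightarrow> L2_norm \<Omega> u \<le> C * grad_norm \<Omega> u"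
proof -
  obtain R where R: "\<And>x. x \<in> \<Omega> \<Longrightarrow> norm x \<le> R" "R > 0"
    using bounded_domain by (meson bounded_pos)
  have "L2_norm \<Omega> u \<le> 2 * sqrt (R\<^sup>2 + 1) * grad_norm \<Omega> u" if u: "u \<in> H10 \<Omega>" for u
  proof -
    let ?m = "\<lambda>x::pt. sqrt ((dist x 0)\<^sup>2 + 1\<^sup>2)"
    have m: "?m \<in> borel_measurable (lebesgue_on \<Omega>)"
      by (intro measurable_restrict_space1 borel_measurable_lebesgue_continuous continuous_intros)
    have le: "\<bar>?m x\<bar> \<le> sqrt (R\<^sup>2 + 1)" if "x \<in> \<Omega>" for x
      using R(1)[OF that] by (simp add: power_mono)
    have ne: "?m x \<noteq> 0" for x by (smt (verit) one_power2 real_sqrt_gt_zero zero_le_power2)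
    have "L2_norm \<Omega> (\<lambda>x. ?m x * (u x / ?m x)) \<le> sqrt (R\<^sup>2 + 1) * L2_norm \<Omega> (\<lambda>x. u x / ?m x)"
      by (rule L2_bounded_mult(2)[OF hardy_weight_L2(1)[OF _ H10_L2[OF u]] m le]) auto
    also have "\<dots> \<le> sqrt (R\<^sup>2 + 1) * (2 * grad_norm \<Omega> u)"
      by (intro mult_left_mono hardy u) auto
    finally show ?thesis using ne by simp
  qed
  moreover have "2 * sqrt (R\<^sup>2 + 1) > 0" using R(2) by (simp add: add_nonneg_pos)
  ultimately show ?thesis by (rule that[rotated])
qed

end

subsection \<open>The Dirichlet problem\<close>

text \<open>Bounds are required at every point and for each entry, a form that fits both the
  oscillating and the constant homogenised coefficients. The resolvent and pair estimates involve
  only \<open>lam\<close>, which is common to the whole oscillating family.\<close>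

locale elliptic_coeff = bounded_open +
  fixes b :: coeff and lam Lam :: real
  assumes lam_pos: "0 < lam"
    and coeff_measurable: "\<And>i j. (\<lambda>x. b x $ i $ j) \<in> borel_measurable (lebesgue_on \<Omega>)"
    and coeff_bound: "\<And>x i j. \<bar>b x $ i $ j\<bar> \<le> Lam"
    and coeff_sym: "\<And>x i j. b x $ i $ j = b x $ j $ i"
    and coeff_elliptic: "\<And>x \<eta>. lam * (norm \<eta>)\<^sup>2 \<le> (b x *v \<eta>) \<bullet> \<eta>"
begin

lemma Lam_nonneg: "0 \<le> Lam"
  using coeff_bound by (meson abs_ge_zero order_trans)

lemma flux_component: "flux \<Omega> b u x $ i = (\<Sum>j\<in>UNIV. b x $ i $ j * weak_pd \<Omega> j u x)"
  by (simp add: flux_def grad_def matrix_vector_mult_def)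

lemma flux_L2:
  assumes "u \<in> H1 \<Omega>"
  shows "(\<lambda>x. flux \<Omega> b u x $ i) \<in> L2 \<Omega>"
  unfolding flux_component
  by (intro L2_sum L2_bounded_mult(1)[OF weak_pd_L2[OF assms] coeff_measurable coeff_bound]) auto

lemma L2_norm_sum_le:
  "finite I \<Longrightarrow> (\<And>i. i \<in> I \<Longrightarrow> u i \<in> L2 \<Omega>) \<Longrightarrow> L2_norm \<Omega> (\<lambda>x. \<Sum>i\<in>I. u i x) \<le> (\<Sum>i\<in>I. L2_norm \<Omega> (u i))"
proof (induction I rule: finite_induct)
  case (insert i I)
  have "L2_norm \<Omega> (\<lambda>x. u i x + (\<Sum>i\<in>I. u i x)) \<le> L2_norm \<Omega> (u i) + L2_norm \<Omega> (\<lambda>x. \<Sum>i\<in>I. u i x)"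
    using insert by (intro L2_triangle L2_sum) auto
  also have "L2_norm \<Omega> (\<lambda>x. \<Sum>i\<in>I. u i x) \<le> (\<Sum>i\<in>I. L2_norm \<Omega> (u i))"
    using insert by auto
  finally show ?case using insert by simp
qed (simp add: L2_norm_0)

lemma flux_norm:
  assumes "u \<in> H1 \<Omega>"
  shows "L2_norm \<Omega> (\<lambda>x. flux \<Omega> b u x $ i) \<le> 3 * Lam * grad_norm \<Omega> u"
proof -
  have "L2_norm \<Omega> (\<lambda>x. flux \<Omega> b u x $ i) \<le> (\<Sum>j\<in>UNIV. L2_norm \<Omega> (\<lambda>x. b x $ i $ j * weak_pd \<Omega> j u x))"
    unfolding flux_component
    by (intro L2_norm_sum_le L2_bounded_mult(1)[OF weak_pd_L2[OF assms] coeff_measurable coeff_bound]) auto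
  also have "\<dots> \<le> (\<Sum>j\<in>(UNIV::3 set). Lam * grad_norm \<Omega> u)"
    by (intro sum_mono order_trans[OF L2_bounded_mult(2)[OF weak_pd_L2[OF assms] coeff_measurable coeff_bound]]
        mult_left_mono component_le_grad_norm Lam_nonneg)
  finally show ?thesis by simp
qed

lemma dirichlet_form_eq:
  assumes "u \<in> H1 \<Omega>" "v \<in> H1 \<Omega>"
  shows "dirichlet_form \<Omega> b u v = (\<Sum>i\<in>UNIV. L2_inner \<Omega> (\<lambda>x. flux \<Omega> b u x $ i) (weak_pd \<Omega> i v))"
  unfolding dirichlet_form_def inner_vec_def L2_inner_def
  using L2_integrable_mult[OF flux_L2[OF assms(1)] weak_pd_L2[OF assms(2)]]
  by (simp add: grad_def)

text \<open>Each gradient is a separate choice, so linearity of the flux is only an almost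
  everywhere statement.\<close>

lemma flux_comb_AE:
  assumes "u \<in> H1 \<Omega>" "v \<in> H1 \<Omega>"
  shows "AE x in lebesgue_on \<Omega>. flux \<Omega> b (\<lambda>x. c * u x + v x) x $ i = c * flux \<Omega> b u x $ i + flux \<Omega> b v x $ i"
proof -
  have "AE x in lebesgue_on \<Omega>. \<forall>j\<in>UNIV. weak_pd \<Omega> j (\<lambda>x. c * u x + v x) x = c * weak_pd \<Omega> j u x + weak_pd \<Omega> j v x"
    by (rule AE_finite_allI) (use weak_pd_comb_AE[OF assms] in auto)
  then show ?thesis
    by eventually_elim (simp add: flux_component algebra_simps sum.distrib sum_distrib_left)
qed

text \<open>The 9 counts the matrix entries, each bounded by \<open>Lam\<close>. The bound serves
  the continuity of the form with respect to the gradient norm.\<close>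

lemma dirichlet_form_bound:
  assumes "u \<in> H1 \<Omega>" "v \<in> H1 \<Omega>"
  shows "\<bar>dirichlet_form \<Omega> b u v\<bar> \<le> 9 * Lam * grad_norm \<Omega> u * grad_norm \<Omega> v"
proof -
  have "\<bar>dirichlet_form \<Omega> b u v\<bar> \<le> (\<Sum>i\<in>UNIV. \<bar>L2_inner \<Omega> (\<lambda>x. flux \<Omega> b u x $ i) (weak_pd \<Omega> i v)\<bar>)"
    unfolding dirichlet_form_eq[OF assms] by (rule sum_abs)
  also have "\<dots> \<le> (\<Sum>i\<in>(UNIV::3 set). (3 * Lam * grad_norm \<Omega> u) * grad_norm \<Omega> v)"
  proof (rule sum_mono)
    fix i :: 3
    have "\<bar>L2_inner \<Omega> (\<lambda>x. flux \<Omega> b u x $ i) (weak_pd \<Omega> i v)\<bar>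
        \<le> L2_norm \<Omega> (\<lambda>x. flux \<Omega> b u x $ i) * L2_norm \<Omega> (weak_pd \<Omega> i v)"
      by (rule L2_cauchy_schwarz[OF flux_L2[OF assms(1)] weak_pd_L2[OF assms(2)]])
    also have "\<dots> \<le> (3 * Lam * grad_norm \<Omega> u) * grad_norm \<Omega> v"
      by (rule mult_mono[OF flux_norm[OF assms(1)] component_le_grad_norm _ L2_norm_nonneg])
        (rule order_trans[OF L2_norm_nonneg flux_norm[OF assms(1)]])
    finally show "\<bar>L2_inner \<Omega> (\<lambda>x. flux \<Omega> b u x $ i) (weak_pd \<Omega> i v)\<bar> \<le> (3 * Lam * grad_norm \<Omega> u) * grad_norm \<Omega> v" .
  qed
  finally show ?thesis by simp
qed

lemma dirichlet_form_coercive: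
  assumes "u \<in> H1 \<Omega>"
  shows "lam * (grad_norm \<Omega> u)\<^sup>2 \<le> dirichlet_form \<Omega> b u u"
proof -
  have "lam * (grad_norm \<Omega> u)\<^sup>2 = lam * (\<Sum>i\<in>UNIV. L2_inner \<Omega> (weak_pd \<Omega> i u) (weak_pd \<Omega> i u))"
    unfolding grad_norm_def L2_norm_power2[symmetric] by (simp add: sum_nonneg)
  also have "\<dots> = (LINT x|lebesgue_on \<Omega>. lam * (\<Sum>i\<in>UNIV. weak_pd \<Omega> i u x * weak_pd \<Omega> i u x))"
    unfolding L2_inner_def
    using L2_integrable_mult[OF weak_pd_L2[OF assms] weak_pd_L2[OF assms]] by simp
  also have "\<dots> \<le> (LINT x|lebesgue_on \<Omega>. flux \<Omega> b u x \<bullet> grad \<Omega> u x)"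
  proof (rule integral_mono)
    show "integrable (lebesgue_on \<Omega>) (\<lambda>x. lam * (\<Sum>i\<in>UNIV. weak_pd \<Omega> i u x * weak_pd \<Omega> i u x))"
      using L2_integrable_mult[OF weak_pd_L2[OF assms] weak_pd_L2[OF assms]] by simp
    show "integrable (lebesgue_on \<Omega>) (\<lambda>x. flux \<Omega> b u x \<bullet> grad \<Omega> u x)"
      unfolding inner_vec_def
      using L2_integrable_mult[OF flux_L2[OF assms(1)] weak_pd_L2[OF assms]] by (simp add: grad_def)
    fix x
    have "(\<Sum>i\<in>UNIV. weak_pd \<Omega> i u x * weak_pd \<Omega> i u x) = (norm (grad \<Omega> u x))\<^sup>2"
      unfolding power2_norm_eq_inner by (simp add: inner_vec_def grad_def)
    then show "lam * (\<Sum>i\<in>UNIV. weak_pd \<Omega> i u x * weak_pd \<Omega> i u x) \<le> flux \<Omega> b u x \<bullet> grad \<Omega> u x"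
      using coeff_elliptic[of "grad \<Omega> u x" x] by (simp add: flux_def)
  qed
  finally show ?thesis by (simp add: dirichlet_form_def)
qed

lemma dirichlet_form_sym: "dirichlet_form \<Omega> b u v = dirichlet_form \<Omega> b v u"
proof -
  have "flux \<Omega> b u x \<bullet> grad \<Omega> v x = flux \<Omega> b v x \<bullet> grad \<Omega> u x" for x
  proof -
    have "transpose (b x) = b x" using coeff_sym by (simp add: transpose_def vec_eq_iff)
    then show ?thesis
      unfolding flux_def by (metis dot_lmul_matrix inner_commute transpose_matrix_vector)
  qed
  then show ?thesis by (simp add: dirichlet_form_def)
qed

lemma dirichlet_form_comb:
  assumes "u \<in> H1 \<Omega>" "v \<in> H1 \<Omega>" "w \<in> H1 \<Omega>"
  shows "dirichlet_form \<Omega> b (\<lambda>x. c * u x + v x) w = c * dirichlet_form \<Omega> b u w + dirichlet_form \<Omega> b v w"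
proof -
  have "L2_inner \<Omega> (\<lambda>x. flux \<Omega> b (\<lambda>x. c * u x + v x) x $ i) (weak_pd \<Omega> i w)
      = L2_inner \<Omega> (\<lambda>x. c * flux \<Omega> b u x $ i + flux \<Omega> b v x $ i) (weak_pd \<Omega> i w)" for i
    by (rule L2_inner_cong_AE[OF flux_comb_AE[OF assms(1,2)]])
      (use assms in \<open>auto intro!: L2_measurable flux_L2 weak_pd_L2 H1_comb L2_comb\<close>)
  also have "\<dots> i = c * L2_inner \<Omega> (\<lambda>x. flux \<Omega> b u x $ i) (weak_pd \<Omega> i w) + L2_inner \<Omega> (\<lambda>x. flux \<Omega> b v x $ i) (weak_pd \<Omega> i w)" for i
    by (intro L2.comb flux_L2 weak_pd_L2 assms)
  finally show ?thesis
    by (simp add: dirichlet_form_eq assms H1_comb sum.distrib sum_distrib_left)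
qed

sublocale form: psd_form "H10 \<Omega>" "dirichlet_form \<Omega> b"
proof
  show "dirichlet_form \<Omega> b (\<lambda>x. c * u x + v x) w = c * dirichlet_form \<Omega> b u w + dirichlet_form \<Omega> b v w"
    if "u \<in> H10 \<Omega>" "v \<in> H10 \<Omega>" "w \<in> H10 \<Omega>" for c u v w
    by (intro dirichlet_form_comb H10_H1 that)
  show "0 \<le> dirichlet_form \<Omega> b u u" if "u \<in> H10 \<Omega>" for u
    using dirichlet_form_coercive[OF H10_H1[OF that]] lam_pos
    by (smt (verit) mult_nonneg_nonneg zero_le_power2)
qed (use H10_zero H10_comb dirichlet_form_sym in auto)

lemma grad_norm_le_form:
  assumes "u \<in> H10 \<Omega>"
  shows "grad_norm \<Omega> u \<le> sqrt (dirichlet_form \<Omega> b u u) / sqrt lam"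
proof -
  have "(grad_norm \<Omega> u)\<^sup>2 \<le> dirichlet_form \<Omega> b u u / lam"
    using dirichlet_form_coercive[OF H10_H1[OF assms]] lam_pos by (simp add: field_simps)
  then show ?thesis
    unfolding real_sqrt_divide[symmetric] by (rule real_le_rsqrt)
qed

end

section \<open>Completeness of H10 in the gradient norm\<close>

context bounded_open
begin

lemma H10_diff: "u \<in> H10 \<Omega> \<Longrightarrow> v \<in> H10 \<Omega> \<Longrightarrow> (\<lambda>x. u x - v x) \<in> H10 \<Omega>"
  using H10_comb[of v u "-1"] by simp

text \<open>The gradients are Cauchy in L2, and Poincare's inequality adds the functions themselves.
  A diagonal choice of test functions shows that the limit is still in their closure.\<close>

theorem H10_complete:
  assumes X: "\<And>n::nat. X n \<in> H10 \<Omega>"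
    and cauchy: "\<And>e. e > 0 \<Longrightarrow> \<exists>N. \<forall>m\<ge>N. \<forall>n\<ge>N. grad_norm \<Omega> (\<lambda>x. X m x - X n x) < e"
  shows "\<exists>u\<in>H10 \<Omega>. (\<lambda>n. grad_norm \<Omega> (\<lambda>x. X n x - u x)) \<longlonglongrightarrow> 0"
proof -
  obtain C where C: "C > 0" "\<And>u. u \<in> H10 \<Omega> \<Longrightarrow> L2_norm \<Omega> u \<le> C * grad_norm \<Omega> u"
    using poincare by blast
  have Xd: "(\<lambda>x. X m x - X n x) \<in> H10 \<Omega>" for m n by (intro H10_diff X)
  have "\<exists>u\<in>L2 \<Omega>. (\<lambda>n. L2_norm \<Omega> (\<lambda>x. X n x - u x)) \<longlonglongrightarrow> 0"
  proof (rule L2_complete[OF lmeasurable_domain H10_L2[OF X]])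
    fix e :: real assume "e > 0"
    then obtain N where N: "\<And>m n. m \<ge> N \<Longrightarrow> n \<ge> N \<Longrightarrow> grad_norm \<Omega> (\<lambda>x. X m x - X n x) < e / C"
      using cauchy[of "e / C"] C(1) by auto
    have "L2_norm \<Omega> (\<lambda>x. X m x - X n x) < e" if "m \<ge> N" "n \<ge> N" for m n
      using C(2)[OF Xd, of m n] N[OF that] C(1) by (simp add: field_simps)
    then show "\<exists>N. \<forall>m\<ge>N. \<forall>n\<ge>N. L2_norm \<Omega> (\<lambda>x. X m x - X n x) < e" by blast
  qed
  then obtain u where u: "u \<in> L2 \<Omega>" "(\<lambda>n. L2_norm \<Omega> (\<lambda>x. X n x - u x)) \<longlonglongrightarrow> 0" by blast
  have "\<exists>d\<in>L2 \<Omega>. (\<lambda>n. L2_norm \<Omega> (\<lambda>x. weak_pd \<Omega> i (X n) x - d x)) \<longlonglongrightarrow> 0" for i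
  proof (rule L2_complete[OF lmeasurable_domain H10_weak_pd_L2[OF X]])
    fix e :: real assume "e > 0"
    then obtain N where N: "\<And>m n. m \<ge> N \<Longrightarrow> n \<ge> N \<Longrightarrow> grad_norm \<Omega> (\<lambda>x. X m x - X n x) < e"
      using cauchy[of "e"] by auto
    have "L2_norm \<Omega> (\<lambda>x. weak_pd \<Omega> i (X m) x - weak_pd \<Omega> i (X n) x) < e" if "m \<ge> N" "n \<ge> N" for m n
      using component_le_grad_norm[of i "\<lambda>x. X m x - X n x"] N[OF that]
      by (simp add: weak_pd_diff_norm[OF H10_H1[OF X] H10_H1[OF X]])
    then show "\<exists>N. \<forall>m\<ge>N. \<forall>n\<ge>N. L2_norm \<Omega> (\<lambda>x. weak_pd \<Omega> i (X m) x - weak_pd \<Omega> i (X n) x) < e" by blast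
  qed
  then have "\<forall>i. \<exists>d. d \<in> L2 \<Omega> \<and> (\<lambda>n. L2_norm \<Omega> (\<lambda>x. weak_pd \<Omega> i (X n) x - d x)) \<longlonglongrightarrow> 0" by blast
  from choice[OF this] obtain d where d: "\<And>i. d i \<in> L2 \<Omega>"
    "\<And>i. (\<lambda>n. L2_norm \<Omega> (\<lambda>x. weak_pd \<Omega> i (X n) x - d i x)) \<longlonglongrightarrow> 0"
    by blast
  \<comment> \<open>One test function per n, close to \<open>X n\<close> together with its
    derivatives: finitely many conditions, so they hold at a common index of the approximating
    sequence.\<close>
  have "\<forall>n. \<exists>\<phi>. \<phi> \<in> test_fun \<Omega> \<and> L2_norm \<Omega> (\<lambda>x. \<phi> x - X n x) < inverse (real (Suc n)) \<and>
      (\<forall>i. L2_norm \<Omega> (\<lambda>x. pd i \<phi> x - weak_pd \<Omega> i (X n) x) < inverse (real (Suc n)))"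
  proof
    fix n
    obtain \<psi> where \<psi>: "\<And>n::nat. \<psi> n \<in> test_fun \<Omega>" "(\<lambda>k. L2_norm \<Omega> (\<lambda>x. \<psi> k x - X n x)) \<longlonglongrightarrow> 0"
      "\<And>i. (\<lambda>k. L2_norm \<Omega> (\<lambda>x. pd i (\<psi> k) x - weak_pd \<Omega> i (X n) x)) \<longlonglongrightarrow> 0"
      using H10_approximation[OF X[of n]] by blast
    have p: "0 < inverse (real (Suc n))" by simp
    have "\<forall>\<^sub>F k in sequentially. L2_norm \<Omega> (\<lambda>x. \<psi> k x - X n x) < inverse (real (Suc n))"
      using order_tendstoD(2)[OF \<psi>(2) p] .
    moreover have "\<forall>\<^sub>F k in sequentially. \<forall>i. L2_norm \<Omega> (\<lambda>x. pd i (\<psi> k) x - weak_pd \<Omega> i (X n) x) < inverse (real (Suc n))"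
      by (intro eventually_all_finite order_tendstoD(2)[OF \<psi>(3) p])
    ultimately have "\<forall>\<^sub>F k in sequentially. L2_norm \<Omega> (\<lambda>x. \<psi> k x - X n x) < inverse (real (Suc n)) \<and>
        (\<forall>i. L2_norm \<Omega> (\<lambda>x. pd i (\<psi> k) x - weak_pd \<Omega> i (X n) x) < inverse (real (Suc n)))"
      by (rule eventually_conj)
    then obtain k where "L2_norm \<Omega> (\<lambda>x. \<psi> k x - X n x) < inverse (real (Suc n)) \<and>
        (\<forall>i. L2_norm \<Omega> (\<lambda>x. pd i (\<psi> k) x - weak_pd \<Omega> i (X n) x) < inverse (real (Suc n)))"
      using eventually_happens'[OF sequentially_bot] by blast
    then show "\<exists>\<phi>. \<phi> \<in> test_fun \<Omega> \<and> L2_norm \<Omega> (\<lambda>x. \<phi> x - X n x) < inverse (real (Suc n)) \<and>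
      (\<forall>i. L2_norm \<Omega> (\<lambda>x. pd i \<phi> x - weak_pd \<Omega> i (X n) x) < inverse (real (Suc n)))"
      using \<psi>(1)[of k] by blast
  qed
  from choice[OF this] obtain \<phi> where \<phi>: "\<And>n. \<phi> n \<in> test_fun \<Omega>"
    "\<And>n. L2_norm \<Omega> (\<lambda>x. \<phi> n x - X n x) < inverse (real (Suc n))"
    "\<And>n i. L2_norm \<Omega> (\<lambda>x. pd i (\<phi> n) x - weak_pd \<Omega> i (X n) x) < inverse (real (Suc n))"
    by blast
  have limit: "(\<lambda>n. L2_norm \<Omega> (\<lambda>x. p n x - w x)) \<longlonglongrightarrow> 0"
    if "\<And>n. p n \<in> L2 \<Omega>" "\<And>n. q n \<in> L2 \<Omega>" "w \<in> L2 \<Omega>"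
      "\<And>n. L2_norm \<Omega> (\<lambda>x. p n x - q n x) < inverse (real (Suc n))"
      "(\<lambda>n. L2_norm \<Omega> (\<lambda>x. q n x - w x)) \<longlonglongrightarrow> 0" for p q :: "nat \<Rightarrow> scal" and w
  proof (rule tendsto_zero_scaled[where c=1])
    show "L2_norm \<Omega> (\<lambda>x. p n x - w x) \<le> 1 * (inverse (real (Suc n)) + L2_norm \<Omega> (\<lambda>x. q n x - w x))" for n
      using L2_triangle[OF L2.diff_mem[OF that(1,2)] L2.diff_mem[OF that(2,3)], of n n n] that(4)[of n] by simp
    show "(\<lambda>n. inverse (real (Suc n)) + L2_norm \<Omega> (\<lambda>x. q n x - w x)) \<longlonglongrightarrow> 0"
      using tendsto_add[OF LIMSEQ_inverse_real_of_nat that(5)] by simp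
  qed (rule L2_norm_nonneg)
  have t: "\<phi> n \<in> L2 \<Omega>" "pd i (\<phi> n) \<in> L2 \<Omega>" for n i
    using \<phi>(1) by (auto intro: test_fun_L2 test_fun_pd measurable_domain)
  have l1: "(\<lambda>n. L2_norm \<Omega> (\<lambda>x. \<phi> n x - u x)) \<longlonglongrightarrow> 0"
    by (rule limit[OF t(1) H10_L2[OF X] u(1) \<phi>(2) u(2)])
  have l2: "(\<lambda>n. L2_norm \<Omega> (\<lambda>x. pd i (\<phi> n) x - d i x)) \<longlonglongrightarrow> 0" for i
    by (rule limit[OF t(2) H10_weak_pd_L2[OF X] d(1) \<phi>(3) d(2)])
  note uH = H10I[OF u(1) d(1) \<phi>(1) l1 l2]
  have "L2_norm \<Omega> (weak_pd \<Omega> i (\<lambda>x. X n x - u x)) = L2_norm \<Omega> (\<lambda>x. weak_pd \<Omega> i (X n) x - d i x)" for i n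
  proof -
    have "has_weak_pd \<Omega> i (\<lambda>x. -1 * u x + X n x) (\<lambda>x. -1 * d i x + weak_pd \<Omega> i (X n) x)"
      by (intro has_weak_pd_comb uH(2) open_domain H1_has_weak_pd H10_H1 X)
    then have "has_weak_pd \<Omega> i (\<lambda>x. X n x - u x) (\<lambda>x. weak_pd \<Omega> i (X n) x - d i x)"
      by simp
    then show ?thesis by (rule weak_pd_norm_eq) (intro L2.diff_mem d(1) H10_weak_pd_L2 X)
  qed
  then have "(\<lambda>n. grad_norm \<Omega> (\<lambda>x. X n x - u x)) \<longlonglongrightarrow> sqrt (\<Sum>i\<in>(UNIV::3 set). 0\<^sup>2)"
    unfolding grad_norm_def by (simp only:) (intro tendsto_intros d(2))
  then show ?thesis using uH(1) by auto
qed

end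

section \<open>Variational solutions and weak divergences\<close>

context elliptic_coeff
begin

text \<open>The Dirichlet form itself is the inner product. Ellipticity and boundedness make it
  equivalent to the squared gradient norm, so completeness carries over; Poincare's inequality makes
  the right-hand side a bounded functional.\<close>

theorem dirichlet_problem_solvable:
  assumes h: "h \<in> L2 \<Omega>"
  shows "\<exists>u. u \<in> H10 \<Omega> \<and> (\<forall>\<phi>\<in>H10 \<Omega>. dirichlet_form \<Omega> b u \<phi> = L2_inner \<Omega> h \<phi>)"
proof -
  obtain C where C: "C > 0" "\<And>u. u \<in> H10 \<Omega> \<Longrightarrow> L2_norm \<Omega> u \<le> C * grad_norm \<Omega> u"
    using poincare by blast
  have "\<exists>u\<in>H10 \<Omega>. \<forall>v\<in>H10 \<Omega>. dirichlet_form \<Omega> b u v = L2_inner \<Omega> h v"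
  proof (rule form.riesz_representation[where C="L2_norm \<Omega> h * C / sqrt lam"])
    fix X :: "nat \<Rightarrow> scal" assume X: "\<And>n. X n \<in> H10 \<Omega>"
      and ca: "\<And>e. e > 0 \<Longrightarrow> \<exists>N. \<forall>m\<ge>N. \<forall>n\<ge>N. dirichlet_form \<Omega> b (\<lambda>x. X m x - X n x) (\<lambda>x. X m x - X n x) < e"
    have "\<exists>u\<in>H10 \<Omega>. (\<lambda>n. grad_norm \<Omega> (\<lambda>x. X n x - u x)) \<longlonglongrightarrow> 0"
    proof (rule H10_complete[OF X])
      fix e :: real assume "e > 0"
      then obtain N where N: "\<And>m n. m \<ge> N \<Longrightarrow> n \<ge> N \<Longrightarrow> dirichlet_form \<Omega> b (\<lambda>x. X m x - X n x) (\<lambda>x. X m x - X n x) < lam * e\<^sup>2"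
        using ca[of "lam * e\<^sup>2"] lam_pos by auto
      have "grad_norm \<Omega> (\<lambda>x. X m x - X n x) < e" if "m \<ge> N" "n \<ge> N" for m n
      proof -
        have "lam * (grad_norm \<Omega> (\<lambda>x. X m x - X n x))\<^sup>2 < lam * e\<^sup>2"
          using dirichlet_form_coercive[OF H10_H1[OF H10_diff[OF X X]], of m n] N[OF that] by linarith
        then show ?thesis
          using lam_pos \<open>e > 0\<close> by (simp add: power_less_imp_less_base)
      qed
      then show "\<exists>N. \<forall>m\<ge>N. \<forall>n\<ge>N. grad_norm \<Omega> (\<lambda>x. X m x - X n x) < e" by blast
    qed
    then obtain u where u: "u \<in> H10 \<Omega>" "(\<lambda>n. grad_norm \<Omega> (\<lambda>x. X n x - u x)) \<longlonglongrightarrow> 0" by blast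
    have "(\<lambda>n. dirichlet_form \<Omega> b (\<lambda>x. X n x - u x) (\<lambda>x. X n x - u x)) \<longlonglongrightarrow> 0"
    proof (rule tendsto_zero_scaled[where c="9 * Lam"])
      show "0 \<le> dirichlet_form \<Omega> b (\<lambda>x. X n x - u x) (\<lambda>x. X n x - u x)" for n
        by (intro form.nonneg H10_diff X u)
      show "dirichlet_form \<Omega> b (\<lambda>x. X n x - u x) (\<lambda>x. X n x - u x) \<le> 9 * Lam * (grad_norm \<Omega> (\<lambda>x. X n x - u x))\<^sup>2" for n
        using dirichlet_form_bound[OF H10_H1 H10_H1, OF H10_diff[OF X u(1)] H10_diff[OF X u(1)], of n n]
        by (simp add: power2_eq_square mult.assoc)
      show "(\<lambda>n. (grad_norm \<Omega> (\<lambda>x. X n x - u x))\<^sup>2) \<longlonglongrightarrow> 0"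
        using tendsto_power[OF u(2), of 2] by simp
    qed
    then show "\<exists>u\<in>H10 \<Omega>. (\<lambda>n. dirichlet_form \<Omega> b (\<lambda>x. X n x - u x) (\<lambda>x. X n x - u x)) \<longlonglongrightarrow> 0"
      using u(1) by blast
  next
    fix u v c assume "u \<in> H10 \<Omega>" "v \<in> H10 \<Omega>"
    then show "L2_inner \<Omega> h (\<lambda>x. c * u x + v x) = c * L2_inner \<Omega> h u + L2_inner \<Omega> h v"
      by (intro L2.comb_right H10_L2 h)
  next
    fix v assume v: "v \<in> H10 \<Omega>"
    have "\<bar>L2_inner \<Omega> h v\<bar> \<le> L2_norm \<Omega> h * L2_norm \<Omega> v"
      by (intro L2_cauchy_schwarz h H10_L2 v)
    also have "\<dots> \<le> L2_norm \<Omega> h * (C * (sqrt (dirichlet_form \<Omega> b v v) / sqrt lam))"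
      using C v grad_norm_le_form[OF v]
      by (intro mult_left_mono[OF order_trans[OF C(2)[OF v] mult_left_mono]]) (auto simp: L2_norm_nonneg)
    finally show "\<bar>L2_inner \<Omega> h v\<bar> \<le> L2_norm \<Omega> h * C / sqrt lam * sqrt (dirichlet_form \<Omega> b v v)"
      by simp
  qed
  then show ?thesis by blast
qed

lemma dirichlet_inv_works:
  assumes "h \<in> L2 \<Omega>"
  shows "dirichlet_inv \<Omega> b h \<in> H10 \<Omega>"
    "\<And>\<phi>. \<phi> \<in> H10 \<Omega> \<Longrightarrow> dirichlet_form \<Omega> b (dirichlet_inv \<Omega> b h) \<phi> = L2_inner \<Omega> h \<phi>"
  using someI_ex[OF dirichlet_problem_solvable[OF assms]] unfolding dirichlet_inv_def by blast+

text \<open>A weak divergence is tested with smooth functions of compact support only. Density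
  extends the identity to H10, so that solutions and their differences can be inserted.\<close>

lemma weak_div_dirichlet_form:
  assumes u: "u \<in> H1 \<Omega>" and d: "has_weak_div \<Omega> (flux \<Omega> b u) d" "d \<in> L2 \<Omega>" and \<phi>: "\<phi> \<in> H10 \<Omega>"
  shows "dirichlet_form \<Omega> b u \<phi> = - L2_inner \<Omega> d \<phi>"
proof -
  obtain \<psi> where \<psi>: "\<And>n::nat. \<psi> n \<in> test_fun \<Omega>" "(\<lambda>n. L2_norm \<Omega> (\<lambda>x. \<psi> n x - \<phi> x)) \<longlonglongrightarrow> 0"
    "\<And>i. (\<lambda>n. L2_norm \<Omega> (\<lambda>x. pd i (\<psi> n) x - weak_pd \<Omega> i \<phi> x)) \<longlonglongrightarrow> 0"
    using H10_approximation[OF \<phi>] by blast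
  have t: "\<psi> n \<in> L2 \<Omega>" "pd i (\<psi> n) \<in> L2 \<Omega>" for n i
    using \<psi>(1) by (auto intro: test_fun_L2 test_fun_pd measurable_domain)
  have "(\<lambda>n. \<Sum>i\<in>UNIV. L2_inner \<Omega> (pd i (\<psi> n)) (\<lambda>x. flux \<Omega> b u x $ i)) \<longlonglongrightarrow>
      (\<Sum>i\<in>UNIV. L2_inner \<Omega> (weak_pd \<Omega> i \<phi>) (\<lambda>x. flux \<Omega> b u x $ i))"
    by (intro tendsto_sum tendsto_L2_inner[OF t(2) H10_weak_pd_L2[OF \<phi>] flux_L2[OF u] \<psi>(3)])
  moreover have "(\<lambda>n. - L2_inner \<Omega> (\<psi> n) d) \<longlonglongrightarrow> - L2_inner \<Omega> \<phi> d"
    by (intro tendsto_minus tendsto_L2_inner[OF t(1) H10_L2[OF \<phi>] d(2) \<psi>(2)])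
  moreover have "(\<Sum>i\<in>UNIV. L2_inner \<Omega> (pd i (\<psi> n)) (\<lambda>x. flux \<Omega> b u x $ i)) = - L2_inner \<Omega> (\<psi> n) d" for n
    using d(1) \<psi>(1)[of n] unfolding has_weak_div_def L2_inner_def by (simp add: mult.commute)
  ultimately have "(\<Sum>i\<in>UNIV. L2_inner \<Omega> (weak_pd \<Omega> i \<phi>) (\<lambda>x. flux \<Omega> b u x $ i)) = - L2_inner \<Omega> \<phi> d"
    using LIMSEQ_unique by simp
  then show ?thesis
    unfolding dirichlet_form_eq[OF u H10_H1[OF \<phi>]] unfolding L2_inner_def by (simp add: mult.commute)
qed

text \<open>The Hoelder hypothesis is phrased with weak divergences, so a variational solution has
  to be translated back before the hypothesis applies to the corrector.\<close>

lemma dirichlet_form_weak_div: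
  assumes u: "u \<in> H1 \<Omega>" and h: "h \<in> L2 \<Omega>" and eq: "\<And>\<phi>. \<phi> \<in> H10 \<Omega> \<Longrightarrow> dirichlet_form \<Omega> b u \<phi> = L2_inner \<Omega> h \<phi>"
  shows "has_weak_div \<Omega> (flux \<Omega> b u) (\<lambda>x. - h x)"
  unfolding has_weak_div_def
proof (intro conjI allI ballI)
  have h': "(\<lambda>x. - h x) \<in> L2 \<Omega>" using L2.scale_mem[OF h, of "-1"] by simp
  show "(\<lambda>x. flux \<Omega> b u x $ i) \<in> L1_loc \<Omega>" for i
    by (intro L2_imp_L1_loc flux_L2 u measurable_domain)
  show "(\<lambda>x. - h x) \<in> L1_loc \<Omega>" by (intro L2_imp_L1_loc h' measurable_domain)
  fix \<phi> assume \<phi>: "\<phi> \<in> test_fun \<Omega>"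
  have "L2_inner \<Omega> (\<lambda>x. flux \<Omega> b u x $ i) (pd i \<phi>) = L2_inner \<Omega> (\<lambda>x. flux \<Omega> b u x $ i) (weak_pd \<Omega> i \<phi>)" for i
  proof (rule L2_inner_cong_AE)
    show "AE x in lebesgue_on \<Omega>. pd i \<phi> x = weak_pd \<Omega> i \<phi> x"
      using weak_pd_AE[OF has_weak_pd_smooth[OF test_fun_smooth[OF \<phi>] open_domain, of i] open_domain]
      by eventually_elim simp
  qed (auto intro!: L2_measurable flux_L2 u test_fun_L2 test_fun_pd \<phi> measurable_domain weak_pd_L2 test_fun_H1)
  then have "(\<Sum>i\<in>UNIV. L2_inner \<Omega> (\<lambda>x. flux \<Omega> b u x $ i) (pd i \<phi>)) = dirichlet_form \<Omega> b u \<phi>"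
    by (simp add: dirichlet_form_eq[OF u test_fun_H1[OF \<phi>]])
  also have "\<dots> = L2_inner \<Omega> h \<phi>" by (intro eq test_fun_H10 \<phi>)
  finally show "(\<Sum>i\<in>UNIV. L2_inner \<Omega> (\<lambda>x. flux \<Omega> b u x $ i) (pd i \<phi>)) = - L2_inner \<Omega> (\<lambda>x. - h x) \<phi>"
    by (simp add: L2_inner_def)
qed

text \<open>Two solutions may differ on a null set, so uniqueness takes the form of a vanishing
  norm: coercivity kills the gradient of the difference and Poincare's inequality the difference
  itself.\<close>

lemma dirichlet_solution_unique:
  assumes "u \<in> H10 \<Omega>" "v \<in> H10 \<Omega>" "\<And>\<phi>. \<phi> \<in> H10 \<Omega> \<Longrightarrow> dirichlet_form \<Omega> b u \<phi> = dirichlet_form \<Omega> b v \<phi>"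
  shows "L2_norm \<Omega> (\<lambda>x. u x - v x) = 0"
proof -
  obtain C where C: "C > 0" "\<And>u. u \<in> H10 \<Omega> \<Longrightarrow> L2_norm \<Omega> u \<le> C * grad_norm \<Omega> u"
    using poincare by blast
  have d: "(\<lambda>x. u x - v x) \<in> H10 \<Omega>" by (intro H10_diff assms)
  have "dirichlet_form \<Omega> b (\<lambda>x. u x - v x) (\<lambda>x. u x - v x) = 0"
    using assms(3)[OF d] form.diff_left[OF assms(1,2) d] by simp
  then have "grad_norm \<Omega> (\<lambda>x. u x - v x) \<le> 0" using grad_norm_le_form[OF d] by simp
  then have "C * grad_norm \<Omega> (\<lambda>x. u x - v x) \<le> 0" using C(1) by (simp add: mult_le_0_iff)
  then show ?thesis
    using C(2)[OF d] L2_norm_nonneg[of \<Omega> "\<lambda>x. u x - v x"] by linarith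
qed

end

subsection \<open>Interior balls of a smooth domain\<close>

lemma frechet_derivative_expansion:
  assumes "f differentiable (at (p::pt))"
  shows "frechet_derivative f (at p) v = (\<Sum>j\<in>UNIV. v $ j * pd j f p)"
proof -
  have lin: "linear (frechet_derivative f (at p))"
    using assms by (simp add: linear_frechet_derivative)
  have "v = (\<Sum>j\<in>UNIV. v $ j *\<^sub>R axis j 1)"
    by (simp add: vec_eq_iff axis_def if_distrib cong: if_cong)
  then have "frechet_derivative f (at p) v = frechet_derivative f (at p) (\<Sum>j\<in>UNIV. v $ j *\<^sub>R axis j 1)"
    by simp
  also have "\<dots> = (\<Sum>j\<in>UNIV. v $ j * pd j f p)"
    using lin by (simp add: linear_sum linear_scale pd_def)
  finally show ?thesis .
qed

text \<open>Moving from \<open>x\<close> by r/2 along the i-th axis, against the sign of the partial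
  derivative, contributes at most -\<kappa>r/4 to the change of \<rho>, and a further displacement
  shorter than c r contributes at most \<kappa>r/8. The points \<open>x\<close> range over the
  closure near \<open>z\<close>, not only over the boundary.\<close>

lemma boundary_interior_balls:
  assumes z: "smooth \<rho>" "0 < r1" "pd i \<rho> z \<noteq> 0" "\<Omega> \<inter> ball z r1 = {x \<in> ball z r1. \<rho> x < 0}"
  shows "\<exists>c s. 0 < c \<and> 0 < s \<and> (\<forall>x\<in>closure \<Omega> \<inter> ball z s. \<forall>r. 0 < r \<and> r \<le> s \<longrightarrow>
    (\<exists>y. ball y (c * r) \<subseteq> \<Omega> \<inter> ball x r))"
proof -
  define \<kappa> where "\<kappa> = \<bar>pd i \<rho> z\<bar>"
  define \<sigma> where "\<sigma> = - sgn (pd i \<rho> z)"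
  \<comment> \<open>\<open>L\<close> bounds the sum of the absolute partial derivatives near
    \<open>z\<close>; the 1 in each term allows for their oscillation.\<close>
  define L where "L = (\<Sum>j\<in>UNIV. \<bar>pd j \<rho> z\<bar> + 1)"
  \<comment> \<open>The bound 1/2 keeps the small ball inside \<open>ball x r\<close>, the other one
    keeps its effect on \<rho> below \<kappa>r/8.\<close>
  define c where "c = min (1/2) (\<kappa> / (8 * L))"
  have \<kappa>: "\<kappa> > 0" using z(3) by (simp add: \<kappa>_def)
  have L: "L > 0" unfolding L_def by (intro sum_pos) (auto intro: add_nonneg_pos)
  have c: "c > 0" "c \<le> 1/2" "c * L \<le> \<kappa> / 8"
    using \<kappa> L by (auto simp: c_def min_def field_simps)
  have diff: "\<rho> differentiable (at x)" for x using z(1) by (rule smooth_imp_differentiable)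
  have cont: "isCont \<rho> x" "isCont (pd j \<rho>) x" for x j
    using continuous_on_smooth[OF z(1), of UNIV] continuous_on_smooth[OF smooth_pd[OF z(1)], of UNIV]
    by (auto simp: continuous_on_eq_continuous_at)
  have "\<forall>\<^sub>F p in nhds z. \<forall>j. \<bar>pd j \<rho> p - pd j \<rho> z\<bar> < min 1 (\<kappa> / 2)"
  proof (intro eventually_all_finite)
    fix j
    have "((\<lambda>p. pd j \<rho> p) \<longlongrightarrow> pd j \<rho> z) (nhds z)"
      using cont(2)[of z j] by (simp add: continuous_within tendsto_at_iff_tendsto_nhds)
    from tendstoD[OF this, of "min 1 (\<kappa> / 2)"] \<kappa>
    show "\<forall>\<^sub>F p in nhds z. \<bar>pd j \<rho> p - pd j \<rho> z\<bar> < min 1 (\<kappa> / 2)" by (simp add: dist_real_def)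
  qed
  then obtain s0 where s0: "s0 > 0" "\<And>p j. dist p z < s0 \<Longrightarrow> \<bar>pd j \<rho> p - pd j \<rho> z\<bar> < min 1 (\<kappa> / 2)"
    unfolding eventually_nhds_metric by blast
  define s where "s = min s0 r1 / 2"
  have s: "s > 0" "2 * s \<le> s0" "2 * s \<le> r1" using s0(1) z(2) by (auto simp: s_def)
  \<comment> \<open>The defining function is negative at nearby points of the domain only;
    continuity leaves the weak inequality on the closure.\<close>
  have neg: "\<rho> x \<le> 0" if x: "x \<in> closure \<Omega>" "x \<in> ball z r1" for x
  proof (rule ccontr)
    assume "\<not> \<rho> x \<le> 0"
    then have "\<forall>\<^sub>F p in nhds x. \<rho> p > 0"
      using cont(1)[of x] by (intro order_tendstoD(1)) (auto simp: continuous_within tendsto_at_iff_tendsto_nhds)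
    moreover have "\<forall>\<^sub>F p in nhds x. p \<in> ball z r1"
      using x(2) by (intro eventually_nhds_in_open) auto
    ultimately have "\<forall>\<^sub>F p in nhds x. \<rho> p > 0 \<and> p \<in> ball z r1" by (rule eventually_conj)
    then obtain e where e: "e > 0" "\<And>p. dist p x < e \<Longrightarrow> \<rho> p > 0 \<and> p \<in> ball z r1"
      unfolding eventually_nhds_metric by blast
    obtain p where p: "p \<in> \<Omega>" "dist p x < e"
      using x(1) e(1) unfolding closure_approachable by blast
    then have "p \<in> \<Omega> \<inter> ball z r1" using e(2) by auto
    then show False using z(4) e(2)[OF p(2)] by auto
  qed
  have main: "\<exists>y. ball y (c * r) \<subseteq> \<Omega> \<inter> ball x r" if x: "x \<in> closure \<Omega>" "x \<in> ball z s" and r: "0 < r" "r \<le> s" for x r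
  proof (intro exI subsetI)
    fix q assume q: "q \<in> ball (x + (r / 2 * \<sigma>) *\<^sub>R axis i 1) (c * r)"
    define w where "w = q - (x + (r / 2 * \<sigma>) *\<^sub>R axis i 1)"
    have w: "norm w < c * r" using q by (simp add: w_def dist_norm norm_minus_commute)
    have \<sigma>: "\<bar>\<sigma>\<bar> = 1" using z(3) by (simp add: \<sigma>_def sgn_if)
    have qx: "q - x = (r / 2 * \<sigma>) *\<^sub>R axis i 1 + w" by (simp add: w_def)
    have "norm (q - x) \<le> r / 2 + norm w"
      unfolding qx using r(1) \<sigma> by (intro order_trans[OF norm_triangle_ineq]) (simp add: abs_mult)
    also have "\<dots> < r / 2 + 1 / 2 * r"
      using w c(2) r(1) mult_right_mono[of c "1/2" r] by linarith
    finally have qr: "dist q x < r" by (simp add: dist_norm)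
    have near: "dist (x + t *\<^sub>R (q - x)) z < 2 * s" if "0 \<le> t" "t \<le> 1" for t
    proof -
      have "dist (x + t *\<^sub>R (q - x)) x = t * dist q x" using that by (simp add: dist_norm)
      also have "\<dots> < s" using that qr r(2) mult_left_le_one_le[of "dist q x" t] by simp
      finally show ?thesis using x(2) dist_triangle[of "x + t *\<^sub>R (q - x)" z x] by (simp add: dist_commute)
    qed
    have der: "((\<lambda>t. \<rho> (x + t *\<^sub>R (q - x))) has_derivative
        (\<lambda>h. frechet_derivative \<rho> (at (x + t *\<^sub>R (q - x))) (h *\<^sub>R (q - x)))) (at t within {0..1})" for t :: real
    proof (rule has_derivative_compose[where f="\<lambda>t. x + t *\<^sub>R (q - x)"])
      show "((\<lambda>t. x + t *\<^sub>R (q - x)) has_derivative (\<lambda>h. h *\<^sub>R (q - x))) (at t within {0..1})"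
        by (auto intro!: derivative_eq_intros)
      show "(\<rho> has_derivative frechet_derivative \<rho> (at (x + t *\<^sub>R (q - x)))) (at (x + t *\<^sub>R (q - x)))"
        using diff frechet_derivative_works by blast
    qed
    obtain t where t: "t \<in> {0..1}" "\<rho> (x + 1 *\<^sub>R (q - x)) - \<rho> (x + 0 *\<^sub>R (q - x)) =
        frechet_derivative \<rho> (at (x + t *\<^sub>R (q - x))) ((1 - 0) *\<^sub>R (q - x))"
      using mvt_very_simple[of 0 1 "\<lambda>t. \<rho> (x + t *\<^sub>R (q - x))", OF _ der] by auto
    define p where "p = x + t *\<^sub>R (q - x)"
    have p: "\<And>j. \<bar>pd j \<rho> p - pd j \<rho> z\<bar> < min 1 (\<kappa> / 2)"
      using near[of t] t(1) s(2) by (intro s0(2)) (auto simp: p_def)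
    have "\<rho> q - \<rho> x = frechet_derivative \<rho> (at p) (q - x)" using t(2) by (simp add: p_def)
    also have "\<dots> = frechet_derivative \<rho> (at p) ((r / 2 * \<sigma>) *\<^sub>R axis i 1) + frechet_derivative \<rho> (at p) w"
      unfolding qx using linear_frechet_derivative[OF diff] by (rule linear_add)
    also have "frechet_derivative \<rho> (at p) ((r / 2 * \<sigma>) *\<^sub>R axis i 1) = r / 2 * \<sigma> * pd i \<rho> p"
      using linear_frechet_derivative[OF diff, of p] by (simp add: linear_scale pd_def)
    \<comment> \<open>At the intermediate point of the mean value theorem the i-th derivative keeps
      at least half of its size at \<open>z\<close>.\<close>
    also have "\<sigma> * pd i \<rho> p \<le> - \<kappa> / 2"
    proof -
      have "\<sigma> * pd i \<rho> z = - \<kappa>" by (simp add: \<sigma>_def \<kappa>_def sgn_if abs_if)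
      moreover have "\<bar>\<sigma> * (pd i \<rho> p - pd i \<rho> z)\<bar> < \<kappa> / 2" using p[of i] \<sigma> by (simp add: abs_mult)
      ultimately show ?thesis unfolding right_diff_distrib by linarith
    qed
    then have "r / 2 * \<sigma> * pd i \<rho> p \<le> r / 2 * (- \<kappa> / 2)"
      using r(1) unfolding mult.assoc by (intro mult_left_mono) auto
    also have "frechet_derivative \<rho> (at p) w \<le> L * norm w"
    proof -
      have "frechet_derivative \<rho> (at p) w \<le> (\<Sum>j\<in>UNIV. \<bar>w $ j * pd j \<rho> p\<bar>)"
        unfolding frechet_derivative_expansion[OF diff] by (rule sum_mono) simp
      also have "\<dots> \<le> (\<Sum>j\<in>UNIV. norm w * (\<bar>pd j \<rho> z\<bar> + 1))"
      proof (rule sum_mono)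
        fix j
        have "\<bar>pd j \<rho> p\<bar> \<le> \<bar>pd j \<rho> z\<bar> + 1" using p[of j] by linarith
        then show "\<bar>w $ j * pd j \<rho> p\<bar> \<le> norm w * (\<bar>pd j \<rho> z\<bar> + 1)"
          unfolding abs_mult using component_le_norm_cart by (intro mult_mono) auto
      qed
      finally show ?thesis by (simp add: L_def sum_distrib_left mult.commute)
    qed
    finally have "\<rho> q - \<rho> x \<le> r / 2 * (- \<kappa> / 2) + L * norm w" by simp
    also have "L * norm w \<le> L * (c * r)" using w L by (intro mult_left_mono) auto
    also have "L * (c * r) \<le> \<kappa> / 8 * r" using c(3) r(1) mult_right_mono[of "c * L" "\<kappa> / 8" r] by (simp add: ac_simps)
    finally have "\<rho> q - \<rho> x \<le> - (\<kappa> * r) / 8" by (simp add: field_simps)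
    moreover have "\<kappa> * r > 0" using \<kappa> r(1) by simp
    moreover have "\<rho> x \<le> 0" using x s by (intro neg) auto
    ultimately have "\<rho> q < 0" by linarith
    moreover have "q \<in> ball z r1" using near[of 1] s(3) by (auto simp: dist_commute)
    ultimately have "q \<in> \<Omega>" using z(4) by blast
    then show "q \<in> \<Omega> \<inter> ball x r" using qr by (simp add: dist_commute)
  qed
  show ?thesis using main c(1) s(1) by blast
qed

text \<open>An interior corkscrew condition, made uniform by compactness of the closure. Near
  \<open>z\<close> only radii up to \<open>s z\<close> are available, so a radius r \<le> 1 is first
  shrunk by \<open>min (s z) 1\<close>, and the loss goes into the constant.\<close>

theorem interior_balls:
  assumes "smooth_bounded_domain \<Omega>"
  obtains c where "c > 0"
    "\<And>x r. x \<in> closure \<Omega> \<Longrightarrow> 0 < r \<Longrightarrow> r \<le> 1 \<Longrightarrow> \<exists>y. ball y (c * r) \<subseteq> \<Omega> \<inter> ball x r"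
proof -
  have \<Omega>: "open \<Omega>" "bounded \<Omega>" using assms by (auto simp: smooth_bounded_domain_def)
  have "\<exists>c s. 0 < c \<and> 0 < s \<and> (\<forall>x\<in>closure \<Omega> \<inter> ball z s. \<forall>r. 0 < r \<and> r \<le> s \<longrightarrow>
    (\<exists>y. ball y (c * r) \<subseteq> \<Omega> \<inter> ball x r))" if z: "z \<in> closure \<Omega>" for z
  proof (cases "z \<in> \<Omega>")
    case True
    then obtain s where s: "s > 0" "ball z s \<subseteq> \<Omega>" using \<Omega>(1) by (meson openE)
    have "ball x (1 * r) \<subseteq> \<Omega> \<inter> ball x r" if "x \<in> ball z (s / 2)" "r \<le> s / 2" for x r
    proof -
      have "ball x r \<subseteq> ball z s"
      proof
        fix p assume "p \<in> ball x r"
        then show "p \<in> ball z s" using that dist_triangle[of z p x] by simp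
      qed
      then show ?thesis using s(2) by auto
    qed
    then have "\<forall>x\<in>closure \<Omega> \<inter> ball z (s / 2). \<forall>r. 0 < r \<and> r \<le> s / 2 \<longrightarrow>
        (\<exists>y. ball y (1 * r) \<subseteq> \<Omega> \<inter> ball x r)" by blast
    moreover have "(0::real) < 1" "0 < s / 2" using s(1) by auto
    ultimately show ?thesis by blast
  next
    case False
    then have "z \<in> frontier \<Omega>" using z \<Omega>(1) by (simp add: frontier_def interior_open)
    then obtain \<rho> r i where "smooth \<rho>" "0 < r" "pd i \<rho> z \<noteq> 0" "\<Omega> \<inter> ball z r = {x \<in> ball z r. \<rho> x < 0}"
      using assms unfolding smooth_bounded_domain_def by blast
    then show ?thesis by (rule boundary_interior_balls)
  qed
  then have "\<forall>z. \<exists>c s. z \<in> closure \<Omega> \<longrightarrow> 0 < c \<and> 0 < s \<and> (\<forall>x\<in>closure \<Omega> \<inter> ball z s. \<forall>r. 0 < r \<and> r \<le> s \<longrightarrow>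
    (\<exists>y. ball y (c * r) \<subseteq> \<Omega> \<inter> ball x r))" by blast
  then obtain c s where cs: "\<And>z. z \<in> closure \<Omega> \<Longrightarrow> 0 < c z" "\<And>z. z \<in> closure \<Omega> \<Longrightarrow> 0 < s z"
    "\<And>z x r. z \<in> closure \<Omega> \<Longrightarrow> x \<in> closure \<Omega> \<inter> ball z (s z) \<Longrightarrow> 0 < r \<Longrightarrow> r \<le> s z \<Longrightarrow>
       \<exists>y. ball y (c z * r) \<subseteq> \<Omega> \<inter> ball x r"
    by metis
  have "compact (closure \<Omega>)" using \<Omega>(2) by (simp add: compact_closure)
  then obtain T where T: "T \<subseteq> closure \<Omega>" "finite T" "closure \<Omega> \<subseteq> (\<Union>z\<in>T. ball z (s z))"
    by (rule compactE_image[where C="closure \<Omega>" and f="\<lambda>z. ball z (s z)"]) (use cs(2) in \<open>auto intro: UN_I\<close>)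
  \<comment> \<open>Inserting 1 makes the finite set nonempty whatever \<open>T\<close> is.\<close>
  define d where "d = Min (insert 1 ((\<lambda>z. min (c z) 1 * min (s z) 1) ` T))"
  have d: "d > 0" "\<And>z. z \<in> T \<Longrightarrow> d \<le> min (c z) 1 * min (s z) 1"
    using T cs(1,2) unfolding d_def by (auto simp: subset_iff)
  have "\<exists>y. ball y (d * r) \<subseteq> \<Omega> \<inter> ball x r" if x: "x \<in> closure \<Omega>" and r: "0 < r" "r \<le> 1" for x r
  proof -
    obtain z where z: "z \<in> T" "x \<in> ball z (s z)" using T(3) x by blast
    define q where "q = min (s z) 1 * r"
    have zc: "z \<in> closure \<Omega>" using z T by blast
    have q: "0 < q" "q \<le> s z" "q \<le> r"
      using cs(2)[OF zc] r mult_left_le[of r "min (s z) 1"] mult_left_le_one_le[of r "min (s z) 1"]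
      by (auto simp: q_def)
    obtain y where y: "ball y (c z * q) \<subseteq> \<Omega> \<inter> ball x q"
      using cs(3)[OF zc _ q(1,2), of x] x z(2) by blast
    have "d * r \<le> min (c z) 1 * min (s z) 1 * r" using d(2)[OF z(1)] r by (intro mult_right_mono) auto
    also have "\<dots> \<le> c z * q" unfolding q_def mult.assoc using cs(1)[OF zc] cs(2)[OF zc] r
      by (intro mult_right_mono) auto
    finally have "ball y (d * r) \<subseteq> ball y (c z * q)" by (rule subset_ball)
    also note y
    also have "\<Omega> \<inter> ball x q \<subseteq> \<Omega> \<inter> ball x r" using q(3) by auto
    finally show ?thesis by blast
  qed
  with d(1) show ?thesis by (rule that)
qed

subsection \<open>Hoelder interpolation\<close>

text \<open>A real-valued substitute for the norm: one representative, with maximum and Hoelder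
  quotient both bounded by \<open>K\<close>. It avoids infima and suprema of extended reals. For
  \<beta> = 0 the second clause bounds the oscillation by \<open>K\<close>.\<close>

definition Holder_bound :: "pt set \<Rightarrow> real \<Rightarrow> real \<Rightarrow> scal \<Rightarrow> bool" where
  "Holder_bound \<Omega> \<beta> K u \<longleftrightarrow> (\<exists>v. continuous_on (closure \<Omega>) v \<and> (AE x in lebesgue_on \<Omega>. v x = u x) \<and>
     (\<forall>x\<in>closure \<Omega>. \<bar>v x\<bar> \<le> K) \<and>
     (\<forall>x\<in>closure \<Omega>. \<forall>y\<in>closure \<Omega>. \<bar>v x - v y\<bar> \<le> K * dist x y powr \<beta>))"

text \<open>The norm is an infimum over representatives; the margin 1 selects one that is good for
  both terms.\<close>

lemma Holder_enorm_imp_bound: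
  assumes "Holder_enorm \<Omega> \<alpha> u \<le> ennreal K" "0 \<le> K" "0 < \<alpha>"
  shows "Holder_bound \<Omega> \<alpha> (K + 1) u"
proof -
  let ?A = "\<lambda>v. SUP x\<in>closure \<Omega>. ennreal \<bar>v x\<bar>"
  let ?B = "\<lambda>v. SUP (x, y)\<in>{(x, y). x \<in> closure \<Omega> \<and> y \<in> closure \<Omega> \<and> x \<noteq> y}. ennreal (\<bar>v x - v y\<bar> / dist x y powr \<alpha>)"
  have "Holder_enorm \<Omega> \<alpha> u < ennreal (K + 1)"
    by (rule order.strict_trans1[OF assms(1) ennreal_lessI]) (use assms(2) in auto)
  then obtain v where v: "continuous_on (closure \<Omega>) v" "AE x in lebesgue_on \<Omega>. v x = u x" "?A v + ?B v < ennreal (K + 1)"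
    using assms(3) unfolding Holder_enorm_def INF_less_iff by auto
  have A: "?A v \<le> ennreal (K + 1)" "?B v \<le> ennreal (K + 1)"
    using v(3) by (auto intro: order.trans[OF _ less_imp_le[OF v(3)]])
  have "\<bar>v x\<bar> \<le> K + 1" if "x \<in> closure \<Omega>" for x
  proof -
    have "ennreal \<bar>v x\<bar> \<le> ennreal (K + 1)" using order.trans[OF SUP_upper[OF that] A(1)] .
    then show ?thesis by (subst (asm) ennreal_le_iff) (use assms(2) in auto)
  qed
  moreover have "\<bar>v x - v y\<bar> \<le> (K + 1) * dist x y powr \<alpha>" if "x \<in> closure \<Omega>" "y \<in> closure \<Omega>" for x y
  proof (cases "x = y")
    case False
    have "(x, y) \<in> {(x, y). x \<in> closure \<Omega> \<and> y \<in> closure \<Omega> \<and> x \<noteq> y}" using that False by simp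
    from order.trans[OF SUP_upper[OF this] A(2)]
    have "ennreal (\<bar>v x - v y\<bar> / dist x y powr \<alpha>) \<le> ennreal (K + 1)" by simp
    then have "\<bar>v x - v y\<bar> / dist x y powr \<alpha> \<le> K + 1"
      by (subst (asm) ennreal_le_iff) (use assms(2) in auto)
    then show ?thesis using False by (simp add: divide_le_eq)
  qed simp
  ultimately show ?thesis using v(1,2) unfolding Holder_bound_def by blast
qed

lemma Holder_bound_imp_enorm:
  assumes "Holder_bound \<Omega> \<beta> K u" "0 \<le> K"
  shows "Holder_enorm \<Omega> \<beta> u \<le> ennreal (2 * K)"
proof -
  obtain v where v: "continuous_on (closure \<Omega>) v" "AE x in lebesgue_on \<Omega>. v x = u x"
    "\<And>x. x \<in> closure \<Omega> \<Longrightarrow> \<bar>v x\<bar> \<le> K"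
    "\<And>x y. x \<in> closure \<Omega> \<Longrightarrow> y \<in> closure \<Omega> \<Longrightarrow> \<bar>v x - v y\<bar> \<le> K * dist x y powr \<beta>"
    using assms(1) unfolding Holder_bound_def by blast
  have "Holder_enorm \<Omega> \<beta> u \<le> (SUP x\<in>closure \<Omega>. ennreal \<bar>v x\<bar>) +
        (if \<beta> = 0 then 0 else SUP (x, y)\<in>{(x, y). x \<in> closure \<Omega> \<and> y \<in> closure \<Omega> \<and> x \<noteq> y}.
                ennreal (\<bar>v x - v y\<bar> / dist x y powr \<beta>))"
    unfolding Holder_enorm_def by (rule INF_lower) (use v in simp)
  also have "\<dots> \<le> ennreal K + ennreal K"
  proof (rule add_mono)
    show "(SUP x\<in>closure \<Omega>. ennreal \<bar>v x\<bar>) \<le> ennreal K"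
      by (rule SUP_least) (use v(3) in \<open>auto intro: ennreal_leI\<close>)
    have "(SUP (x, y)\<in>{(x, y). x \<in> closure \<Omega> \<and> y \<in> closure \<Omega> \<and> x \<noteq> y}.
                ennreal (\<bar>v x - v y\<bar> / dist x y powr \<beta>)) \<le> ennreal K"
    proof (rule SUP_least, clarify)
      fix x y assume "x \<in> closure \<Omega>" "y \<in> closure \<Omega>" "x \<noteq> y"
      then show "ennreal (\<bar>v x - v y\<bar> / dist x y powr \<beta>) \<le> ennreal K"
        using v(4)[of x y] by (intro ennreal_leI) (simp add: divide_le_eq)
    qed
    then show "(if \<beta> = 0 then 0 else SUP (x, y)\<in>{(x, y). x \<in> closure \<Omega> \<and> y \<in> closure \<Omega> \<and> x \<noteq> y}.
                ennreal (\<bar>v x - v y\<bar> / dist x y powr \<beta>)) \<le> ennreal K" by simp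
  qed
  also have "\<dots> = ennreal (2 * K)" using assms(2) by (simp flip: ennreal_plus)
  finally show ?thesis .
qed

lemma Holder_bound_add:
  assumes "Holder_bound \<Omega> \<beta> K u" "Holder_bound \<Omega> \<beta> L v" "\<bar>c\<bar> \<le> 1"
  shows "Holder_bound \<Omega> \<beta> (K + L) (\<lambda>x. u x + c * v x)"
proof -
  obtain p where p: "continuous_on (closure \<Omega>) p" "AE x in lebesgue_on \<Omega>. p x = u x"
    "\<And>x. x \<in> closure \<Omega> \<Longrightarrow> \<bar>p x\<bar> \<le> K"
    "\<And>x y. x \<in> closure \<Omega> \<Longrightarrow> y \<in> closure \<Omega> \<Longrightarrow> \<bar>p x - p y\<bar> \<le> K * dist x y powr \<beta>"
    using assms(1) unfolding Holder_bound_def by blast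
  obtain q where q: "continuous_on (closure \<Omega>) q" "AE x in lebesgue_on \<Omega>. q x = v x"
    "\<And>x. x \<in> closure \<Omega> \<Longrightarrow> \<bar>q x\<bar> \<le> L"
    "\<And>x y. x \<in> closure \<Omega> \<Longrightarrow> y \<in> closure \<Omega> \<Longrightarrow> \<bar>q x - q y\<bar> \<le> L * dist x y powr \<beta>"
    using assms(2) unfolding Holder_bound_def by blast
  have c: "\<bar>c * t\<bar> \<le> \<bar>t\<bar>" for t using assms(3) by (simp add: abs_mult mult_left_le_one_le)
  have "continuous_on (closure \<Omega>) (\<lambda>x. p x + c * q x)" by (intro continuous_intros p q)
  moreover have "AE x in lebesgue_on \<Omega>. p x + c * q x = u x + c * v x"
    using p(2) q(2) by eventually_elim simp
  moreover have "\<bar>p x + c * q x\<bar> \<le> K + L" if "x \<in> closure \<Omega>" for x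
    using p(3)[OF that] q(3)[OF that] c[of "q x"] by linarith
  moreover have "\<bar>(p x + c * q x) - (p y + c * q y)\<bar> \<le> (K + L) * dist x y powr \<beta>"
    if "x \<in> closure \<Omega>" "y \<in> closure \<Omega>" for x y
    using p(4)[OF that] q(4)[OF that] c[of "q x - q y"] unfolding right_diff_distrib distrib_right by linarith
  ultimately show ?thesis unfolding Holder_bound_def by blast
qed

lemma Holder_bound_mono:
  assumes "Holder_bound \<Omega> \<beta> K u" "K \<le> L"
  shows "Holder_bound \<Omega> \<beta> L u"
proof -
  have "K * d powr \<beta> \<le> L * d powr \<beta>" for d using assms(2) by (intro mult_right_mono) auto
  then show ?thesis using assms unfolding Holder_bound_def by (meson order_trans)
qed

text \<open>The radius \<open>r0\<close> is the largest one with K r^\<alpha> \<le> h/2; it is at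
  most 1 because h \<le> K. Inserting it leaves c h^(2+m/\<alpha>) (2K)^(-m/\<alpha>) \<le> e^2, and
  raising this to the power p = \<alpha>/(2\<alpha>+m) makes the exponent of h equal to 1.\<close>

lemma interpolation_algebra:
  fixes h :: real
  assumes "0 < \<alpha>" "0 < m" "0 < K" "0 \<le> h" "h \<le> K" "0 < c" "0 \<le> e"
    and r: "\<And>r. 0 < r \<Longrightarrow> r \<le> 1 \<Longrightarrow> K * r powr \<alpha> \<le> h / 2 \<Longrightarrow> c * h\<^sup>2 * r powr m \<le> e\<^sup>2"
  shows "h \<le> (2 * K) powr (m / (2 * \<alpha> + m)) * (1 / c) powr (\<alpha> / (2 * \<alpha> + m)) * e powr (2 * \<alpha> / (2 * \<alpha> + m))"
proof (cases "h = 0")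
  case False
  then have h: "h > 0" using assms by simp
  define p where "p = \<alpha> / (2 * \<alpha> + m)"
  define r0 where "r0 = (h / (2 * K)) powr (1 / \<alpha>)"
  have p: "p > 0" "2 * p + m / \<alpha> * p = 1" "m / \<alpha> * p = m / (2 * \<alpha> + m)" "2 * p = 2 * \<alpha> / (2 * \<alpha> + m)"
  proof -
    have d: "2 * \<alpha> + m > 0" using assms by simp
    then show "p > 0" "m / \<alpha> * p = m / (2 * \<alpha> + m)" "2 * p = 2 * \<alpha> / (2 * \<alpha> + m)"
      using assms by (auto simp: p_def)
    then show "2 * p + m / \<alpha> * p = 1" using d by (simp add: add_divide_distrib[symmetric])
  qed
  have q: "0 < h / (2 * K)" "h / (2 * K) \<le> 1" using h assms by auto
  have r0: "0 < r0" "r0 \<le> 1" "r0 powr \<alpha> = h / (2 * K)" "r0 powr m = (h / (2 * K)) powr (m / \<alpha>)"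
    using q assms unfolding r0_def by (auto simp: powr_powr powr_le1)
  have le: "c * h\<^sup>2 * (h / (2 * K)) powr (m / \<alpha>) \<le> e\<^sup>2"
    using r[OF r0(1,2)] r0(3,4) assms by simp
  have epos: "e > 0"
  proof (rule ccontr)
    assume "\<not> e > 0"
    moreover have "0 < c * h\<^sup>2 * (h / (2 * K)) powr (m / \<alpha>)" using h assms by simp
    ultimately show False using le assms(7) by simp
  qed
  have "(c * h\<^sup>2 * (h / (2 * K)) powr (m / \<alpha>)) powr p \<le> (e\<^sup>2) powr p"
    using le h assms p by (intro powr_mono2) auto
  also have "(e\<^sup>2) powr p = e powr (2 * p)"
    using epos by (simp add: powr_powr flip: powr_numeral)
  also have "(c * h\<^sup>2 * (h / (2 * K)) powr (m / \<alpha>)) powr p = c powr p * (h powr (2 * p) * (h powr (m / \<alpha> * p) / (2 * K) powr (m / \<alpha> * p)))"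
    using h assms by (simp add: powr_mult powr_powr powr_divide flip: powr_numeral)
  also have "\<dots> = c powr p * h / (2 * K) powr (m / \<alpha> * p)"
  proof -
    have "h powr (2 * p) * h powr (m / \<alpha> * p) = h" using p(2) h by (simp flip: powr_add)
    then show ?thesis by (simp add: field_simps)
  qed
  finally have "c powr p * h \<le> (2 * K) powr (m / \<alpha> * p) * e powr (2 * p)"
    using assms by (simp add: divide_le_eq mult.commute)
  then have "h \<le> (2 * K) powr (m / \<alpha> * p) * e powr (2 * p) / c powr p"
    using assms by (simp add: le_divide_eq mult.commute)
  also have "\<dots> = (2 * K) powr (m / \<alpha> * p) * (1 / c) powr p * e powr (2 * p)"
    using assms by (simp add: powr_divide)
  finally have "h \<le> (2 * K) powr (m / \<alpha> * p) * (1 / c) powr p * e powr (2 * p)" .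
  then show ?thesis unfolding p(3,4) unfolding p_def .
qed simp

text \<open>A number below both A and B is below A^q B^(1-q). With q = \<beta>/\<alpha> this is
  applied to the oscillation, bounded once by the Hoelder quotient and once by 2H; the 2 in the
  result absorbs 2^(1-q).\<close>

lemma Holder_interpolation:
  assumes "0 \<le> \<beta>" "\<beta> < \<alpha>" "0 \<le> K" "0 \<le> H"
    and v: "continuous_on (closure \<Omega>) v" "AE x in lebesgue_on \<Omega>. v x = u x"
    "\<And>x. x \<in> closure \<Omega> \<Longrightarrow> \<bar>v x\<bar> \<le> K" "\<And>x. x \<in> closure \<Omega> \<Longrightarrow> \<bar>v x\<bar> \<le> H"
    "\<And>x y. x \<in> closure \<Omega> \<Longrightarrow> y \<in> closure \<Omega> \<Longrightarrow> \<bar>v x - v y\<bar> \<le> K * dist x y powr \<alpha>"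
  shows "Holder_bound \<Omega> \<beta> (2 * K powr (\<beta> / \<alpha>) * H powr (1 - \<beta> / \<alpha>)) u"
proof -
  define q where "q = \<beta> / \<alpha>"
  have q: "0 \<le> q" "q < 1" "\<alpha> * q = \<beta>" using assms by (auto simp: q_def)
  have split: "t \<le> A powr q * B powr (1 - q)" if "0 \<le> t" "t \<le> A" "t \<le> B" for t A B :: real
  proof (cases "t = 0")
    case False
    then have "t = t powr q * t powr (1 - q)" using that by (simp flip: powr_add)
    also have "\<dots> \<le> A powr q * B powr (1 - q)"
      using that q by (intro mult_mono powr_mono2) auto
    finally show ?thesis .
  qed simp
  have two: "(2 * H) powr (1 - q) \<le> 2 * H powr (1 - q)"
  proof -
    have "(2::real) powr (1 - q) \<le> 2 powr 1" using q by (intro powr_mono) auto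
    then show ?thesis using assms(4) by (simp add: powr_mult mult_right_mono)
  qed
  have "\<bar>v x\<bar> \<le> 2 * K powr q * H powr (1 - q)" if "x \<in> closure \<Omega>" for x
  proof -
    have "0 \<le> K powr q * H powr (1 - q)" by simp
    then show ?thesis using split[OF abs_ge_zero v(3,4)[OF that]] by linarith
  qed
  moreover have "\<bar>v x - v y\<bar> \<le> 2 * K powr q * H powr (1 - q) * dist x y powr \<beta>"
    if "x \<in> closure \<Omega>" "y \<in> closure \<Omega>" for x y
  proof -
    have "\<bar>v x - v y\<bar> \<le> 2 * H" using v(4)[OF that(1)] v(4)[OF that(2)] by linarith
    then have "\<bar>v x - v y\<bar> \<le> (K * dist x y powr \<alpha>) powr q * (2 * H) powr (1 - q)"
      by (intro split v(5) that) auto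
    also have "\<dots> \<le> (K * dist x y powr \<alpha>) powr q * (2 * H powr (1 - q))"
      using two by (intro mult_left_mono) auto
    also have "(K * dist x y powr \<alpha>) powr q = K powr q * dist x y powr \<beta>"
      using assms(3) q(3) by (simp add: powr_mult powr_powr)
    finally show ?thesis by (simp add: ac_simps)
  qed
  ultimately show ?thesis using v(1,2) unfolding Holder_bound_def q_def by blast
qed

section \<open>Smallness in L2 or in the gradient norm implies smallness in Hoelder spaces\<close>

context bounded_open
begin

text \<open>On the ball of radius c r the square of the function is at least h^2/4 and the squared
  weight at least 1/(2r^2), whence the 8. The volume is of order r^3, so the weighted mass is of
  order h^2 r.\<close>

lemma ball_mass:
  assumes c: "c > 0" and y: "ball y (c * r) \<subseteq> \<Omega> \<inter> ball x0 r" and r: "0 < r"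
    and w: "w \<in> L2 \<Omega>" and v: "AE x in lebesgue_on \<Omega>. v x = w x"
    and h: "0 \<le> h" "\<And>x. x \<in> \<Omega> \<inter> ball x0 r \<Longrightarrow> h / 2 \<le> \<bar>v x\<bar>"
  shows "unit_ball_vol 3 * c ^ 3 / 8 * h\<^sup>2 * r \<le> (L2_norm \<Omega> (\<lambda>x. w x / sqrt ((dist x x0)\<^sup>2 + r\<^sup>2)))\<^sup>2"
proof -
  let ?B = "ball y (c * r)"
  let ?g = "\<lambda>x. w x / sqrt ((dist x x0)\<^sup>2 + r\<^sup>2)"
  have g: "?g \<in> L2 \<Omega>" by (rule hardy_weight_L2(1)[OF r w])
  have Bm: "?B \<in> lmeasurable" by (rule lmeasurable_ball)
  have eq: "(\<lambda>x. indicator \<Omega> x *\<^sub>R indicat_real ?B x) = indicat_real ?B"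
    using y by (auto simp: indicator_def fun_eq_iff)
  have int: "integrable (lebesgue_on \<Omega>) (indicat_real ?B)"
    using integrable_indicator_lmeasurable[OF Bm] measurable_domain eq by (simp add: integrable_restrict_space)
  have meas: "(LINT x|lebesgue_on \<Omega>. indicat_real ?B x) = unit_ball_vol 3 * (c * r) ^ 3"
  proof -
    have "(LINT x|lebesgue_on \<Omega>. indicat_real ?B x) = (LINT x|lebesgue. indicator \<Omega> x *\<^sub>R indicat_real ?B x)"
      using measurable_domain by (intro integral_restrict_space) simp
    also have "\<dots> = (LINT x|lebesgue. indicat_real ?B x)" by (simp only: eq)
    also have "\<dots> = measure lebesgue ?B" by simp
    also have "\<dots> = unit_ball_vol 3 * (c * r) ^ 3" using c r by (simp add: content_ball)
    finally show ?thesis .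
  qed
  have "(LINT x|lebesgue_on \<Omega>. h\<^sup>2 / (8 * r\<^sup>2) * indicat_real ?B x) \<le> (LINT x|lebesgue_on \<Omega>. ?g x * ?g x)"
  proof (rule integral_mono_AE)
    show "integrable (lebesgue_on \<Omega>) (\<lambda>x. h\<^sup>2 / (8 * r\<^sup>2) * indicat_real ?B x)"
      using int by (rule integrable_mult_right)
    show "integrable (lebesgue_on \<Omega>) (\<lambda>x. ?g x * ?g x)" by (rule L2_integrable_mult[OF g g])
    show "AE x in lebesgue_on \<Omega>. h\<^sup>2 / (8 * r\<^sup>2) * indicat_real ?B x \<le> ?g x * ?g x"
      using v
    proof eventually_elim
      case (elim x)
      show ?case
      proof (cases "x \<in> ?B")
        case True
        then have x: "x \<in> \<Omega> \<inter> ball x0 r" using y by blast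
        have "(dist x x0)\<^sup>2 + r\<^sup>2 \<le> 2 * r\<^sup>2"
          using x by (simp add: dist_commute power_mono)
        moreover have "(h / 2)\<^sup>2 \<le> (w x)\<^sup>2" using h(2)[OF x] h(1) elim by (simp add: abs_le_square_iff[symmetric])
        ultimately have "(h / 2)\<^sup>2 / (2 * r\<^sup>2) \<le> (w x)\<^sup>2 / ((dist x x0)\<^sup>2 + r\<^sup>2)"
          using r by (intro frac_le) (auto intro: add_nonneg_pos)
        also have "\<dots> = (?g x)\<^sup>2" by (simp add: power_divide)
        also have "\<dots> = ?g x * ?g x" by (rule power2_eq_square)
        finally show ?thesis using True by (simp add: power_divide)
      qed simp
    qed
  qed
  moreover have "(LINT x|lebesgue_on \<Omega>. h\<^sup>2 / (8 * r\<^sup>2) * indicat_real ?B x) = unit_ball_vol 3 * c ^ 3 / 8 * h\<^sup>2 * r"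
    using meas r by (simp add: power_mult_distrib power2_eq_square power3_eq_cube)
  ultimately show ?thesis by (simp add: L2_norm_power2 L2_inner_def)
qed

text \<open>The factor \<open>r powr (m - 1)\<close> unites two cases: for m = 1 Hardy's inequality
  bounds the weighted norm uniformly in r, and for m = 3 the weight is simply at most 1/r. The
  maximum norm is then controlled by the power 2\<alpha>/(2\<alpha>+m) of e, and interpolation
  reduces \<alpha> in the numerator to \<alpha>-\<beta>.\<close>

theorem Holder_small:
  assumes dom: "smooth_bounded_domain \<Omega>" and \<beta>: "0 \<le> \<beta>" "\<beta> < \<alpha>" and m: "0 < m" and K: "0 < K"
  obtains C where "C \<ge> 0" "\<And>w e. w \<in> L2 \<Omega> \<Longrightarrow> 0 \<le> e \<Longrightarrow> Holder_bound \<Omega> \<alpha> K w \<Longrightarrow>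
    (\<And>x0 r. 0 < r \<Longrightarrow> r \<le> 1 \<Longrightarrow> r powr (m - 1) * (L2_norm \<Omega> (\<lambda>x. w x / sqrt ((dist x x0)\<^sup>2 + r\<^sup>2)))\<^sup>2 \<le> e\<^sup>2) \<Longrightarrow>
    Holder_bound \<Omega> \<beta> (C * e powr (2 * (\<alpha> - \<beta>) / (2 * \<alpha> + m))) w"
proof -
  obtain c where c: "c > 0"
    "\<And>x r. x \<in> closure \<Omega> \<Longrightarrow> 0 < r \<Longrightarrow> r \<le> 1 \<Longrightarrow> \<exists>y. ball y (c * r) \<subseteq> \<Omega> \<inter> ball x r"
    using interior_balls[OF dom] by blast
  define c1 where "c1 = unit_ball_vol 3 * c ^ 3 / 8"
  have c1: "c1 > 0" using c(1) by (simp add: c1_def)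
  define C0 where "C0 = (2 * K) powr (m / (2 * \<alpha> + m)) * (1 / c1) powr (\<alpha> / (2 * \<alpha> + m))"
  define C where "C = 2 * K powr (\<beta> / \<alpha>) * C0 powr (1 - \<beta> / \<alpha>)"
  have C0: "C0 \<ge> 0" by (simp add: C0_def)
  have "Holder_bound \<Omega> \<beta> (C * e powr (2 * (\<alpha> - \<beta>) / (2 * \<alpha> + m))) w"
    if w: "w \<in> L2 \<Omega>" and e: "0 \<le> e" and Hb: "Holder_bound \<Omega> \<alpha> K w"
      and mass: "\<And>x0 r. 0 < r \<Longrightarrow> r \<le> 1 \<Longrightarrow> r powr (m - 1) * (L2_norm \<Omega> (\<lambda>x. w x / sqrt ((dist x x0)\<^sup>2 + r\<^sup>2)))\<^sup>2 \<le> e\<^sup>2"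
    for w e
  proof -
    obtain v where v: "continuous_on (closure \<Omega>) v" "AE x in lebesgue_on \<Omega>. v x = w x"
      "\<And>x. x \<in> closure \<Omega> \<Longrightarrow> \<bar>v x\<bar> \<le> K"
      "\<And>x y. x \<in> closure \<Omega> \<Longrightarrow> y \<in> closure \<Omega> \<Longrightarrow> \<bar>v x - v y\<bar> \<le> K * dist x y powr \<alpha>"
      using Hb unfolding Holder_bound_def by blast
    have sup: "\<bar>v x0\<bar> \<le> C0 * e powr (2 * \<alpha> / (2 * \<alpha> + m))" if x0: "x0 \<in> closure \<Omega>" for x0
      unfolding C0_def
    proof (rule interpolation_algebra)
      show "c1 * \<bar>v x0\<bar>\<^sup>2 * r powr m \<le> e\<^sup>2" if r: "0 < r" "r \<le> 1" "K * r powr \<alpha> \<le> \<bar>v x0\<bar> / 2" for r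
      proof -
        obtain y where y: "ball y (c * r) \<subseteq> \<Omega> \<inter> ball x0 r" using c(2)[OF x0 r(1,2)] by blast
        have "\<bar>v x0\<bar> / 2 \<le> \<bar>v x\<bar>" if x: "x \<in> \<Omega> \<inter> ball x0 r" for x
        proof -
          have "\<bar>v x0 - v x\<bar> \<le> K * dist x0 x powr \<alpha>"
            using x closure_subset by (intro v(4) x0) blast
          also have "\<dots> \<le> K * r powr \<alpha>"
            using x \<beta> K by (intro mult_left_mono powr_mono2) auto
          finally show ?thesis using r(3) by linarith
        qed
        then have "c1 * \<bar>v x0\<bar>\<^sup>2 * r \<le> (L2_norm \<Omega> (\<lambda>x. w x / sqrt ((dist x x0)\<^sup>2 + r\<^sup>2)))\<^sup>2"
          unfolding c1_def by (intro ball_mass[OF c(1) y r(1) w v(2)]) auto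
        then have "r powr (m - 1) * (c1 * \<bar>v x0\<bar>\<^sup>2 * r) \<le> e\<^sup>2"
          using mass[OF r(1,2), of x0] mult_left_mono[of _ _ "r powr (m - 1)"] by (meson order_trans powr_ge_zero)
        moreover have "r powr m = r powr (m - 1) * r" using r(1) by (simp add: powr_diff)
        then have "r powr (m - 1) * (c1 * \<bar>v x0\<bar>\<^sup>2 * r) = c1 * \<bar>v x0\<bar>\<^sup>2 * r powr m"
          by (simp only: ac_simps)
        ultimately show ?thesis by (simp only:)
      qed
    qed (use \<beta> m K c1 e v(3)[OF x0] in auto)
    have "Holder_bound \<Omega> \<beta> (2 * K powr (\<beta> / \<alpha>) * (C0 * e powr (2 * \<alpha> / (2 * \<alpha> + m))) powr (1 - \<beta> / \<alpha>)) w"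
      by (rule Holder_interpolation[OF \<beta> _ _ v(1,2,3) sup v(4)]) (use K C0 in auto)
    moreover have "(C0 * e powr (2 * \<alpha> / (2 * \<alpha> + m))) powr (1 - \<beta> / \<alpha>)
        = C0 powr (1 - \<beta> / \<alpha>) * e powr (2 * (\<alpha> - \<beta>) / (2 * \<alpha> + m))"
    proof -
      have "2 * \<alpha> / (2 * \<alpha> + m) * (1 - \<beta> / \<alpha>) = 2 * (\<alpha> - \<beta>) / (2 * \<alpha> + m)"
      proof -
        have "2 * \<alpha> * (1 - \<beta> / \<alpha>) = 2 * (\<alpha> - \<beta>)" using \<beta> by (simp add: field_simps)
        then show ?thesis by (simp only: times_divide_eq_left)
      qed
      from this[symmetric] show ?thesis
        unfolding powr_powr[symmetric] by (simp only: powr_mult C0 powr_ge_zero powr_powr[symmetric])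
    qed
    ultimately show ?thesis by (simp add: C_def mult.assoc)
  qed
  moreover have "C \<ge> 0" by (simp add: C_def)
  ultimately show ?thesis by (rule that[rotated])
qed

corollary Holder_small_H10:
  assumes dom: "smooth_bounded_domain \<Omega>" and \<beta>: "0 \<le> \<beta>" "\<beta> < \<alpha>" and K: "0 < K"
  obtains C where "C \<ge> 0" "\<And>w. w \<in> H10 \<Omega> \<Longrightarrow> Holder_bound \<Omega> \<alpha> K w \<Longrightarrow>
    Holder_bound \<Omega> \<beta> (C * (2 * grad_norm \<Omega> w) powr (2 * (\<alpha> - \<beta>) / (2 * \<alpha> + 1))) w"
proof -
  obtain C where C: "C \<ge> 0" "\<And>w e. w \<in> L2 \<Omega> \<Longrightarrow> 0 \<le> e \<Longrightarrow> Holder_bound \<Omega> \<alpha> K w \<Longrightarrow>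
    (\<And>x0 r. 0 < r \<Longrightarrow> r \<le> 1 \<Longrightarrow> r powr (1 - 1) * (L2_norm \<Omega> (\<lambda>x. w x / sqrt ((dist x x0)\<^sup>2 + r\<^sup>2)))\<^sup>2 \<le> e\<^sup>2) \<Longrightarrow>
    Holder_bound \<Omega> \<beta> (C * e powr (2 * (\<alpha> - \<beta>) / (2 * \<alpha> + 1))) w"
    using Holder_small[OF dom \<beta> zero_less_one K] by blast
  show ?thesis
  proof (rule that[OF C(1)])
    fix w assume w: "w \<in> H10 \<Omega>" "Holder_bound \<Omega> \<alpha> K w"
    have "r powr (1 - 1) * (L2_norm \<Omega> (\<lambda>x. w x / sqrt ((dist x x0)\<^sup>2 + r\<^sup>2)))\<^sup>2 \<le> (2 * grad_norm \<Omega> w)\<^sup>2"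
      if "0 < r" "r \<le> 1" for x0 r
      using power_mono[OF hardy[OF that(1) w(1), of x0] L2_norm_nonneg, of 2] that by simp
    moreover have "0 \<le> 2 * grad_norm \<Omega> w" by (simp add: grad_norm_def sum_nonneg)
    ultimately show "Holder_bound \<Omega> \<beta> (C * (2 * grad_norm \<Omega> w) powr (2 * (\<alpha> - \<beta>) / (2 * \<alpha> + 1))) w"
      by (intro C(2) H10_L2 w) auto
  qed
qed

corollary Holder_small_L2:
  assumes dom: "smooth_bounded_domain \<Omega>" and \<beta>: "0 \<le> \<beta>" "\<beta> < \<alpha>" and K: "0 < K"
  obtains C where "C \<ge> 0" "\<And>w. w \<in> L2 \<Omega> \<Longrightarrow> Holder_bound \<Omega> \<alpha> K w \<Longrightarrow>
    Holder_bound \<Omega> \<beta> (C * L2_norm \<Omega> w powr (2 * (\<alpha> - \<beta>) / (2 * \<alpha> + 3))) w"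
proof -
  obtain C where C: "C \<ge> 0" "\<And>w e. w \<in> L2 \<Omega> \<Longrightarrow> 0 \<le> e \<Longrightarrow> Holder_bound \<Omega> \<alpha> K w \<Longrightarrow>
    (\<And>x0 r. 0 < r \<Longrightarrow> r \<le> 1 \<Longrightarrow> r powr (3 - 1) * (L2_norm \<Omega> (\<lambda>x. w x / sqrt ((dist x x0)\<^sup>2 + r\<^sup>2)))\<^sup>2 \<le> e\<^sup>2) \<Longrightarrow>
    Holder_bound \<Omega> \<beta> (C * e powr (2 * (\<alpha> - \<beta>) / (2 * \<alpha> + 3))) w"
    using Holder_small[OF dom \<beta> zero_less_numeral K] by blast
  show ?thesis
  proof (rule that[OF C(1)])
    fix w assume w: "w \<in> L2 \<Omega>" "Holder_bound \<Omega> \<alpha> K w"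
    have "r powr (3 - 1) * (L2_norm \<Omega> (\<lambda>x. w x / sqrt ((dist x x0)\<^sup>2 + r\<^sup>2)))\<^sup>2 \<le> (L2_norm \<Omega> w)\<^sup>2"
      if "0 < r" "r \<le> 1" for x0 r
    proof -
      have "r * L2_norm \<Omega> (\<lambda>x. w x / sqrt ((dist x x0)\<^sup>2 + r\<^sup>2)) \<le> L2_norm \<Omega> w"
        using hardy_weight_L2(2)[OF that(1) w(1), of x0] that by (simp add: field_simps)
      from power_mono[OF this, of 2] that show ?thesis
        by (simp add: power_mult_distrib L2_norm_nonneg)
    qed
    then show "Holder_bound \<Omega> \<beta> (C * L2_norm \<Omega> w powr (2 * (\<alpha> - \<beta>) / (2 * \<alpha> + 3))) w"
      by (intro C(2) L2_norm_nonneg w)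
  qed
qed

end

subsection \<open>Ellipticity of the oscillating and homogenised coefficients\<close>

lemma matrix_form_sym:
  fixes A :: "real^3^3"
  assumes "\<And>i j. A $ i $ j = A $ j $ i"
  shows "(A *v x) \<bullet> y = (A *v y) \<bullet> x"
proof -
  have "transpose A = A" using assms by (simp add: transpose_def vec_eq_iff)
  then show ?thesis by (metis dot_lmul_matrix inner_commute transpose_matrix_vector)
qed

lemma matrix_form_axis: "(A *v axis j 1) \<bullet> axis i 1 = (A :: real^3^3) $ i $ j"
  by (simp add: inner_axis matrix_vector_mul_component inner_commute[of _ "axis j 1"])

text \<open>Polarisation: the bounds of the form at \<open>axis i 1\<close> and at
  \<open>axis i 1\<close> plus or minus \<open>axis j 1\<close> control every entry at every point
  by an explicit constant.\<close>

lemma admissible_coeff_bound: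
  assumes "admissible_coeff \<nu> a" "0 < \<nu>"
  shows "\<bar>a y $ i $ j\<bar> \<le> inverse \<nu>"
proof -
  have sym: "\<And>i j. a y $ i $ j = a y $ j $ i" using assms(1) by (simp add: admissible_coeff_def)
  have up: "(a y *v \<eta>) \<bullet> \<eta> \<le> inverse \<nu> * (norm \<eta>)\<^sup>2" and low: "0 \<le> (a y *v \<eta>) \<bullet> \<eta>" for \<eta>
  proof -
    show "(a y *v \<eta>) \<bullet> \<eta> \<le> inverse \<nu> * (norm \<eta>)\<^sup>2" using assms(1) by (simp add: admissible_coeff_def)
    have "\<nu> * (norm \<eta>)\<^sup>2 \<le> (a y *v \<eta>) \<bullet> \<eta>" using assms(1) by (simp add: admissible_coeff_def)
    moreover have "0 \<le> \<nu> * (norm \<eta>)\<^sup>2" using assms(2) by simp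
    ultimately show "0 \<le> (a y *v \<eta>) \<bullet> \<eta>" by linarith
  qed
  define \<alpha> where "\<alpha> = a y"
  note up = up[folded \<alpha>_def] and low = low[folded \<alpha>_def] and sym = sym[folded \<alpha>_def]
  have diag: "0 \<le> \<alpha> $ i $ i" "\<alpha> $ i $ i \<le> inverse \<nu>" for i
    using up[of "axis i 1"] low[of "axis i 1"] by (simp_all add: matrix_form_axis)
  show ?thesis
  proof (cases "i = j")
    case True
    then show ?thesis using diag[of i] by (simp add: \<alpha>_def)
  next
    case False
    have n: "(norm (axis i 1 + s *\<^sub>R axis j 1 :: real^3))\<^sup>2 = 1 + s\<^sup>2" for s
      unfolding power2_norm_eq_inner using False
      by (simp add: inner_add_left inner_add_right inner_axis_axis power2_eq_square)
    have e: "(\<alpha> *v (axis i 1 + s *\<^sub>R axis j 1)) \<bullet> (axis i 1 + s *\<^sub>R axis j 1)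
        = \<alpha> $ i $ i + 2 * s * \<alpha> $ i $ j + s\<^sup>2 * \<alpha> $ j $ j" for s
      using sym[of j i]
      by (simp add: matrix_vector_right_distrib matrix_vector_mult_scaleR inner_add_left inner_add_right
          matrix_form_axis power2_eq_square algebra_simps)
    have "\<alpha> $ i $ i + 2 * s * \<alpha> $ i $ j + s\<^sup>2 * \<alpha> $ j $ j \<le> inverse \<nu> * (1 + s\<^sup>2)" for s
      using up[of "axis i 1 + s *\<^sub>R axis j 1"] unfolding n e .
    from this[of 1] this[of "-1"] diag[of i] diag[of j] show ?thesis by (simp add: \<alpha>_def)
  qed
qed

text \<open>The constants do not depend on \<epsilon>, which is one source of the uniformity of the
  later estimates.\<close>

lemma osc_coeff_elliptic:
  assumes "admissible_coeff \<nu> a" "0 < \<nu>" "bounded_open \<Omega>"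
  shows "elliptic_coeff \<Omega> (osc_coeff a \<epsilon>) \<nu> (inverse \<nu>)"
proof -
  interpret bounded_open \<Omega> by fact
  show ?thesis
  proof unfold_locales
    fix i j
    have "(\<lambda>y. a y $ i $ j) \<in> borel_measurable lebesgue"
      using assms(1) by (simp add: admissible_coeff_def)
    from measurable_compose[OF lebesgue_measurable_scaling this, of "inverse \<epsilon>"]
    show "(\<lambda>x. osc_coeff a \<epsilon> x $ i $ j) \<in> borel_measurable (lebesgue_on \<Omega>)"
      unfolding osc_coeff_def by (intro measurable_restrict_space1) simp
    show "\<bar>osc_coeff a \<epsilon> x $ i $ j\<bar> \<le> inverse \<nu>" for x
      unfolding osc_coeff_def by (rule admissible_coeff_bound[OF assms(1,2)])
  qed (use assms in \<open>auto simp: osc_coeff_def admissible_coeff_def\<close>)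
qed

section \<open>Periodic functions with a constant weak derivative\<close>

lemma smooth_antiderivative:
  assumes "\<And>t. (H has_real_derivative h t) (at t)" "\<And>i d. smooth (\<lambda>x. h (x $ i + d))"
  shows "smooth (\<lambda>x. H (x $ i + d))"
proof -
  \<comment> \<open>The antiderivative joins the smooth functions as a generator; its own partial
    derivatives already fall among them.\<close>
  define G where "G = insert (\<lambda>x. H (x $ i + d)) (Collect smooth)"
  have d: "(H has_real_derivative h (1 * x $ i + d)) (at (1 * x $ i + d))" for x :: pt using assms(1) .
  note c = coordinate_composition[OF d, simplified]
  show ?thesis
  proof (rule smooth_alg[where G=G])
    show "(\<lambda>x. H (x $ i + d)) \<in> alg G" by (rule alg_base) (simp add: G_def)
    fix g x j assume g: "g \<in> G"
    show "g differentiable (at x)"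
      using g c(1) by (auto simp: G_def smooth_imp_differentiable)
    have "pd j (\<lambda>x. H (x $ i + d)) = (\<lambda>x. (if j = i then 1 else 0) * h (x $ i + d))"
      using c(2) by (auto simp: fun_eq_iff)
    then have "smooth (pd j (\<lambda>x. H (x $ i + d)))"
      using assms(2) by (simp only: smooth_cmult)
    then show "pd j g \<in> alg G"
      using g by (intro alg_base) (auto simp: G_def smooth_pd)
  qed
qed

lemma pd_translate:
  assumes "\<phi> differentiable (at (c + x))"
  shows "pd i (\<lambda>x. \<phi> (c + x)) x = pd i \<phi> (c + x)"
    "(\<lambda>x. \<phi> (c + x)) differentiable (at x)"
proof -
  have D: "(\<phi> has_derivative frechet_derivative \<phi> (at (c + x))) (at (c + x))"
    using assms frechet_derivative_works by blast
  have "((\<lambda>x. c + x) has_derivative (\<lambda>h. h)) (at x)" by (auto intro!: derivative_eq_intros)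
  from has_derivative_compose[OF this D]
  have *: "((\<lambda>x. \<phi> (c + x)) has_derivative frechet_derivative \<phi> (at (c + x))) (at x)" .
  show "pd i (\<lambda>x. \<phi> (c + x)) x = pd i \<phi> (c + x)" using pd_eqI[OF *] by (simp add: pd_def)
  show "(\<lambda>x. \<phi> (c + x)) differentiable (at x)" using * by (auto simp: differentiable_def)
qed

lemma smooth_translate:
  assumes "smooth \<phi>"
  shows "smooth (\<lambda>x. \<phi> (c + x))"
proof (rule smooth_coinduct[where P="{(\<lambda>x. \<phi> (c + x)) |\<phi>. smooth \<phi>}"])
  show "(\<lambda>x. \<phi> (c + x)) \<in> {(\<lambda>x. \<phi> (c + x)) |\<phi>. smooth \<phi>}" using assms by blast
  fix \<psi> x i assume "\<psi> \<in> {(\<lambda>x. \<phi> (c + x)) |\<phi>. smooth \<phi>}"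
  then obtain \<phi> where \<phi>: "\<psi> = (\<lambda>x. \<phi> (c + x))" "smooth \<phi>" by blast
  show "\<psi> differentiable (at x)"
    unfolding \<phi>(1) by (rule pd_translate(2)[OF smooth_imp_differentiable[OF \<phi>(2)]])
  have "pd i \<psi> = (\<lambda>x. pd i \<phi> (c + x))"
    unfolding \<phi>(1) using pd_translate(1)[OF smooth_imp_differentiable[OF \<phi>(2)]] by blast
  then show "pd i \<psi> \<in> {(\<lambda>x. \<phi> (c + x)) |\<phi>. smooth \<phi>}" using smooth_pd[OF \<phi>(2)] by blast
qed

lemma test_fun_translate:
  assumes "\<phi> \<in> test_fun UNIV"
  shows "(\<lambda>x. \<phi> (c + x)) \<in> test_fun UNIV"
proof -
  obtain K where K': "smooth \<phi>" "compact K" "K \<subseteq> UNIV" "\<And>x. x \<notin> K \<Longrightarrow> \<phi> x = 0"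
    using test_funE[OF assms] by blast
  note K = K'(1,2,4)
  show ?thesis
  proof (rule test_funI[OF smooth_translate[OF K(1)]])
    show "compact ((\<lambda>x. - c + x) ` K)" using K(2) by (rule compact_translation)
    show "\<phi> (c + x) = 0" if "x \<notin> (\<lambda>x. - c + x) ` K" for x
    proof (rule K(3))
      show "c + x \<notin> K"
      proof
        assume "c + x \<in> K"
        then have "- c + (c + x) \<in> (\<lambda>x. - c + x) ` K" by (rule imageI)
        then show False using that by simp
      qed
    qed
  qed simp
qed

lemma L1_loc_translate:
  assumes "u \<in> L1_loc UNIV"
  shows "(\<lambda>x. u (c + x)) \<in> L1_loc UNIV"
proof -
  have "set_integrable lebesgue K (\<lambda>x. u (c + x))" if K: "compact K" for K
  proof -
    have "compact ((\<lambda>x. c + x) ` K)" using K by (rule compact_translation)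
    then have i: "integrable lebesgue (\<lambda>x. indicator ((\<lambda>x. c + x) ` K) x *\<^sub>R u x)"
      using assms by (simp add: L1_loc_def set_integrable_def)
    then have "integrable (distr lebesgue lebesgue (\<lambda>x. c + x)) (\<lambda>x. indicator ((\<lambda>x. c + x) ` K) x *\<^sub>R u x)"
      by (simp only: lebesgue_translation(2))
    then have "integrable lebesgue (\<lambda>x. indicator ((\<lambda>x. c + x) ` K) (c + x) *\<^sub>R u (c + x))"
      by (subst (asm) integrable_distr_eq[OF lebesgue_translation(1) borel_measurable_integrable[OF i]])
    moreover have "indicator ((\<lambda>x. c + x) ` K) (c + x) = indicat_real K x" for x
      by (auto simp: indicator_def)
    ultimately show ?thesis by (simp add: set_integrable_def)
  qed
  then show ?thesis by (simp add: L1_loc_def)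
qed

lemma L2_inner_translate:
  assumes "u \<in> L1_loc UNIV" "\<phi> \<in> test_fun UNIV"
  shows "L2_inner UNIV (\<lambda>x. u (c + x)) (\<lambda>x. \<phi> (c + x)) = L2_inner UNIV u \<phi>"
  using integral_lebesgue_translation[OF borel_measurable_integrable[OF L1_loc_mult_integrable(2)[OF assms]], of c]
  by (simp add: L2_inner_def lebesgue_on_UNIV_eq)

lemma has_weak_pd_translate:
  assumes "has_weak_pd UNIV i u d"
  shows "has_weak_pd UNIV i (\<lambda>x. u (c + x)) (\<lambda>x. d (c + x))"
  unfolding has_weak_pd_def
proof (intro conjI ballI)
  have l: "u \<in> L1_loc UNIV" "d \<in> L1_loc UNIV" using assms by (auto simp: has_weak_pd_def)
  then show "(\<lambda>x. u (c + x)) \<in> L1_loc UNIV" "(\<lambda>x. d (c + x)) \<in> L1_loc UNIV"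
    by (auto intro: L1_loc_translate)
  fix \<phi> assume \<phi>: "\<phi> \<in> test_fun UNIV"
  define \<psi> where "\<psi> = (\<lambda>x. \<phi> (- c + x))"
  have \<psi>: "\<psi> \<in> test_fun UNIV" unfolding \<psi>_def using \<phi> by (rule test_fun_translate)
  have eq: "(\<lambda>x. \<psi> (c + x)) = \<phi>" by (simp add: \<psi>_def)
  have eq': "(\<lambda>x. pd i \<psi> (c + x)) = pd i \<phi>"
    using pd_translate(1)[OF smooth_imp_differentiable[OF test_fun_smooth[OF \<psi>]], of i c]
    by (simp add: eq fun_eq_iff)
  show "L2_inner UNIV (\<lambda>x. u (c + x)) (pd i \<phi>) = - L2_inner UNIV (\<lambda>x. d (c + x)) \<phi>"
    using L2_inner_translate[OF l(1) test_fun_pd[OF \<psi>], of c i] L2_inner_translate[OF l(2) \<psi>, of c]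
      assms \<psi> unfolding eq eq' by (simp add: has_weak_pd_def)
qed

text \<open>Integrating from -1 works on the whole line because \<open>h\<close> vanishes for t
  \<le> 0: on the negative half-axis the integral is constantly 0, also where the interval is
  empty.\<close>

lemma antiderivative_exists:
  fixes h :: "real \<Rightarrow> real"
  assumes "continuous_on UNIV h" "\<And>t. t \<le> 0 \<Longrightarrow> h t = 0"
  obtains H where "\<And>t. (H has_real_derivative h t) (at t)"
proof
  fix t :: real
  show "((\<lambda>t. integral {-1..t} h) has_real_derivative h t) (at t)"
  proof (cases "t < 0")
    case True
    have "((\<lambda>t. 0) has_real_derivative 0) (at t)" by simp
    then have "((\<lambda>t. integral {-1..t} h) has_real_derivative 0) (at t)"
    proof (rule has_field_derivative_transform_within_open[where S="{..<0}"])
      show "0 = integral {-1..x} h" if "x \<in> {..<0}" for x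
      proof -
        have "integral {-1..x} h = integral {-1..x} (\<lambda>x. 0)"
          by (rule Henstock_Kurzweil_Integration.integral_cong) (use that assms(2) in auto)
        then show ?thesis by simp
      qed
    qed (use True in auto)
    then show ?thesis using True assms(2)[of t] by simp
  next
    case False
    have "((\<lambda>x. integral {-1..x} h) has_real_derivative h t) (at t within {-1..t + 1})"
    proof (rule integral_has_real_derivative)
      show "continuous_on {-1..t + 1} h" by (rule continuous_on_subset[OF assms(1)]) simp
    qed (use False in auto)
    moreover have "at t within {-1..t + 1} = at t"
      by (rule at_within_Icc_at) (use False in auto)
    ultimately show ?thesis by simp
  qed
qed

lemma unit_cell_measurable: "unit_cell \<in> sets lebesgue"
proof -
  have "unit_cell = (\<Inter>i. {y. 0 \<le> y $ i} \<inter> {y. y $ i < 1})" by (auto simp: unit_cell_def)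
  also have "\<dots> \<in> sets borel"
    by (intro sets.countable_INT image_subsetI sets.Int
        borel_closed[OF closed_halfspace_component_ge_cart] borel_open[OF open_halfspace_component_lt_cart]) auto
  finally show ?thesis by (simp add: sets_completionI_sets)
qed

text \<open>Test against $\theta(x_k) \prod_{j \ne k} h(x_j)$ where $\theta$ has the derivative
  $h(t) - h(t - 1)$: by periodicity the integral of $u$ against its $k$-th derivative vanishes.\<close>

lemma periodic_weak_pd_const:
  assumes u: "periodic u" and d: "has_weak_pd UNIV k u d" and c: "AE x in lebesgue_on unit_cell. d x = c"
  shows "c = 0"
proof -
  define h :: "real \<Rightarrow> real" where "h t = flat_exp 0 t * flat_exp 0 (1 - t)" for t
  have h0: "h t \<noteq> 0 \<longleftrightarrow> 0 < t \<and> t < 1" "0 \<le> h t" for t by (auto simp: h_def flat_exp_def)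
  have hc: "continuous_on UNIV h"
    unfolding h_def by (intro continuous_intros continuous_on_compose2[OF continuous_on_flat_exp]) auto
  obtain H where H: "\<And>t. (H has_real_derivative h t) (at t)"
    using antiderivative_exists[OF hc] h0 by force
  have h_smooth: "smooth (\<lambda>x. h (x $ i + t))" for i t
    using smooth_mult[OF smooth_flat_exp[of 0 1 i t] smooth_flat_exp[of 0 "-1" i "1 - t"]]
    by (simp add: h_def algebra_simps)
  have H_smooth: "smooth (\<lambda>x. H (x $ i + t))" for i t
    by (rule smooth_antiderivative[OF H h_smooth])
  \<comment> \<open>\<open>\<theta> t\<close> is the integral of \<open>h\<close> over a unit
    interval ending at t. The subtraction restores the compact support, inside [0,2], that the
    antiderivative \<open>H\<close> alone does not have.\<close>
  define \<theta> where "\<theta> t = H t - H (t - 1)" for t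
  have \<theta>_mvt: "\<exists>z. t - 1 < z \<and> z < t \<and> \<theta> t = h z" for t
    using MVT2[of "t - 1" t H h] H by (auto simp: \<theta>_def)
  have \<theta>0: "0 \<le> \<theta> t" "\<theta> t \<noteq> 0 \<Longrightarrow> 0 < t \<and> t < 2" "\<theta> 1 \<noteq> 0" for t
    using \<theta>_mvt[of t] \<theta>_mvt[of 1] h0 by force+
  define P where "P x = (\<Prod>j\<in>UNIV - {k}. h (x $ j))" for x :: pt
  define \<psi> where "\<psi> x = \<theta> (x $ k) * P x" for x
  define \<xi> where "\<xi> x = h (x $ k) * P x" for x
  have P_smooth: "smooth P"
    unfolding P_def using h_smooth[of _ 0] by (intro smooth_prod) auto
  have \<theta>_smooth: "smooth (\<lambda>x. \<theta> (x $ k))"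
    using smooth_add[OF H_smooth[of k 0] smooth_cmult[OF H_smooth[of k "-1"], of "-1"]] by (simp add: \<theta>_def)
  have \<psi>_smooth: "smooth \<psi>" unfolding \<psi>_def by (intro smooth_mult \<theta>_smooth P_smooth)
  have \<xi>_smooth: "smooth \<xi>" unfolding \<xi>_def using h_smooth[of k 0] by (intro smooth_mult P_smooth) simp
  have P0: "0 < x $ j \<and> x $ j < 1" if "P x \<noteq> 0" "j \<noteq> k" for x j
    using that h0(1) by (auto simp: P_def)
  let ?L = "cbox 0 (\<chi> j. 2) :: pt set"
  have \<psi>_supp: "\<psi> x = 0" if "x \<notin> ?L" for x
  proof (rule ccontr)
    assume "\<psi> x \<noteq> 0"
    then have "\<theta> (x $ k) \<noteq> 0" "P x \<noteq> 0" by (auto simp: \<psi>_def)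
    then have "0 \<le> x $ j \<and> x $ j \<le> 2" for j
      using \<theta>0(2) P0[of x j] by (cases "j = k") force+
    then show False using that by (simp add: mem_box_cart)
  qed
  have \<xi>_supp: "\<xi> x = 0" if "x \<notin> ?L" for x
  proof (rule ccontr)
    assume "\<xi> x \<noteq> 0"
    then have "h (x $ k) \<noteq> 0" "P x \<noteq> 0" by (auto simp: \<xi>_def)
    then have "0 \<le> x $ j \<and> x $ j \<le> 2" for j
      using h0(1)[of "x $ k"] P0[of x j] by (cases "j = k") force+
    then show False using that by (simp add: mem_box_cart)
  qed
  have \<psi>_test: "\<psi> \<in> test_fun UNIV" by (rule test_funI[OF \<psi>_smooth compact_cbox _ \<psi>_supp]) auto
  have \<xi>_test: "\<xi> \<in> test_fun UNIV" by (rule test_funI[OF \<xi>_smooth compact_cbox _ \<xi>_supp]) auto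
  define e :: pt where "e = axis k 1"
  have P_shift: "P (- e + x) = P x" for x
    unfolding P_def by (intro prod.cong) (auto simp: e_def axis_def)
  have pd_\<psi>: "pd k \<psi> = (\<lambda>x. -1 * \<xi> (- e + x) + \<xi> x)"
  proof
    fix x
    have P_pd: "pd k P x = 0"
    proof -
      have "((\<lambda>t. P (x + t *\<^sub>R axis k 1)) has_real_derivative pd k P (x + 0 *\<^sub>R axis k 1)) (at 0)"
        by (rule pd_line[OF smooth_imp_differentiable[OF P_smooth]])
      moreover have "(\<lambda>t. P (x + t *\<^sub>R axis k 1)) = (\<lambda>t. P x)"
        unfolding P_def by (intro ext prod.cong) (auto simp: axis_def)
      ultimately show ?thesis using DERIV_unique[OF _ DERIV_const] by simp
    qed
    have "((\<lambda>t. \<theta> t) has_real_derivative h (1 * x $ k + 0) - h (x $ k - 1)) (at (1 * x $ k + 0))"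
    proof -
      have "((\<lambda>t. t - 1) has_real_derivative 1) (at (x $ k))" by (auto intro!: derivative_eq_intros)
      from DERIV_diff[OF H DERIV_chain2[OF H this]] show ?thesis by (simp add: \<theta>_def)
    qed
    from coordinate_composition(2)[OF this, of k]
    have \<theta>_pd: "pd k (\<lambda>x. \<theta> (x $ k)) x = h (x $ k) - h (x $ k - 1)" by simp
    have "pd k \<psi> x = \<theta> (x $ k) * pd k P x + pd k (\<lambda>x. \<theta> (x $ k)) x * P x"
      unfolding \<psi>_def by (intro pd_mult smooth_imp_differentiable \<theta>_smooth P_smooth)
    moreover have "\<xi> (- e + x) = h (x $ k - 1) * P x"
      unfolding \<xi>_def P_shift by (simp add: e_def)
    moreover have "\<xi> x = h (x $ k) * P x" by (simp add: \<xi>_def)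
    ultimately show "pd k \<psi> x = -1 * \<xi> (- e + x) + \<xi> x"
      by (simp add: P_pd \<theta>_pd left_diff_distrib)
  qed
  have l: "u \<in> L1_loc UNIV" "d \<in> L1_loc UNIV" using d by (auto simp: has_weak_pd_def)
  have per: "(\<lambda>x. u (e + x)) = u" "(\<lambda>x. u (- e + x)) = u"
  proof -
    show "(\<lambda>x. u (e + x)) = u" using u by (auto simp: periodic_def e_def add.commute)
    then have "u (e + (- e + x)) = u (- e + x)" for x by metis
    then show "(\<lambda>x. u (- e + x)) = u" by (simp add: fun_eq_iff)
  qed
  have "L2_inner UNIV u (pd k \<psi>) = 0"
  proof -
    have t: "(\<lambda>x. \<xi> (- e + x)) \<in> test_fun UNIV" by (rule test_fun_translate[OF \<xi>_test])
    have "L2_inner UNIV u (pd k \<psi>) = - L2_inner UNIV u (\<lambda>x. \<xi> (- e + x)) + L2_inner UNIV u \<xi>"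
      using L1_loc_mult_integrable(1)[OF l(1) t] L1_loc_mult_integrable(1)[OF l(1) \<xi>_test]
      unfolding L2_inner_def pd_\<psi> by (simp add: distrib_left right_diff_distrib)
    then show ?thesis using L2_inner_translate[OF l(1) \<xi>_test, of "- e"] unfolding per by simp
  qed
  then have dz: "L2_inner UNIV d \<psi> = 0" using d \<psi>_test by (auto simp: has_weak_pd_def)
  have cell_meas: "unit_cell \<in> sets lebesgue" by (rule unit_cell_measurable)
  have ae1: "AE x in lebesgue. x \<in> unit_cell \<longrightarrow> d x = c"
    using c cell_meas by (simp add: AE_restrict_space_iff)
  \<comment> \<open>\<open>d\<close> is merely some weak derivative of the periodic
    \<open>u\<close>; uniqueness makes it periodic in direction \<open>e\<close> almost everywhere.
    This carries the value \<open>c\<close> from the unit cell to the rest of the support of \<psi>,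
    which reaches up to 2 in the k-th coordinate.\<close>
  have shift: "AE x in lebesgue. d (- e + x) = d x"
  proof -
    have "has_weak_pd UNIV k u (\<lambda>x. d (- e + x))"
      using has_weak_pd_translate[OF d, of "- e"] unfolding per .
    from has_weak_pd_unique[OF this d open_UNIV] show ?thesis unfolding lebesgue_on_UNIV_eq .
  qed
  have ae2: "AE x in lebesgue. - e + x \<in> unit_cell \<longrightarrow> d (- e + x) = c"
    by (rule AE_distrD[OF lebesgue_translation(1)]) (unfold lebesgue_translation(2), rule ae1)
  have ae: "AE x in lebesgue. d x * \<psi> x = c * \<psi> x"
    using ae1 ae2 shift
  proof eventually_elim
    case (elim x)
    show ?case
    proof (cases "\<psi> x = 0")
      case False
      then have *: "\<theta> (x $ k) \<noteq> 0" "P x \<noteq> 0" by (auto simp: \<psi>_def)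
      show ?thesis
      proof (cases "x $ k < 1")
        case True
        have "0 \<le> x $ j \<and> x $ j < 1" for j
          using \<theta>0(2)[OF *(1)] P0[OF *(2), of j] True by (cases "j = k") auto
        then show ?thesis using elim(1) by (simp add: unit_cell_def)
      next
        case False
        have "0 \<le> (- e + x) $ j \<and> (- e + x) $ j < 1" for j
          using \<theta>0(2)[OF *(1)] P0[OF *(2), of j] False by (cases "j = k") (auto simp: e_def axis_def)
        then show ?thesis using elim(2,3) by (simp add: unit_cell_def)
      qed
    qed simp
  qed
  have \<psi>_int: "integrable lebesgue \<psi>"
    by (rule integrable_continuous_compact_support[OF continuous_on_smooth[OF \<psi>_smooth] compact_cbox \<psi>_supp])
  have "0 = (LINT x|lebesgue. d x * \<psi> x)"
    using dz L1_loc_mult_integrable(3)[OF l(2) \<psi>_test] by simp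
  also have "\<dots> = (LINT x|lebesgue. c * \<psi> x)"
    using L1_loc_mult_integrable(2)[OF l(2) \<psi>_test] \<psi>_int ae
    by (intro integral_cong_AE) (auto intro: borel_measurable_integrable)
  finally have "c * (LINT x|lebesgue. \<psi> x) = 0" by simp
  \<comment> \<open>\<psi> is nonnegative, continuous and nonzero at the point with k-th coordinate
    1 and the others 1/2; a nonempty open set is not null.\<close>
  moreover have "(LINT x|lebesgue. \<psi> x) \<noteq> 0"
  proof
    assume "(LINT x|lebesgue. \<psi> x) = 0"
    moreover have "0 \<le> \<psi> x" for x
      unfolding \<psi>_def P_def using \<theta>0(1) h0(2) by (intro mult_nonneg_nonneg prod_nonneg) auto
    ultimately have "AE x in lebesgue. \<psi> x = 0"
      using integral_nonneg_eq_0_iff_AE[OF \<psi>_int] by simp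
    then have "negligible {x. \<psi> x \<noteq> 0}"
      by (simp add: completion.AE_iff_null_sets negligible_iff_null_sets)
    moreover have "open {x. \<psi> x \<noteq> 0}"
      by (intro open_Collect_neq continuous_on_smooth[OF \<psi>_smooth] continuous_on_const)
    moreover have "(\<chi> j. if j = k then 1 else 1/2) \<in> {x. \<psi> x \<noteq> 0}"
      using \<theta>0(3) h0(1)[of "1/2"] by (simp add: \<psi>_def P_def)
    ultimately show False using open_not_negligible by blast
  qed
  ultimately show ?thesis by simp
qed

section \<open>Ellipticity of the homogenised matrix\<close>

lemma has_weak_pd_sum:
  assumes "finite I" "\<And>i. i \<in> I \<Longrightarrow> has_weak_pd \<Omega> k (u i) (d i)" "open \<Omega>"
  shows "has_weak_pd \<Omega> k (\<lambda>x. \<Sum>i\<in>I. c i * u i x) (\<lambda>x. \<Sum>i\<in>I. c i * d i x)"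
  using assms(1,2)
proof (induction I rule: finite_induct)
  case empty
  then show ?case using has_weak_pd_smooth[OF smooth_const[of 0] assms(3), of k] by (simp add: pd_const)
next
  case (insert i I)
  then show ?case using has_weak_pd_comb[of \<Omega> k "u i" "d i" _ _ "c i"] assms(3) by simp
qed

text \<open>The minimum over the compact unit sphere. The ellipticity constant of the homogenised
  matrix is thus obtained qualitatively, from strict positivity.\<close>

lemma positive_form_lower_bound:
  fixes A :: "real^'n^'n"
  assumes "\<And>x. x \<noteq> 0 \<Longrightarrow> 0 < (A *v x) \<bullet> x"
  obtains m where "m > 0" "\<And>x. m * (norm x)\<^sup>2 \<le> (A *v x) \<bullet> x"
proof -
  let ?f = "\<lambda>x. (A *v x) \<bullet> x"
  have cont: "continuous_on (sphere 0 1) ?f"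
    by (intro continuous_intros linear_continuous_on matrix_vector_mul_bounded_linear)
  have "axis undefined 1 \<in> sphere (0::real^'n) 1" by simp
  then have "sphere (0::real^'n) 1 \<noteq> {}" by blast
  then obtain x0 where x0: "x0 \<in> sphere 0 1" "\<And>x. x \<in> sphere 0 1 \<Longrightarrow> ?f x0 \<le> ?f x"
    using continuous_attains_inf[OF compact_sphere _ cont] by blast
  have "?f x0 * (norm x)\<^sup>2 \<le> ?f x" for x
  proof (cases "x = 0")
    case False
    define y where "y = (1 / norm x) *\<^sub>R x"
    have x: "x = norm x *\<^sub>R y" using False by (simp add: y_def)
    have "y \<in> sphere 0 1" using False by (simp add: y_def)
    then have "?f x0 \<le> ?f y" by (rule x0(2))
    then have "?f x0 * (norm x)\<^sup>2 \<le> ?f y * (norm x)\<^sup>2" by (intro mult_right_mono) auto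
    also have "\<dots> = (A *v (norm x *\<^sub>R y)) \<bullet> (norm x *\<^sub>R y)"
      by (simp only: matrix_vector_mult_scaleR inner_scaleR_left inner_scaleR_right power2_eq_square ac_simps)
    finally show ?thesis unfolding x[symmetric] .
  qed simp
  moreover have "?f x0 > 0" using x0(1) by (intro assms) auto
  ultimately show ?thesis by (rule that[rotated])
qed

text \<open>Testing the cell equation for $N_j$ with $N_i$ shows that the term added to the definition of
  the homogenised matrix, which makes the integrand symmetric, vanishes.\<close>

lemma hom_matrix_gram:
  assumes adm: "admissible_coeff \<nu> a" "0 < \<nu>" and cell: "cell_solution a N"
  defines "p \<equiv> \<lambda>i y. axis i 1 + grad UNIV (N i) y"
  shows "hom_matrix a N $ i $ j = (LINT y|lebesgue_on unit_cell. (a y *v p j y) \<bullet> p i y)"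
    and "integrable (lebesgue_on unit_cell) (\<lambda>y. (a y *v p j y) \<bullet> p i y)"
    and "(\<lambda>y. p i y $ k) \<in> L2 unit_cell"
proof -
  let ?Q = "lebesgue_on unit_cell"
  have "unit_cell \<in> lmeasurable"
    by (rule bounded_set_imp_lmeasurable[OF bounded_subset[OF bounded_cbox[of 0 "\<chi> j. 1"]] unit_cell_measurable])
      (auto simp: unit_cell_def mem_box_cart less_imp_le)
  note c_L2 = L2_const[OF this]
  have a_meas: "(\<lambda>y. a y $ i $ j) \<in> borel_measurable ?Q" for i j
    using adm(1) by (intro measurable_restrict_space1) (simp add: admissible_coeff_def)
  have D_L2: "weak_pd UNIV k (N i) \<in> L2 unit_cell" for k i
  proof -
    obtain d where d: "d \<in> L2 unit_cell" "has_weak_pd UNIV k (N i) d"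
      using cell unfolding cell_solution_def H1_per_def by blast
    have "AE y in lebesgue. weak_pd UNIV k (N i) y = d y"
      using weak_pd_AE[OF d(2) open_UNIV] unfolding lebesgue_on_UNIV_eq .
    then have "AE y in ?Q. d y = weak_pd UNIV k (N i) y"
      using unit_cell_measurable by (simp add: AE_restrict_space_iff) (auto elim: eventually_mono)
    from L2_AE_closed[OF d(1) this unit_cell_measurable] show ?thesis .
  qed
  have grad_L2: "(\<lambda>y. grad UNIV (N i) y $ k) \<in> L2 unit_cell" for i k
    using D_L2[of k i] by (simp add: grad_def)
  have axis_L2: "(\<lambda>y. axis i 1 $ k) \<in> L2 unit_cell" for i k :: 3 by (rule c_L2)
  show p_L2: "(\<lambda>y. p i y $ k) \<in> L2 unit_cell" for i k
    unfolding p_def vector_add_component by (intro L2.add_mem axis_L2 grad_L2)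
  have int: "integrable ?Q (\<lambda>y. (a y *v F y) \<bullet> H y)"
    if F: "\<And>k. (\<lambda>y. F y $ k) \<in> L2 unit_cell" and H: "\<And>k. (\<lambda>y. H y $ k) \<in> L2 unit_cell" for F H :: "pt \<Rightarrow> real^3"
  proof -
    have "(\<lambda>y. \<Sum>k\<in>UNIV. a y $ i $ k * F y $ k) \<in> L2 unit_cell" for i
      by (intro L2_sum L2_bounded_mult(1)[OF F a_meas admissible_coeff_bound[OF adm]]) auto
    from L2_integrable_mult[OF this H]
    have "integrable ?Q (\<lambda>y. \<Sum>i\<in>UNIV. (\<Sum>k\<in>UNIV. a y $ i $ k * F y $ k) * H y $ i)"
      by (intro Bochner_Integration.integrable_sum)
    then show ?thesis by (simp add: inner_vec_def matrix_vector_mult_def)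
  qed
  show "integrable ?Q (\<lambda>y. (a y *v p j y) \<bullet> p i y)" by (rule int[OF p_L2 p_L2])
  have "(LINT y|?Q. (a y *v p j y) \<bullet> grad UNIV (N i) y)
      = (LINT y|?Q. (a y *v axis j 1) \<bullet> grad UNIV (N i) y + (a y *v grad UNIV (N j) y) \<bullet> grad UNIV (N i) y)"
    by (simp add: p_def matrix_vector_right_distrib inner_add_left)
  also have "\<dots> = (LINT y|?Q. (a y *v axis j 1) \<bullet> grad UNIV (N i) y) + (LINT y|?Q. (a y *v grad UNIV (N j) y) \<bullet> grad UNIV (N i) y)"
    by (intro Bochner_Integration.integral_add int axis_L2 grad_L2)
  also have "\<dots> = 0"
    using cell unfolding cell_solution_def by simp
  finally have zero: "(LINT y|?Q. (a y *v p j y) \<bullet> grad UNIV (N i) y) = 0" .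
  have "hom_matrix a N $ i $ j = (LINT y|?Q. (a y *v p j y) \<bullet> axis i 1)"
  proof -
    have "a y $ i $ j + (\<Sum>k\<in>UNIV. a y $ i $ k * weak_pd UNIV k (N j) y) = (a y *v p j y) \<bullet> axis i 1" for y
      unfolding p_def matrix_vector_right_distrib inner_add_left matrix_form_axis
      by (simp add: inner_axis matrix_vector_mult_def grad_def)
    then show ?thesis by (simp add: hom_matrix_def)
  qed
  also have "\<dots> = (LINT y|?Q. (a y *v p j y) \<bullet> axis i 1) + (LINT y|?Q. (a y *v p j y) \<bullet> grad UNIV (N i) y)"
    by (simp add: zero)
  also have "\<dots> = (LINT y|?Q. (a y *v p j y) \<bullet> axis i 1 + (a y *v p j y) \<bullet> grad UNIV (N i) y)"
    by (intro Bochner_Integration.integral_add[symmetric] int p_L2 axis_L2 grad_L2)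
  also have "\<dots> = (LINT y|?Q. (a y *v p j y) \<bullet> p i y)"
    by (simp add: p_def inner_add_right)
  finally show "hom_matrix a N $ i $ j = (LINT y|?Q. (a y *v p j y) \<bullet> p i y)" .
qed

text \<open>The form at \<eta> is the integral of a V against V, where V is \<eta> plus the gradient
  of the sum of \<eta>_i N_i; it is at least \<nu> times the integral of |V|^2. If that vanished, a
  periodic function would have the constant gradient -\<eta>, which forces \<eta> = 0.\<close>

lemma hom_matrix_positive:
  assumes adm: "admissible_coeff \<nu> a" "0 < \<nu>" and cell: "cell_solution a N" and \<eta>: "\<eta> \<noteq> 0"
  shows "0 < (hom_matrix a N *v \<eta>) \<bullet> \<eta>"
proof -
  let ?Q = "lebesgue_on unit_cell"
  define p where "p i y = axis i 1 + grad UNIV (N i) y" for i y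
  note gram = hom_matrix_gram[OF adm cell, folded p_def]
  define V where "V y = (\<Sum>i\<in>UNIV. \<eta> $ i *\<^sub>R p i y)" for y
  have V_L2: "(\<lambda>y. V y $ k) \<in> L2 unit_cell" for k
    unfolding V_def sum_component vector_scaleR_component real_scaleR_def
    by (intro L2_sum L2.scale_mem gram(3)) auto
  have V_form: "(a y *v V y) \<bullet> V y = (\<Sum>i\<in>UNIV. \<Sum>j\<in>UNIV. \<eta> $ i * (\<eta> $ j * ((a y *v p j y) \<bullet> p i y)))" for y
  proof -
    have "a y *v V y = (\<Sum>j\<in>UNIV. \<eta> $ j *\<^sub>R (a y *v p j y))"
      unfolding V_def by (simp add: linear_sum[OF matrix_vector_mul_linear] matrix_vector_mult_scaleR)
    then have "(a y *v V y) \<bullet> V y = (\<Sum>i\<in>UNIV. \<eta> $ i * ((\<Sum>j\<in>UNIV. \<eta> $ j *\<^sub>R (a y *v p j y)) \<bullet> p i y))"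
      unfolding V_def[of y] by (simp add: inner_sum_right)
    then show ?thesis by (simp add: inner_sum_left sum_distrib_left)
  qed
  have V_int: "integrable ?Q (\<lambda>y. (a y *v V y) \<bullet> V y)"
    unfolding V_form by (intro Bochner_Integration.integrable_sum integrable_mult_right gram(2))
  have "(hom_matrix a N *v \<eta>) \<bullet> \<eta> = (\<Sum>i\<in>UNIV. \<Sum>j\<in>UNIV. \<eta> $ i * (\<eta> $ j * hom_matrix a N $ i $ j))"
    by (simp add: inner_vec_def matrix_vector_mult_def sum_distrib_left sum_distrib_right ac_simps)
  also have "\<dots> = (LINT y|?Q. (a y *v V y) \<bullet> V y)"
    unfolding V_form using gram(1,2) by simp
  finally have eq: "(hom_matrix a N *v \<eta>) \<bullet> \<eta> = (LINT y|?Q. (a y *v V y) \<bullet> V y)" .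
  have sq_int: "integrable ?Q (\<lambda>y. V y \<bullet> V y)"
    unfolding inner_vec_def using L2_integrable_mult[OF V_L2 V_L2] by simp
  have "\<nu> * (LINT y|?Q. V y \<bullet> V y) = (LINT y|?Q. \<nu> * (V y \<bullet> V y))" by simp
  also have "\<dots> \<le> (LINT y|?Q. (a y *v V y) \<bullet> V y)"
    by (rule integral_mono[OF integrable_mult_right[OF sq_int] V_int])
      (use adm(1) in \<open>simp add: admissible_coeff_def power2_norm_eq_inner\<close>)
  finally have low: "\<nu> * (LINT y|?Q. V y \<bullet> V y) \<le> (hom_matrix a N *v \<eta>) \<bullet> \<eta>" unfolding eq .
  have "(LINT y|?Q. V y \<bullet> V y) \<noteq> 0"
  proof
    assume "(LINT y|?Q. V y \<bullet> V y) = 0"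
    then have V0: "AE y in ?Q. V y = 0"
      using integral_nonneg_eq_0_iff_AE[OF sq_int] by simp
    obtain k where k: "\<eta> $ k \<noteq> 0" using \<eta> by (auto simp: vec_eq_iff)
    let ?u = "\<lambda>y. \<Sum>i\<in>UNIV. \<eta> $ i * N i y" and ?d = "\<lambda>y. \<Sum>i\<in>UNIV. \<eta> $ i * weak_pd UNIV k (N i) y"
    have N: "N i \<in> H1_per" for i using cell by (simp add: cell_solution_def)
    have "has_weak_pd UNIV k (N i) (weak_pd UNIV k (N i))" for i
    proof -
      obtain d where "has_weak_pd UNIV k (N i) d" using N[of i] unfolding H1_per_def by blast
      then show ?thesis by (rule has_weak_pd_weak_pd)
    qed
    then have d: "has_weak_pd UNIV k ?u ?d" by (intro has_weak_pd_sum) auto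
    have u: "periodic ?u" using N by (simp add: H1_per_def periodic_def)
    have "AE y in ?Q. ?d y = - \<eta> $ k"
      using V0
    proof eventually_elim
      case (elim y)
      have "V y $ k = (\<Sum>i\<in>UNIV. \<eta> $ i * axis i 1 $ k) + ?d y"
        by (simp add: V_def p_def grad_def distrib_left sum.distrib)
      also have "(\<Sum>i\<in>UNIV. \<eta> $ i * axis i 1 $ k) = \<eta> $ k"
        by (simp add: axis_def if_distrib cong: if_cong)
      finally show ?case using elim by simp
    qed
    from periodic_weak_pd_const[OF u d this] k show False by simp
  qed
  moreover have "0 \<le> (LINT y|?Q. V y \<bullet> V y)" by simp
  ultimately have "0 < (LINT y|?Q. V y \<bullet> V y)" by linarith
  then have "0 < \<nu> * (LINT y|?Q. V y \<bullet> V y)" using adm(2) by (rule mult_pos_pos[rotated])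
  then show ?thesis using low by linarith
qed

theorem hom_coeff_elliptic:
  assumes adm: "admissible_coeff \<nu> a" "0 < \<nu>" and cell: "cell_solution a N" and "bounded_open \<Omega>"
  obtains lam Lam where "elliptic_coeff \<Omega> (hom_coeff a N) lam Lam"
proof -
  interpret bounded_open \<Omega> by fact
  obtain m where m: "m > 0" "\<And>x. m * (norm x)\<^sup>2 \<le> (hom_matrix a N *v x) \<bullet> x"
    using positive_form_lower_bound[OF hom_matrix_positive[OF adm cell]] by blast
  define L where "L = (\<Sum>i\<in>UNIV. \<Sum>j\<in>UNIV. \<bar>hom_matrix a N $ i $ j\<bar>)"
  have "\<bar>hom_matrix a N $ i $ j\<bar> \<le> L" for i j
  proof -
    have "\<bar>hom_matrix a N $ i $ j\<bar> \<le> (\<Sum>j\<in>UNIV. \<bar>hom_matrix a N $ i $ j\<bar>)"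
      by (rule member_le_sum) auto
    also have "\<dots> \<le> L" unfolding L_def by (rule member_le_sum) (auto intro: sum_nonneg)
    finally show ?thesis .
  qed
  moreover have "hom_matrix a N $ i $ j = hom_matrix a N $ j $ i" for i j
    unfolding hom_matrix_gram(1)[OF adm cell]
    using matrix_form_sym adm(1) by (simp add: admissible_coeff_def)
  ultimately have "elliptic_coeff \<Omega> (hom_coeff a N) m L"
    using m by unfold_locales (auto simp: hom_coeff_def)
  then show ?thesis by (rule that)
qed

subsection \<open>Resolvents\<close>

context bounded_open
begin

lemma grad_norm_nonneg: "0 \<le> grad_norm \<Omega> u"
  by (simp add: grad_norm_def sum_nonneg)

lemma grad_norm_scale:
  assumes "u \<in> H1 \<Omega>"
  shows "grad_norm \<Omega> (\<lambda>x. c * u x) = \<bar>c\<bar> * grad_norm \<Omega> u"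
proof -
  have z: "has_weak_pd \<Omega> i (\<lambda>x. 0) (\<lambda>x. 0)" for i
    using has_weak_pd_smooth[OF smooth_const open_domain, of i 0] by (simp add: pd_const)
  have "L2_norm \<Omega> (weak_pd \<Omega> i (\<lambda>x. c * u x)) = \<bar>c\<bar> * L2_norm \<Omega> (weak_pd \<Omega> i u)" for i
  proof -
    have "has_weak_pd \<Omega> i (\<lambda>x. c * u x) (\<lambda>x. c * weak_pd \<Omega> i u x)"
      using has_weak_pd_comb[OF H1_has_weak_pd[OF assms] z open_domain, of i c] by simp
    from weak_pd_norm_eq[OF this L2.scale_mem[OF weak_pd_L2[OF assms]]] show ?thesis
      by (simp add: L2_norm_scale)
  qed
  then show ?thesis
    by (simp add: grad_norm_def power_mult_distrib sum_distrib_left[symmetric] real_sqrt_mult)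
qed

lemma Hm1_norm_minus_commute: "Hm1_norm \<Omega> (\<lambda>x. u x - v x) = Hm1_norm \<Omega> (\<lambda>x. v x - u x)"
proof -
  have "\<bar>L2_inner \<Omega> (\<lambda>x. u x - v x) \<phi>\<bar> = \<bar>L2_inner \<Omega> (\<lambda>x. v x - u x) \<phi>\<bar>" for \<phi>
  proof -
    have "(\<lambda>x. (u x - v x) * \<phi> x) = (\<lambda>x. - ((v x - u x) * \<phi> x))" by (auto simp: algebra_simps)
    then show ?thesis by (simp add: L2_inner_def)
  qed
  then show ?thesis by (simp add: Hm1_norm_def)
qed

text \<open>Normalising \<open>v\<close> puts it into the set over which the supremum is taken. As a
  supremum of reals it bounds its members only once the range is known to be bounded, which
  Poincare's inequality provides. If the gradient of \<open>v\<close> vanishes, so does its L2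
  norm.\<close>

lemma Hm1_duality:
  assumes C: "\<And>u. u \<in> H10 \<Omega> \<Longrightarrow> L2_norm \<Omega> u \<le> C * grad_norm \<Omega> u" "0 \<le> C"
    and w: "w \<in> L2 \<Omega>" and v: "v \<in> H10 \<Omega>"
  shows "\<bar>L2_inner \<Omega> w v\<bar> \<le> Hm1_norm \<Omega> w * grad_norm \<Omega> v"
proof (cases "grad_norm \<Omega> v = 0")
  case True
  then have "L2_norm \<Omega> v = 0" using C(1)[OF v] L2_norm_nonneg[of \<Omega> v] by simp
  then show ?thesis using L2_cauchy_schwarz[OF w H10_L2[OF v]] True by simp
next
  case False
  define E where "E = grad_norm \<Omega> v"
  have E: "E > 0" using False grad_norm_nonneg[of v] by (simp add: E_def)
  define \<phi> where "\<phi> = (\<lambda>x. (1 / E) * v x)"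
  have \<phi>: "\<phi> \<in> H10 \<Omega>" unfolding \<phi>_def using H10_comb[OF v H10_zero, of "1 / E"] by simp
  have g: "grad_norm \<Omega> \<phi> \<le> 1"
    unfolding \<phi>_def grad_norm_scale[OF H10_H1[OF v]] using E by (simp add: E_def)
  have bdd: "bdd_above ((\<lambda>\<phi>. \<bar>L2_inner \<Omega> w \<phi>\<bar>) ` {\<phi> \<in> H10 \<Omega>. grad_norm \<Omega> \<phi> \<le> 1})"
  proof (rule bdd_aboveI2)
    fix \<psi> assume "\<psi> \<in> {\<phi> \<in> H10 \<Omega>. grad_norm \<Omega> \<phi> \<le> 1}"
    then have \<psi>: "\<psi> \<in> H10 \<Omega>" "grad_norm \<Omega> \<psi> \<le> 1" by auto
    have "L2_norm \<Omega> \<psi> \<le> C" using C(1)[OF \<psi>(1)] mult_left_le[OF \<psi>(2) C(2)] by linarith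
    then have "L2_norm \<Omega> w * L2_norm \<Omega> \<psi> \<le> L2_norm \<Omega> w * C" by (rule mult_left_mono[OF _ L2_norm_nonneg])
    then show "\<bar>L2_inner \<Omega> w \<psi>\<bar> \<le> L2_norm \<Omega> w * C"
      using L2_cauchy_schwarz[OF w H10_L2[OF \<psi>(1)]] by linarith
  qed
  have "\<bar>L2_inner \<Omega> w \<phi>\<bar> \<le> Hm1_norm \<Omega> w"
    unfolding Hm1_norm_def by (rule cSUP_upper[OF _ bdd]) (use \<phi> g in simp)
  moreover have "L2_inner \<Omega> w v = E * L2_inner \<Omega> w \<phi>"
    using E by (simp add: \<phi>_def L2_inner_def)
  ultimately show ?thesis
    using E by (simp add: abs_mult mult.commute flip: E_def)
qed

end

context elliptic_coeff
begin

lemma dirichlet_inv_weak_div: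
  assumes "h \<in> L2 \<Omega>"
  shows "has_weak_div \<Omega> (flux \<Omega> b (dirichlet_inv \<Omega> b h)) (\<lambda>x. - h x)"
  by (rule dirichlet_form_weak_div[OF H10_H1[OF dirichlet_inv_works(1)[OF assms]] assms dirichlet_inv_works(2)[OF assms]])

text \<open>Testing the equation with its own solution. The coefficient enters only through
  \<open>lam\<close>, so the bound is uniform in \<epsilon>.\<close>

lemma dirichlet_inv_bound:
  assumes C: "\<And>u. u \<in> H10 \<Omega> \<Longrightarrow> L2_norm \<Omega> u \<le> C * grad_norm \<Omega> u" "0 \<le> C" and h: "h \<in> L2 \<Omega>"
  shows "L2_norm \<Omega> (dirichlet_inv \<Omega> b h) \<le> C\<^sup>2 / lam * L2_norm \<Omega> h"
proof -
  define u where "u = dirichlet_inv \<Omega> b h"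
  have u: "u \<in> H10 \<Omega>" unfolding u_def by (rule dirichlet_inv_works(1)[OF h])
  define E where "E = grad_norm \<Omega> u"
  have E: "0 \<le> E" by (simp add: E_def grad_norm_nonneg)
  have "lam * E\<^sup>2 \<le> L2_inner \<Omega> h u"
    using dirichlet_form_coercive[OF H10_H1[OF u]] dirichlet_inv_works(2)[OF h u] by (simp add: E_def u_def)
  also have "\<dots> \<le> L2_norm \<Omega> h * L2_norm \<Omega> u"
    using L2_cauchy_schwarz[OF h H10_L2[OF u]] by linarith
  also have "\<dots> \<le> L2_norm \<Omega> h * (C * E)"
    unfolding E_def by (intro mult_left_mono C u L2_norm_nonneg)
  finally have "lam * E * E \<le> L2_norm \<Omega> h * C * E" by (simp add: power2_eq_square mult.assoc)
  then have "lam * E \<le> L2_norm \<Omega> h * C"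
    using E C(2) L2_norm_nonneg[of \<Omega> h] by (cases "E = 0") (auto simp: mult_le_cancel_right)
  then have "E \<le> L2_norm \<Omega> h * C / lam" using lam_pos by (simp add: le_divide_eq mult.commute)
  then have "C * E \<le> C * (L2_norm \<Omega> h * C / lam)" using C(2) by (rule mult_left_mono)
  then show ?thesis
    using C(1)[OF u] unfolding E_def u_def by (simp add: power2_eq_square mult.commute mult.left_commute)
qed

text \<open>\<open>dirichlet_inv\<close> picks a solution separately for each right-hand side, so it
  is homogeneous only up to null sets. This is enough to extend a bound from the unit ball to all of
  L2.\<close>

lemma dirichlet_inv_scale:
  assumes h: "h \<in> L2 \<Omega>"
  shows "L2_norm \<Omega> (\<lambda>x. dirichlet_inv \<Omega> b (\<lambda>x. c * h x) x - c * dirichlet_inv \<Omega> b h x) = 0"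
proof (rule dirichlet_solution_unique)
  have ch: "(\<lambda>x. c * h x) \<in> L2 \<Omega>" by (rule L2.scale_mem[OF h])
  show "dirichlet_inv \<Omega> b (\<lambda>x. c * h x) \<in> H10 \<Omega>" by (rule dirichlet_inv_works(1)[OF ch])
  show "(\<lambda>x. c * dirichlet_inv \<Omega> b h x) \<in> H10 \<Omega>"
    by (rule form.scale_mem[OF dirichlet_inv_works(1)[OF h]])
  fix \<phi> assume \<phi>: "\<phi> \<in> H10 \<Omega>"
  show "dirichlet_form \<Omega> b (dirichlet_inv \<Omega> b (\<lambda>x. c * h x)) \<phi> = dirichlet_form \<Omega> b (\<lambda>x. c * dirichlet_inv \<Omega> b h x) \<phi>"
    using dirichlet_inv_works[OF h] dirichlet_inv_works(2)[OF ch \<phi>] \<phi>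
    by (simp add: form.scale_left L2.scale_left h H10_L2)
qed

lemma dirichlet_inv_of_weak_div:
  assumes u: "u \<in> H10 \<Omega>" and d: "has_weak_div \<Omega> (flux \<Omega> b u) d" "d \<in> L2 \<Omega>"
  shows "L2_norm \<Omega> (\<lambda>x. dirichlet_inv \<Omega> b (\<lambda>x. - d x) x - u x) = 0"
proof (rule dirichlet_solution_unique[OF _ u])
  have h: "(\<lambda>x. - d x) \<in> L2 \<Omega>" using L2.scale_mem[OF d(2), of "-1"] by simp
  show "dirichlet_inv \<Omega> b (\<lambda>x. - d x) \<in> H10 \<Omega>" by (rule dirichlet_inv_works(1)[OF h])
  fix \<phi> assume \<phi>: "\<phi> \<in> H10 \<Omega>"
  show "dirichlet_form \<Omega> b (dirichlet_inv \<Omega> b (\<lambda>x. - d x)) \<phi> = dirichlet_form \<Omega> b u \<phi>"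
    using dirichlet_inv_works(2)[OF h \<phi>] weak_div_dirichlet_form[OF H10_H1[OF u] d \<phi>]
    by (simp add: L2_inner_def)
qed

end

text \<open>\<open>L2_opnorm\<close> is a supremum of reals and acts as an operator norm only
  because both resolvents are bounded. To pass from unit to arbitrary right-hand sides, the
  solutions chosen for the normalised datum are inserted by the triangle inequality; the two scaling
  errors have norm 0.\<close>

lemma resolvent_difference:
  assumes E: "elliptic_coeff \<Omega> b lam Lam" and E': "elliptic_coeff \<Omega> b' lam' Lam'"
    and C: "\<And>u. u \<in> H10 \<Omega> \<Longrightarrow> L2_norm \<Omega> u \<le> C * grad_norm \<Omega> u" "0 \<le> C"
  defines "T \<equiv> L2_opnorm \<Omega> (\<lambda>h. dirichlet_inv \<Omega> b h - dirichlet_inv \<Omega> b' h)"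
  shows "0 \<le> T" "T \<le> C\<^sup>2 / lam + C\<^sup>2 / lam'"
    "\<And>h. h \<in> L2 \<Omega> \<Longrightarrow> L2_norm \<Omega> (\<lambda>x. dirichlet_inv \<Omega> b h x - dirichlet_inv \<Omega> b' h x) \<le> T * L2_norm \<Omega> h"
proof -
  interpret E: elliptic_coeff \<Omega> b lam Lam by fact
  interpret E': elliptic_coeff \<Omega> b' lam' Lam' by fact
  let ?A = "dirichlet_inv \<Omega> b" and ?A' = "dirichlet_inv \<Omega> b'"
  have A: "?A h \<in> L2 \<Omega>" "?A' h \<in> L2 \<Omega>" if "h \<in> L2 \<Omega>" for h
    using E.dirichlet_inv_works(1)[OF that] E'.dirichlet_inv_works(1)[OF that] E.H10_L2 by auto
  have diff: "L2_norm \<Omega> (\<lambda>x. u x - v x) \<le> L2_norm \<Omega> u + L2_norm \<Omega> v" if "u \<in> L2 \<Omega>" "v \<in> L2 \<Omega>" for u v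
    using L2_triangle[OF that(1) L2.scale_mem[OF that(2), of "-1"]] L2_norm_scale[of \<Omega> "-1" v] by simp
  have bound: "L2_norm \<Omega> (\<lambda>x. ?A h x - ?A' h x) \<le> (C\<^sup>2 / lam + C\<^sup>2 / lam') * L2_norm \<Omega> h" if h: "h \<in> L2 \<Omega>" for h
    using diff[OF A[OF h]] E.dirichlet_inv_bound[OF C h] E'.dirichlet_inv_bound[OF C h]
    unfolding distrib_right by linarith
  have c0: "0 \<le> C\<^sup>2 / lam + C\<^sup>2 / lam'" using E.lam_pos E'.lam_pos by simp
  let ?S = "{h \<in> L2 \<Omega>. L2_norm \<Omega> h \<le> 1}"
  have bound1: "L2_norm \<Omega> (?A h - ?A' h) \<le> C\<^sup>2 / lam + C\<^sup>2 / lam'" if "h \<in> ?S" for h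
  proof -
    have "(C\<^sup>2 / lam + C\<^sup>2 / lam') * L2_norm \<Omega> h \<le> C\<^sup>2 / lam + C\<^sup>2 / lam'"
      by (rule mult_left_le[OF _ c0]) (use that in simp)
    then show ?thesis using bound[of h] that by (simp add: fun_diff_def)
  qed
  have bdd: "bdd_above ((\<lambda>h. L2_norm \<Omega> (?A h - ?A' h)) ` ?S)"
    using bound1 by (rule bdd_aboveI2)
  have z: "(\<lambda>x. 0) \<in> ?S" by (simp add: L2.zero_mem E.L2_norm_0)
  have upper: "L2_norm \<Omega> (\<lambda>x. ?A h x - ?A' h x) \<le> T" if "h \<in> ?S" for h
    using cSUP_upper[OF that bdd] unfolding T_def L2_opnorm_def by (simp add: fun_diff_def)
  show "0 \<le> T" using upper[OF z] L2_norm_nonneg order_trans by blast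
  show "T \<le> C\<^sup>2 / lam + C\<^sup>2 / lam'"
    unfolding T_def L2_opnorm_def by (rule cSUP_least) (use z bound1 in auto)
  fix h assume h: "h \<in> L2 \<Omega>"
  show "L2_norm \<Omega> (\<lambda>x. ?A h x - ?A' h x) \<le> T * L2_norm \<Omega> h"
  proof (cases "L2_norm \<Omega> h = 0")
    case True
    then show ?thesis using bound[OF h] by simp
  next
    case False
    define t where "t = L2_norm \<Omega> h"
    have t: "t > 0" using False L2_norm_nonneg[of \<Omega> h] by (simp add: t_def)
    define k where "k = (\<lambda>x. (1 / t) * h x)"
    have k: "k \<in> L2 \<Omega>" unfolding k_def by (rule L2.scale_mem[OF h])
    have "L2_norm \<Omega> k = 1" unfolding k_def L2_norm_scale using t by (simp flip: t_def)
    then have kS: "k \<in> ?S" using k by simp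
    have p: "(\<lambda>x. 1 / t * ?A h x) \<in> L2 \<Omega>" "(\<lambda>x. 1 / t * ?A' h x) \<in> L2 \<Omega>"
      by (intro L2.scale_mem A h)+
    have "L2_norm \<Omega> (\<lambda>x. 1 / t * ?A h x - 1 / t * ?A' h x) \<le>
        L2_norm \<Omega> (\<lambda>x. 1 / t * ?A h x - ?A k x) + L2_norm \<Omega> (\<lambda>x. ?A k x - 1 / t * ?A' h x)"
      unfolding L2_norm_def by (rule L2.triangle_diff[OF p(1) A(1)[OF k] p(2)])
    also have "L2_norm \<Omega> (\<lambda>x. ?A k x - 1 / t * ?A' h x) \<le>
        L2_norm \<Omega> (\<lambda>x. ?A k x - ?A' k x) + L2_norm \<Omega> (\<lambda>x. ?A' k x - 1 / t * ?A' h x)"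
      unfolding L2_norm_def by (rule L2.triangle_diff[OF A(1)[OF k] A(2)[OF k] p(2)])
    also have "L2_norm \<Omega> (\<lambda>x. ?A' k x - 1 / t * ?A' h x) = 0"
      unfolding k_def by (rule E'.dirichlet_inv_scale[OF h])
    also have "L2_norm \<Omega> (\<lambda>x. 1 / t * ?A h x - ?A k x) = 0"
      unfolding L2_norm_minus_commute[of \<Omega> "\<lambda>x. 1 / t * ?A h x"] unfolding k_def by (rule E.dirichlet_inv_scale[OF h])
    finally have "L2_norm \<Omega> (\<lambda>x. 1 / t * ?A h x - 1 / t * ?A' h x) \<le> T"
      using upper[OF kS] by simp
    moreover have "(\<lambda>x. 1 / t * ?A h x - 1 / t * ?A' h x) = (\<lambda>x. 1 / t * (?A h x - ?A' h x))"
      by (simp add: right_diff_distrib)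
    ultimately have "L2_norm \<Omega> (\<lambda>x. ?A h x - ?A' h x) / t \<le> T"
      using L2_norm_scale[of \<Omega> "1 / t" "\<lambda>x. ?A h x - ?A' h x"] t by simp
    then show ?thesis using t by (simp add: divide_le_eq flip: t_def)
  qed
qed

subsection \<open>Comparison of two attractor elements\<close>

text \<open>On a bounded range a higher power is dominated by a lower one, which reduces different
  rates to a common one.\<close>

lemma powr_compare:
  fixes x X :: real
  assumes "0 \<le> x" "x \<le> X" "q \<le> p"
  shows "x powr p \<le> X powr (p - q) * x powr q"
proof -
  have "x powr p = x powr (p - q) * x powr q" by (simp flip: powr_add)
  also have "\<dots> \<le> X powr (p - q) * x powr q" using assms by (intro mult_right_mono powr_mono2) auto
  finally show ?thesis .
qed

lemma Holder_bound_uminus: "Holder_bound \<Omega> \<beta> K (\<lambda>x. u x - v x) \<Longrightarrow> Holder_bound \<Omega> \<beta> K (\<lambda>x. v x - u x)"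
proof -
  assume H: "Holder_bound \<Omega> \<beta> K (\<lambda>x. u x - v x)"
  have "Holder_bound \<Omega> \<beta> 0 (\<lambda>x. 0)" unfolding Holder_bound_def by (intro exI[of _ "\<lambda>x. 0"]) auto
  from Holder_bound_add[OF this H, of "-1"] show ?thesis by simp
qed

text \<open>One constant \<open>C\<close> for all coefficients in \<open>S\<close> and all pairs
  with data bounded by \<open>K\<close>; as a predicate it allows \<open>C\<close> to be chosen for
  each \<open>K\<close> before any attractor is given. The number \<open>x\<close> is any common
  bound for both distances and, up to \<Gamma>, for the resolvent gap, so slack can be stored in
  it.\<close>

definition pair_rate ::
  "pt set \<Rightarrow> coeff set \<Rightarrow> coeff \<Rightarrow> real \<Rightarrow> real \<Rightarrow> real \<Rightarrow> real \<Rightarrow> real \<Rightarrow> real \<Rightarrow> bool" where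
  "pair_rate \<Omega> S b0 \<beta> \<theta> \<Gamma> K X C \<longleftrightarrow> 0 \<le> C \<and> (\<forall>b \<xi>1 \<xi>2 \<eta>1 \<eta>2 p1 p2 q1 q2 x. b \<in> S \<longrightarrow>
     {\<xi>1, \<xi>2, \<eta>1, \<eta>2} \<subseteq> H10 \<Omega> \<longrightarrow> {p1, p2, q1, q2} \<subseteq> {d \<in> L2 \<Omega>. L2_norm \<Omega> d \<le> K} \<longrightarrow>
     has_weak_div \<Omega> (flux \<Omega> b \<xi>1) p1 \<longrightarrow> has_weak_div \<Omega> (flux \<Omega> b \<xi>2) p2 \<longrightarrow>
     has_weak_div \<Omega> (flux \<Omega> b0 \<eta>1) q1 \<longrightarrow> has_weak_div \<Omega> (flux \<Omega> b0 \<eta>2) q2 \<longrightarrow>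
     0 \<le> x \<longrightarrow> x \<le> X \<longrightarrow> L2_norm \<Omega> (\<lambda>x. \<xi>1 x - \<eta>1 x) \<le> x \<longrightarrow> Hm1_norm \<Omega> (\<lambda>x. \<xi>2 x - \<eta>2 x) \<le> x \<longrightarrow>
     L2_opnorm \<Omega> (\<lambda>h. dirichlet_inv \<Omega> b h - dirichlet_inv \<Omega> b0 h) \<le> \<Gamma> * x \<longrightarrow>
     Holder_bound \<Omega> \<beta> (C * x powr \<theta>) (\<lambda>x. \<xi>1 x - \<eta>1 x) \<and>
     Holder_bound \<Omega> \<beta> (C * x powr \<theta>) (\<lambda>x. \<xi>2 x - \<eta>2 x))"

context bounded_open
begin

text \<open>The L2 route gives the exponent 2(\<alpha>-\<beta>)/(2\<alpha>+3), which beats the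
  required one because 2\<alpha>+3 \<le> 2(2+\<alpha>). The surplus is paid by a power of the range
  \<open>X\<close>.\<close>

lemma Holder_rate_L2:
  assumes dom: "smooth_bounded_domain \<Omega>" and \<beta>: "0 \<le> \<beta>" "\<beta> < \<alpha>" and K: "0 < K"
    and A: "0 \<le> A" and X: "0 \<le> X"
  obtains C where "C \<ge> 0" "\<And>w x. w \<in> L2 \<Omega> \<Longrightarrow> Holder_bound \<Omega> \<alpha> K w \<Longrightarrow> 0 \<le> x \<Longrightarrow> x \<le> X \<Longrightarrow>
    L2_norm \<Omega> w \<le> A * x \<Longrightarrow> Holder_bound \<Omega> \<beta> (C * x powr ((\<alpha> - \<beta>) / (2 + \<alpha>))) w"
proof -
  define p where "p = 2 * (\<alpha> - \<beta>) / (2 * \<alpha> + 3)"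
  define \<theta> where "\<theta> = (\<alpha> - \<beta>) / (2 + \<alpha>)"
  have p0: "0 \<le> p" using \<beta> by (simp add: p_def)
  have \<theta>p: "\<theta> \<le> p"
  proof -
    have "\<theta> = 2 * (\<alpha> - \<beta>) / (2 * (2 + \<alpha>))"
      unfolding \<theta>_def by (rule mult_divide_mult_cancel_left[symmetric]) simp
    also have "\<dots> \<le> p" unfolding p_def using \<beta> by (intro divide_left_mono) auto
    finally show ?thesis .
  qed
  obtain C where C: "C \<ge> 0" "\<And>w. w \<in> L2 \<Omega> \<Longrightarrow> Holder_bound \<Omega> \<alpha> K w \<Longrightarrow>
    Holder_bound \<Omega> \<beta> (C * L2_norm \<Omega> w powr p) w"
    unfolding p_def using Holder_small_L2[OF dom \<beta> K] by blast
  show ?thesis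
  proof (rule that[of "C * (A powr p * X powr (p - \<theta>))"])
    show "0 \<le> C * (A powr p * X powr (p - \<theta>))" using C(1) by simp
    fix w x assume w: "w \<in> L2 \<Omega>" "Holder_bound \<Omega> \<alpha> K w" and x: "0 \<le> x" "x \<le> X" "L2_norm \<Omega> w \<le> A * x"
    have "L2_norm \<Omega> w powr p \<le> (A * x) powr p"
      using x p0 by (intro powr_mono2) (auto simp: L2_norm_nonneg)
    also have "\<dots> = A powr p * x powr p" using A x by (simp add: powr_mult)
    also have "\<dots> \<le> A powr p * (X powr (p - \<theta>) * x powr \<theta>)"
      by (intro mult_left_mono powr_compare x \<theta>p) auto
    finally have "C * L2_norm \<Omega> w powr p \<le> C * (A powr p * (X powr (p - \<theta>) * x powr \<theta>))"
      using C(1) by (rule mult_left_mono)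
    then have "C * L2_norm \<Omega> w powr p \<le> C * (A powr p * X powr (p - \<theta>)) * x powr ((\<alpha> - \<beta>) / (2 + \<alpha>))"
      by (simp add: mult.assoc \<theta>_def)
    from Holder_bound_mono[OF C(2)[OF w] this]
    show "Holder_bound \<Omega> \<beta> (C * (A powr p * X powr (p - \<theta>)) * x powr ((\<alpha> - \<beta>) / (2 + \<alpha>))) w" .
  qed
qed

text \<open>Smallness is known for the cube of the gradient norm, so the exponent
  2(\<alpha>-\<beta>)/(2\<alpha>+1) is divided by 3. The required comparison 3(2\<alpha>+1) \<le>
  2(2+\<alpha>) is exactly \<alpha> \<le> 1/4. The 8 is the cube of Hardy's constant 2.\<close>

lemma Holder_rate_grad:
  assumes dom: "smooth_bounded_domain \<Omega>" and \<beta>: "0 \<le> \<beta>" "\<beta> < \<alpha>" "\<alpha> \<le> 1/4" and K: "0 < K"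
    and A: "0 \<le> A" and X: "0 \<le> X"
  obtains C where "C \<ge> 0" "\<And>w x. w \<in> H10 \<Omega> \<Longrightarrow> Holder_bound \<Omega> \<alpha> K w \<Longrightarrow> 0 \<le> x \<Longrightarrow> x \<le> X \<Longrightarrow>
    grad_norm \<Omega> w ^ 3 \<le> A * x \<Longrightarrow> Holder_bound \<Omega> \<beta> (C * x powr ((\<alpha> - \<beta>) / (2 + \<alpha>))) w"
proof -
  define q where "q = 2 * (\<alpha> - \<beta>) / (2 * \<alpha> + 1)"
  define p where "p = q / 3"
  define \<theta> where "\<theta> = (\<alpha> - \<beta>) / (2 + \<alpha>)"
  have p0: "0 \<le> p" using \<beta> by (simp add: p_def q_def)
  have \<theta>p: "\<theta> \<le> p"
  proof -
    have "\<theta> = 2 * (\<alpha> - \<beta>) / (2 * (2 + \<alpha>))"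
      unfolding \<theta>_def by (rule mult_divide_mult_cancel_left[symmetric]) simp
    also have "\<dots> \<le> 2 * (\<alpha> - \<beta>) / ((2 * \<alpha> + 1) * 3)" using \<beta> by (intro divide_left_mono) auto
    also have "\<dots> = p" by (simp add: p_def q_def)
    finally show ?thesis .
  qed
  obtain C where C: "C \<ge> 0" "\<And>w. w \<in> H10 \<Omega> \<Longrightarrow> Holder_bound \<Omega> \<alpha> K w \<Longrightarrow>
    Holder_bound \<Omega> \<beta> (C * (2 * grad_norm \<Omega> w) powr q) w"
    unfolding q_def using Holder_small_H10[OF dom \<beta>(1,2) K] by blast
  show ?thesis
  proof (rule that[of "C * ((8 * A) powr p * X powr (p - \<theta>))"])
    show "0 \<le> C * ((8 * A) powr p * X powr (p - \<theta>))" using C(1) by simp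
    fix w x assume w: "w \<in> H10 \<Omega>" "Holder_bound \<Omega> \<alpha> K w" and x: "0 \<le> x" "x \<le> X" "grad_norm \<Omega> w ^ 3 \<le> A * x"
    define E where "E = 2 * grad_norm \<Omega> w"
    have E: "0 \<le> E" "E ^ 3 \<le> 8 * A * x" using x(3) grad_norm_nonneg[of w] by (auto simp: E_def power_mult_distrib)
    have "E powr q = (E ^ 3) powr p"
    proof (cases "E = 0")
      case False
      then have "E ^ 3 = E powr 3" using E(1) by simp
      then show ?thesis by (simp add: powr_powr p_def)
    qed simp
    also have "\<dots> \<le> (8 * A * x) powr p" using E p0 by (intro powr_mono2) auto
    also have "\<dots> = (8 * A) powr p * x powr p" by (rule powr_mult)
    also have "\<dots> \<le> (8 * A) powr p * (X powr (p - \<theta>) * x powr \<theta>)"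
      by (intro mult_left_mono powr_compare x \<theta>p) auto
    finally have "C * E powr q \<le> C * ((8 * A) powr p * (X powr (p - \<theta>) * x powr \<theta>))"
      using C(1) by (rule mult_left_mono)
    then have "C * E powr q \<le> C * ((8 * A) powr p * X powr (p - \<theta>)) * x powr ((\<alpha> - \<beta>) / (2 + \<alpha>))"
      by (simp add: mult.assoc \<theta>_def)
    from Holder_bound_mono[OF C(2)[OF w, folded E_def] this]
    show "Holder_bound \<Omega> \<beta> (C * ((8 * A) powr p * X powr (p - \<theta>)) * x powr ((\<alpha> - \<beta>) / (2 + \<alpha>))) w" .
  qed
qed

text \<open>Splitting \<xi>2 - \<eta>2 into (u - \<eta>2) + v separates two effects: the first part
  is small in L2 by the resolvent gap, the second belongs to one operator and admits an energy
  estimate. The first components are close in L2 from the start.\<close>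

theorem pair_estimate:
  assumes dom: "smooth_bounded_domain \<Omega>" and \<beta>: "0 \<le> \<beta>" "\<beta> < \<alpha>" "\<alpha> \<le> 1/4"
    and ell: "\<And>b. b \<in> S \<Longrightarrow> elliptic_coeff \<Omega> b lam Lam" "0 < lam" and ell0: "elliptic_coeff \<Omega> b0 lam0 Lam0"
    and reg: "\<And>b u d. b \<in> insert b0 S \<Longrightarrow> u \<in> H10 \<Omega> \<Longrightarrow> d \<in> L2 \<Omega> \<Longrightarrow> has_weak_div \<Omega> (flux \<Omega> b u) d \<Longrightarrow>
      Holder_enorm \<Omega> \<alpha> u \<le> ennreal (R * L2_norm \<Omega> d)" "0 \<le> R"
    and K: "0 \<le> K" and X: "0 \<le> X" and G: "0 \<le> \<Gamma>"
  shows "\<exists>C. pair_rate \<Omega> S b0 \<beta> ((\<alpha> - \<beta>) / (2 + \<alpha>)) \<Gamma> K X C"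
proof -
  let ?\<theta> = "(\<alpha> - \<beta>) / (2 + \<alpha>)"
  obtain CP where CP: "CP > 0" "\<And>u. u \<in> H10 \<Omega> \<Longrightarrow> L2_norm \<Omega> u \<le> CP * grad_norm \<Omega> u"
    using poincare by blast
  \<comment> \<open>The 1 is the margin of \<open>Holder_enorm_imp_bound\<close>; differences of two
    such functions are bounded by \<open>K1 + K1\<close>.\<close>
  define K1 where "K1 = R * K + 1"
  have K1: "K1 > 0" using reg(2) K by (simp add: K1_def add_nonneg_pos)
  \<comment> \<open>Squaring the energy bound and inserting the duality bound gives E^4 \<le>
    (2K/lam)^2 n^2 \<le> A x E.\<close>
  define A where "A = (2 * K / lam)\<^sup>2 * (1 + \<Gamma> * K * CP)"
  have A: "0 \<le> A" using G K CP(1) by (simp add: A_def)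
  obtain Ca where Ca: "Ca \<ge> 0" "\<And>w x. w \<in> L2 \<Omega> \<Longrightarrow> Holder_bound \<Omega> \<alpha> (K1 + K1) w \<Longrightarrow> 0 \<le> x \<Longrightarrow> x \<le> X \<Longrightarrow>
    L2_norm \<Omega> w \<le> 1 * x \<Longrightarrow> Holder_bound \<Omega> \<beta> (Ca * x powr ?\<theta>) w"
    using Holder_rate_L2[OF dom \<beta>(1,2) _ zero_le_one X, of "K1 + K1"] K1 by (metis add_pos_pos)
  obtain Cb where Cb: "Cb \<ge> 0" "\<And>w x. w \<in> L2 \<Omega> \<Longrightarrow> Holder_bound \<Omega> \<alpha> (K1 + K1) w \<Longrightarrow> 0 \<le> x \<Longrightarrow> x \<le> X \<Longrightarrow>
    L2_norm \<Omega> w \<le> (\<Gamma> * K) * x \<Longrightarrow> Holder_bound \<Omega> \<beta> (Cb * x powr ?\<theta>) w"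
    using Holder_rate_L2[OF dom \<beta>(1,2) _ mult_nonneg_nonneg[OF G K] X, of "K1 + K1"] K1 by (metis add_pos_pos)
  obtain Cc where Cc: "Cc \<ge> 0" "\<And>w x. w \<in> H10 \<Omega> \<Longrightarrow> Holder_bound \<Omega> \<alpha> (K1 + K1) w \<Longrightarrow> 0 \<le> x \<Longrightarrow> x \<le> X \<Longrightarrow>
    grad_norm \<Omega> w ^ 3 \<le> A * x \<Longrightarrow> Holder_bound \<Omega> \<beta> (Cc * x powr ?\<theta>) w"
    using Holder_rate_grad[OF dom \<beta> _ A X, of "K1 + K1"] K1 by (metis add_pos_pos)
  have hb: "Holder_bound \<Omega> \<alpha> K1 u"
    if "b \<in> insert b0 S" "u \<in> H10 \<Omega>" "d \<in> L2 \<Omega>" "has_weak_div \<Omega> (flux \<Omega> b u) d" "L2_norm \<Omega> d \<le> K" for b u d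
  proof -
    have "Holder_enorm \<Omega> \<alpha> u \<le> ennreal (R * K)"
      using reg(1)[OF that(1-4)] mult_left_mono[OF that(5) reg(2)] by (meson ennreal_leI order_trans)
    then show ?thesis unfolding K1_def by (rule Holder_enorm_imp_bound) (use reg(2) K \<beta> in auto)
  qed
  have hb_diff: "Holder_bound \<Omega> \<alpha> (K1 + K1) (\<lambda>x. u x - v x)"
    if "Holder_bound \<Omega> \<alpha> K1 u" "Holder_bound \<Omega> \<alpha> K1 v" for u v
    using Holder_bound_add[OF that, of "-1"] by simp
  have c0: "0 \<le> Ca + (Cb + Cc)" using Ca(1) Cb(1) Cc(1) by simp
  have "pair_rate \<Omega> S b0 \<beta> ?\<theta> \<Gamma> K X (Ca + (Cb + Cc))"
    unfolding pair_rate_def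
  proof (intro conjI[OF c0] allI impI)
    fix b \<xi>1 \<xi>2 \<eta>1 \<eta>2 p1 p2 q1 q2 and x :: real
    assume b: "b \<in> S" and H: "{\<xi>1, \<xi>2, \<eta>1, \<eta>2} \<subseteq> H10 \<Omega>"
      and LK: "{p1, p2, q1, q2} \<subseteq> {d \<in> L2 \<Omega>. L2_norm \<Omega> d \<le> K}"
      and div: "has_weak_div \<Omega> (flux \<Omega> b \<xi>1) p1" "has_weak_div \<Omega> (flux \<Omega> b \<xi>2) p2"
        "has_weak_div \<Omega> (flux \<Omega> b0 \<eta>1) q1" "has_weak_div \<Omega> (flux \<Omega> b0 \<eta>2) q2"
      and x: "0 \<le> x" "x \<le> X"
      and close: "L2_norm \<Omega> (\<lambda>x. \<xi>1 x - \<eta>1 x) \<le> x" "Hm1_norm \<Omega> (\<lambda>x. \<xi>2 x - \<eta>2 x) \<le> x"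
        "L2_opnorm \<Omega> (\<lambda>h. dirichlet_inv \<Omega> b h - dirichlet_inv \<Omega> b0 h) \<le> \<Gamma> * x"
    have L: "{p1, p2, q1, q2} \<subseteq> L2 \<Omega>" using LK by auto
    have nK: "L2_norm \<Omega> d \<le> K" if "d \<in> {p1, p2, q1, q2}" for d using LK that by auto
    interpret E: elliptic_coeff \<Omega> b lam Lam by (rule ell(1)[OF b])
    interpret E0: elliptic_coeff \<Omega> b0 lam0 Lam0 by (rule ell0)
    have HL: "\<xi>1 \<in> L2 \<Omega>" "\<xi>2 \<in> L2 \<Omega>" "\<eta>1 \<in> L2 \<Omega>" "\<eta>2 \<in> L2 \<Omega>" using H H10_L2 by auto
    have mono: "Holder_bound \<Omega> \<beta> ((Ca + (Cb + Cc)) * x powr ?\<theta>) w"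
      if "Holder_bound \<Omega> \<beta> (c * x powr ?\<theta>) w" "c \<le> Ca + (Cb + Cc)" for c w
      using Holder_bound_mono[OF that(1) mult_right_mono[OF that(2) powr_ge_zero]] .
    have h\<xi>1: "Holder_bound \<Omega> \<alpha> K1 \<xi>1" by (rule hb[OF _ _ _ div(1)]) (use b H L nK in auto)
    have h\<xi>2: "Holder_bound \<Omega> \<alpha> K1 \<xi>2" by (rule hb[OF _ _ _ div(2)]) (use b H L nK in auto)
    have h\<eta>1: "Holder_bound \<Omega> \<alpha> K1 \<eta>1" by (rule hb[OF _ _ _ div(3)]) (use b H L nK in auto)
    have h\<eta>2: "Holder_bound \<Omega> \<alpha> K1 \<eta>2" by (rule hb[OF _ _ _ div(4)]) (use b H L nK in auto)
    have one: "Holder_bound \<Omega> \<beta> (Ca * x powr ?\<theta>) (\<lambda>x. \<xi>1 x - \<eta>1 x)"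
      by (rule Ca(2)[OF L2.diff_mem[OF HL(1,3)] hb_diff[OF h\<xi>1 h\<eta>1] x]) (use close(1) in simp)
    have h: "(\<lambda>x. - q2 x) \<in> L2 \<Omega>" using L2.scale_mem[of q2 \<Omega> "-1"] L by simp
    have hn: "L2_norm \<Omega> (\<lambda>x. - q2 x) \<le> K" using L2_norm_scale[of \<Omega> "-1" q2] nK[of q2] by simp
    \<comment> \<open>\<open>u\<close> solves the oscillating problem with the data of \<eta>2; its
      homogenised counterpart \<open>u0\<close> is \<eta>2 up to a null set.\<close>
    define u where "u = dirichlet_inv \<Omega> b (\<lambda>x. - q2 x)"
    define u0 where "u0 = dirichlet_inv \<Omega> b0 (\<lambda>x. - q2 x)"
    have u: "u \<in> H10 \<Omega>" unfolding u_def by (rule E.dirichlet_inv_works(1)[OF h])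
    have u0: "u0 \<in> H10 \<Omega>" unfolding u0_def by (rule E0.dirichlet_inv_works(1)[OF h])
    have u_div: "has_weak_div \<Omega> (flux \<Omega> b u) q2"
      using E.dirichlet_inv_weak_div[OF h] by (simp add: u_def)
    have hu: "Holder_bound \<Omega> \<alpha> K1 u" by (rule hb[OF _ u _ u_div]) (use b L nK in auto)
    have z: "L2_norm \<Omega> (\<lambda>x. u x - \<eta>2 x) \<le> \<Gamma> * K * x"
    proof -
      have "L2_norm \<Omega> (\<lambda>x. u x - \<eta>2 x) \<le> L2_norm \<Omega> (\<lambda>x. u x - u0 x) + L2_norm \<Omega> (\<lambda>x. u0 x - \<eta>2 x)"
        unfolding L2_norm_def by (rule L2.triangle_diff[OF H10_L2[OF u] H10_L2[OF u0] HL(4)])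
      also have "L2_norm \<Omega> (\<lambda>x. u0 x - \<eta>2 x) = 0"
        unfolding u0_def by (rule E0.dirichlet_inv_of_weak_div[OF _ div(4)]) (use H L in auto)
      also have "L2_norm \<Omega> (\<lambda>x. u x - u0 x) \<le>
          L2_opnorm \<Omega> (\<lambda>h. dirichlet_inv \<Omega> b h - dirichlet_inv \<Omega> b0 h) * L2_norm \<Omega> (\<lambda>x. - q2 x)"
        unfolding u_def u0_def
        by (rule resolvent_difference(3)[OF E.elliptic_coeff_axioms E0.elliptic_coeff_axioms CP(2) less_imp_le[OF CP(1)] h])
      also have "\<dots> \<le> (\<Gamma> * x) * K"
        using close(3) hn G x(1) by (intro mult_mono) (auto simp: L2_norm_nonneg)
      finally show ?thesis by (simp add: ac_simps)
    qed
    have two_b: "Holder_bound \<Omega> \<beta> (Cb * x powr ?\<theta>) (\<lambda>x. u x - \<eta>2 x)"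
      by (rule Cb(2)[OF L2.diff_mem[OF H10_L2[OF u] HL(4)] hb_diff[OF hu h\<eta>2] x z])
    define v where "v = (\<lambda>x. \<xi>2 x - u x)"
    have v: "v \<in> H10 \<Omega>" unfolding v_def using H u by (intro H10_diff) auto
    define E where "E = grad_norm \<Omega> v"
    define n where "n = L2_norm \<Omega> v"
    have E0: "0 \<le> E" "0 \<le> n" by (auto simp: E_def n_def grad_norm_nonneg L2_norm_nonneg)
    \<comment> \<open>The divergences belonging to \<xi>2 and to \<open>u\<close> both have L2 norm
      at most \<open>K\<close>, hence the factor 2K.\<close>
    have energy: "lam * E\<^sup>2 \<le> 2 * K * n"
    proof -
      have "lam * E\<^sup>2 \<le> dirichlet_form \<Omega> b v v"
        unfolding E_def by (rule E.dirichlet_form_coercive[OF H10_H1[OF v]])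
      also have "\<dots> = dirichlet_form \<Omega> b \<xi>2 v - dirichlet_form \<Omega> b u v"
        using E.form.diff_left[of \<xi>2 u v] H u v by (simp add: v_def)
      also have "\<dots> = L2_inner \<Omega> q2 v - L2_inner \<Omega> p2 v"
        using E.weak_div_dirichlet_form[OF H10_H1 div(2) _ v] E.weak_div_dirichlet_form[OF H10_H1[OF u] u_div _ v] H L
        by simp
      also have "\<dots> \<le> L2_norm \<Omega> q2 * n + L2_norm \<Omega> p2 * n"
        using L2_cauchy_schwarz[of q2 \<Omega> v] L2_cauchy_schwarz[of p2 \<Omega> v] L H10_L2[OF v]
        by (simp add: n_def)
      also have "\<dots> \<le> K * n + K * n"
        using nK[of q2] nK[of p2] E0 by (intro add_mono mult_right_mono) auto
      finally show ?thesis by simp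
    qed
    \<comment> \<open>With \<open>v\<close> itself as test function, the negative-norm distance of
      \<xi>2 and \<eta>2 pairs with the gradient of \<open>v\<close>, while the L2 error of the
      corrector costs a Poincare constant.\<close>
    have duality: "n\<^sup>2 \<le> (1 + \<Gamma> * K * CP) * x * E"
    proof -
      have d: "(\<lambda>x. \<xi>2 x - \<eta>2 x) \<in> L2 \<Omega>" "(\<lambda>x. u x - \<eta>2 x) \<in> L2 \<Omega>"
        using HL H10_L2[OF u] by (auto intro: L2.diff_mem)
      have "n\<^sup>2 = L2_inner \<Omega> (\<lambda>x. (\<xi>2 x - \<eta>2 x) - (u x - \<eta>2 x)) v"
        by (simp add: n_def L2_norm_power2 v_def)
      also have "\<dots> = L2_inner \<Omega> (\<lambda>x. \<xi>2 x - \<eta>2 x) v - L2_inner \<Omega> (\<lambda>x. u x - \<eta>2 x) v"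
        by (rule L2.diff_left[OF d H10_L2[OF v]])
      also have "\<dots> \<le> \<bar>L2_inner \<Omega> (\<lambda>x. \<xi>2 x - \<eta>2 x) v\<bar> + \<bar>L2_inner \<Omega> (\<lambda>x. u x - \<eta>2 x) v\<bar>"
        by linarith
      also have "\<bar>L2_inner \<Omega> (\<lambda>x. \<xi>2 x - \<eta>2 x) v\<bar> \<le> x * E"
        using Hm1_duality[OF CP(2) less_imp_le[OF CP(1)] d(1) v] mult_right_mono[OF close(2) E0(1)]
        unfolding E_def by linarith
      also have "\<bar>L2_inner \<Omega> (\<lambda>x. u x - \<eta>2 x) v\<bar> \<le> (\<Gamma> * K * x) * (CP * E)"
      proof -
        have "\<bar>L2_inner \<Omega> (\<lambda>x. u x - \<eta>2 x) v\<bar> \<le> L2_norm \<Omega> (\<lambda>x. u x - \<eta>2 x) * L2_norm \<Omega> v"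
          by (rule L2_cauchy_schwarz[OF d(2) H10_L2[OF v]])
        also have "\<dots> \<le> (\<Gamma> * K * x) * (CP * E)"
          unfolding E_def using CP(2)[OF v] G K x by (intro mult_mono z) (auto simp: L2_norm_nonneg)
        finally show ?thesis .
      qed
      finally show ?thesis by (simp add: algebra_simps)
    qed
    \<comment> \<open>One factor E is cancelled from E^4 \<le> A x E, so E = 0 is a case of its
      own.\<close>
    have cube: "E ^ 3 \<le> A * x"
    proof (cases "E = 0")
      case True
      then show ?thesis using A x by simp
    next
      case False
      then have Ep: "E > 0" using E0 by simp
      have "E\<^sup>2 \<le> 2 * K / lam * n" using energy ell(2) by (simp add: field_simps)
      then have "(E\<^sup>2)\<^sup>2 \<le> (2 * K / lam * n)\<^sup>2" by (intro power_mono) auto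
      also have "\<dots> = (2 * K / lam)\<^sup>2 * n\<^sup>2" by (rule power_mult_distrib)
      also have "\<dots> \<le> (2 * K / lam)\<^sup>2 * ((1 + \<Gamma> * K * CP) * x * E)"
        by (intro mult_left_mono duality) auto
      also have "\<dots> = A * x * E" by (simp add: A_def ac_simps)
      also have "(E\<^sup>2)\<^sup>2 = E ^ 3 * E" by (simp add: power2_eq_square power3_eq_cube)
      finally show ?thesis using Ep by (simp add: mult_le_cancel_right)
    qed
    have two_c: "Holder_bound \<Omega> \<beta> (Cc * x powr ?\<theta>) v"
      by (rule Cc(2)[OF v _ x cube[unfolded E_def]]) (unfold v_def, rule hb_diff[OF h\<xi>2 hu])
    have two: "Holder_bound \<Omega> \<beta> ((Cb + Cc) * x powr ?\<theta>) (\<lambda>x. \<xi>2 x - \<eta>2 x)"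
      using Holder_bound_add[OF two_b two_c, of 1] by (simp add: v_def distrib_right)
    show "Holder_bound \<Omega> \<beta> ((Ca + (Cb + Cc)) * x powr ?\<theta>) (\<lambda>x. \<xi>1 x - \<eta>1 x) \<and>
        Holder_bound \<Omega> \<beta> ((Ca + (Cb + Cc)) * x powr ?\<theta>) (\<lambda>x. \<xi>2 x - \<eta>2 x)"
      using mono[OF one] mono[OF two] Ca(1) Cb(1) Cc(1) by simp
  qed
  then show ?thesis by (rule exI)
qed

end

subsection \<open>The convergence rate of the attractors\<close>

text \<open>The infimum in the distance need not be attained, so elements are compared at distance r
  + t with a slack t > 0, and the resulting bounds \<open>f t\<close> are let tend to
  \<open>L\<close>.\<close>

lemma hdist_transfer:
  assumes close: "hdist (\<lambda>\<zeta>. ennreal (e \<zeta>)) A B \<le> ennreal r" "0 \<le> r"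
    and est: "\<And>a b t. a \<in> A \<Longrightarrow> b \<in> B \<Longrightarrow> 0 < t \<Longrightarrow> t \<le> 1 \<Longrightarrow> e (a - b) \<le> r + t \<Longrightarrow> nrm (a - b) \<le> ennreal (f t)"
    and lim: "(f \<longlongrightarrow> L) (at_right (0::real))"
  shows "hdist nrm A B \<le> ennreal L"
  unfolding hdist_def
proof (rule SUP_least)
  fix a assume a: "a \<in> A"
  have le: "(INF b\<in>B. nrm (a - b)) \<le> ennreal (f t)" if t: "0 < t" "t \<le> 1" for t
  proof -
    have "(INF b\<in>B. ennreal (e (a - b))) \<le> hdist (\<lambda>\<zeta>. ennreal (e \<zeta>)) A B"
      unfolding hdist_def using a by (rule SUP_upper)
    also have "\<dots> \<le> ennreal r" by (rule close(1))
    also have "\<dots> < ennreal (r + t)" using close(2) t by (intro ennreal_lessI) auto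
    finally obtain b where b: "b \<in> B" "ennreal (e (a - b)) < ennreal (r + t)"
      unfolding INF_less_iff by blast
    have "e (a - b) \<le> r + t"
    \<comment> \<open>\<open>ennreal\<close> sends negative numbers to 0, so the comparison of reals
      can be read off only for a nonnegative value.\<close>
    proof (cases "e (a - b) < 0")
      case False
      then show ?thesis using b(2) by (simp add: ennreal_less_iff)
    qed (use close(2) t in simp)
    from est[OF a b(1) t this] INF_lower[OF b(1), of "\<lambda>b. nrm (a - b)"]
    show ?thesis by (rule order_trans[rotated])
  qed
  show "(INF b\<in>B. nrm (a - b)) \<le> ennreal L"
  proof (rule tendsto_lowerbound[OF tendsto_ennrealI[OF lim]])
    have "\<forall>\<^sub>F t in at_right (0::real). t \<in> {0<..<1}" by (rule eventually_at_right_real) simp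
    then show "\<forall>\<^sub>F t in at_right 0. (INF b\<in>B. nrm (a - b)) \<le> ennreal (f t)"
      by eventually_elim (auto intro: le)
  qed simp
qed

lemma ennreal_add3_leD:
  fixes A B C m :: ennreal
  assumes "A + B + C \<le> m"
  shows "A \<le> m" "B \<le> m"
proof -
  have "A \<le> A + B + C" "B \<le> A + B + C" by (simp_all add: add.assoc add_increasing2 add_increasing)
  with assms show "A \<le> m" "B \<le> m" by (blast intro: order_trans)+
qed

text \<open>The hypothesis bounds p + g in H10; Poincare's inequality converts this into an L2 bound
  for \<open>p\<close> at the cost of the norm of \<open>g\<close>. Finiteness of the extended norms
  also yields the memberships. A common bound for \<open>p\<close> and \<open>q\<close> fits
  \<open>pair_rate\<close>.\<close>

lemma (in bounded_open) attractor_data_bound: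
  assumes CP: "\<And>u. u \<in> H10 \<Omega> \<Longrightarrow> L2_norm \<Omega> u \<le> CP * grad_norm \<Omega> u" "0 \<le> CP"
    and g: "g \<in> L2 \<Omega>" and m: "0 \<le> m"
    and le: "H10_enorm \<Omega> (\<lambda>x. p x + g x) + L2_enorm \<Omega> q + c \<le> ennreal m"
  shows "p \<in> L2 \<Omega>" "q \<in> L2 \<Omega>" "L2_norm \<Omega> p \<le> CP * m + L2_norm \<Omega> g + m" "L2_norm \<Omega> q \<le> CP * m + L2_norm \<Omega> g + m"
proof -
  note le' = ennreal_add3_leD[OF le]
  have pg: "(\<lambda>x. p x + g x) \<in> H10 \<Omega>" "grad_norm \<Omega> (\<lambda>x. p x + g x) \<le> m"
    using le'(1) m unfolding H10_enorm_def by (auto split: if_splits simp: ennreal_le_iff top_unique)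
  have q: "q \<in> L2 \<Omega>" "L2_norm \<Omega> q \<le> m"
    using le'(2) m unfolding L2_enorm_def by (auto split: if_splits simp: ennreal_le_iff top_unique)
  show "q \<in> L2 \<Omega>" by (rule q)
  have n: "0 \<le> CP * m" "0 \<le> L2_norm \<Omega> g" using CP m by (auto simp: L2_norm_nonneg)
  then show "L2_norm \<Omega> q \<le> CP * m + L2_norm \<Omega> g + m" using q(2) by linarith
  have p_eq: "(\<lambda>x. (p x + g x) + (-1) * g x) = p" by simp
  have mg: "(\<lambda>x. (-1) * g x) \<in> L2 \<Omega>" by (rule L2.scale_mem[OF g])
  show "p \<in> L2 \<Omega>" using L2.add_mem[OF H10_L2[OF pg(1)] mg] unfolding p_eq .
  have "L2_norm \<Omega> p \<le> L2_norm \<Omega> (\<lambda>x. p x + g x) + L2_norm \<Omega> g"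
    using L2_triangle[OF H10_L2[OF pg(1)] mg] L2_norm_scale[of \<Omega> "-1" g] unfolding p_eq by simp
  also have "L2_norm \<Omega> (\<lambda>x. p x + g x) \<le> CP * m"
    using CP(1)[OF pg(1)] mult_left_mono[OF pg(2) CP(2)] by linarith
  finally show "L2_norm \<Omega> p \<le> CP * m + L2_norm \<Omega> g + m" using m by linarith
qed

lemma energy_m1_norm_components:
  "L2_norm \<Omega> (\<lambda>x. fst \<xi> x - fst \<eta> x) \<le> energy_m1_norm \<Omega> (\<xi> - \<eta>)"
  "Hm1_norm \<Omega> (\<lambda>x. snd \<xi> x - snd \<eta> x) \<le> energy_m1_norm \<Omega> (\<xi> - \<eta>)"
  unfolding energy_m1_norm_def fst_diff snd_diff fun_diff_def by (rule real_le_rsqrt, simp)+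

lemma Holder2_enorm_le:
  assumes "Holder_bound \<Omega> \<beta> K (\<lambda>x. fst \<xi> x - fst \<eta> x)" "Holder_bound \<Omega> \<beta> K (\<lambda>x. snd \<xi> x - snd \<eta> x)" "0 \<le> K"
  shows "Holder2_enorm \<Omega> \<beta> (\<xi> - \<eta>) \<le> ennreal (4 * K)"
proof -
  have "Holder2_enorm \<Omega> \<beta> (\<xi> - \<eta>) \<le> ennreal (2 * K) + ennreal (2 * K)"
    unfolding Holder2_enorm_def fst_diff snd_diff fun_diff_def
    by (intro add_mono Holder_bound_imp_enorm assms)
  also have "\<dots> = ennreal (4 * K)" using assms(3) by (simp flip: ennreal_plus)
  finally show ?thesis .
qed

theorem corollary6p1:
  fixes \<Omega> :: "(real^3) set" and \<nu> :: real
  assumes "smooth_bounded_domain \<Omega>" and "0 < \<nu>"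
  shows "\<exists>\<alpha>0>0. \<forall>\<alpha> \<beta> \<gamma> a N f K1 K2 K3 M0 m0 \<sigma> \<kappa> D.
    0 < \<alpha> \<and> \<alpha> \<le> \<alpha>0 \<and> 0 \<le> \<beta> \<and> \<beta> < \<alpha> \<and> 0 < \<gamma> \<and>
    admissible_coeff \<nu> a \<and> cell_solution a N \<and>
    admissible_nonlinearity f K1 K2 K3 \<and>
    Holder_regularity \<Omega> a N \<alpha> \<and>
    mono_on {0..} M0 \<and> (\<forall>s\<ge>0. 0 < M0 s) \<and> 0 < m0 \<and> 0 < \<sigma> \<and> 0 < \<kappa> \<and> \<kappa> < 1 \<and> 0 \<le> D
    \<longrightarrow>
    (\<exists>M :: real \<Rightarrow> real. mono_on {0..} M \<and>
      (\<forall>g \<in> L2 \<Omega>. \<forall>(\<M>\<epsilon> :: real \<Rightarrow> state set) (\<M>0 :: state set).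
        (\<forall>\<epsilon>>0. \<M>\<epsilon> \<epsilon> \<subseteq> H10 \<Omega> \<times> H10 \<Omega> \<and>
           exponential_attractor \<Omega> (semiflow \<Omega> \<gamma> (osc_coeff a \<epsilon>) f g) (\<M>\<epsilon> \<epsilon>)) \<and>
        \<M>0 \<subseteq> H10 \<Omega> \<times> H10 \<Omega> \<and>
        exponential_attractor \<Omega> (semiflow \<Omega> \<gamma> (hom_coeff a N) f g) \<M>0 \<and>
        (\<forall>\<epsilon>>0. \<forall>\<xi> \<in> \<M>\<epsilon> \<epsilon>. \<exists>p q.
           has_weak_div \<Omega> (flux \<Omega> (osc_coeff a \<epsilon>) (fst \<xi>)) p \<and>
           has_weak_div \<Omega> (flux \<Omega> (osc_coeff a \<epsilon>) (snd \<xi>)) q \<and>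
           H10_enorm \<Omega> (\<lambda>x. p x + g x) + L2_enorm \<Omega> q + Holder2_enorm \<Omega> \<alpha> \<xi>
             \<le> ennreal (M0 (L2_norm \<Omega> g))) \<and>
        (\<forall>\<xi> \<in> \<M>0. \<exists>p q.
           has_weak_div \<Omega> (flux \<Omega> (hom_coeff a N) (fst \<xi>)) p \<and>
           has_weak_div \<Omega> (flux \<Omega> (hom_coeff a N) (snd \<xi>)) q \<and>
           H10_enorm \<Omega> (\<lambda>x. p x + g x) + L2_enorm \<Omega> q + H22_enorm \<Omega> \<xi>
             \<le> ennreal (M0 (L2_norm \<Omega> g))) \<and>
        (\<forall>\<epsilon>>0. \<forall>B t. energy_bounded \<Omega> B \<and> 0 \<le> t \<longrightarrow>
           energy_hdist \<Omega> (semiflow \<Omega> \<gamma> (osc_coeff a \<epsilon>) f g t ` B) (\<M>\<epsilon> \<epsilon>) +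
           energy_hdist \<Omega> (semiflow \<Omega> \<gamma> (hom_coeff a N) f g t ` B) \<M>0
             \<le> ennreal (M0 (energy_set_norm \<Omega> B) * exp (- \<sigma> * t))) \<and>
        (\<forall>\<epsilon>>0. fractal_dim \<Omega> (\<M>\<epsilon> \<epsilon>) + fractal_dim \<Omega> \<M>0 \<le> ereal D) \<and>
        (\<forall>\<epsilon>>0. sym_hdist (\<lambda>\<zeta>. ennreal (energy_m1_norm \<Omega> \<zeta>)) (\<M>\<epsilon> \<epsilon>) \<M>0
             \<le> ennreal (m0 * resolvent_gap \<Omega> a N \<epsilon> powr \<kappa>))
        \<longrightarrow>
        (\<forall>\<epsilon>>0. sym_hdist (Holder2_enorm \<Omega> \<beta>) (\<M>\<epsilon> \<epsilon>) \<M>0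
             \<le> ennreal (M (L2_norm \<Omega> g) *
                 resolvent_gap \<Omega> a N \<epsilon> powr ((\<alpha> - \<beta>) / (2 + \<alpha>) * \<kappa>)))))"
\<comment> \<open>The threshold of \<open>Holder_rate_grad\<close>; it depends neither on \<Omega>
  nor on \<nu>.\<close>
proof (rule exI[of _ "1/4"], intro conjI allI impI, goal_cases)
  case 1
  show ?case by simp
next
  case (2 \<alpha> \<beta> \<gamma> a N f K1 K2 K3 M0 m0 \<sigma> \<kappa> D)
  then have \<alpha>: "0 \<le> \<beta>" "\<beta> < \<alpha>" "\<alpha> \<le> 1/4" and adm: "admissible_coeff \<nu> a" and cell: "cell_solution a N"
    and hol: "Holder_regularity \<Omega> a N \<alpha>" and M0: "mono_on {0..} M0" "\<And>s. 0 \<le> s \<Longrightarrow> 0 < M0 s"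
    and m0: "0 < m0" and \<kappa>: "0 < \<kappa>" "\<kappa> < 1"
    by auto
  interpret bounded_open \<Omega>
    using assms(1) by unfold_locales (auto simp: smooth_bounded_domain_def)
  have ell: "elliptic_coeff \<Omega> (osc_coeff a \<epsilon>) \<nu> (inverse \<nu>)" for \<epsilon>
    by (rule osc_coeff_elliptic[OF adm assms(2) bounded_open_axioms])
  obtain lam0 Lam0 where ell0: "elliptic_coeff \<Omega> (hom_coeff a N) lam0 Lam0"
    using hom_coeff_elliptic[OF adm assms(2) cell bounded_open_axioms] by blast
  interpret E0: elliptic_coeff \<Omega> "hom_coeff a N" lam0 Lam0 by (rule ell0)
  obtain CP where CP: "CP > 0" "\<And>u. u \<in> H10 \<Omega> \<Longrightarrow> L2_norm \<Omega> u \<le> CP * grad_norm \<Omega> u"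
    using poincare by blast
  define S where "S = osc_coeff a ` {0<..}"
  obtain R0 where R0: "\<And>b u d. b \<in> insert (hom_coeff a N) S \<Longrightarrow> u \<in> H10 \<Omega> \<Longrightarrow> d \<in> L2 \<Omega> \<Longrightarrow>
      has_weak_div \<Omega> (flux \<Omega> b u) d \<Longrightarrow> Holder_enorm \<Omega> \<alpha> u \<le> ennreal (R0 * L2_norm \<Omega> d)"
    using hol unfolding Holder_regularity_def S_def by blast
  \<comment> \<open>The constant in \<open>Holder_regularity\<close> carries no sign, so its
    positive part is taken.\<close>
  have reg: "Holder_enorm \<Omega> \<alpha> u \<le> ennreal (max R0 0 * L2_norm \<Omega> d)"
    if "b \<in> insert (hom_coeff a N) S" "u \<in> H10 \<Omega>" "d \<in> L2 \<Omega>" "has_weak_div \<Omega> (flux \<Omega> b u) d" for b u d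
  proof -
    have "ennreal (R0 * L2_norm \<Omega> d) \<le> ennreal (max R0 0 * L2_norm \<Omega> d)"
      by (intro ennreal_leI mult_right_mono L2_norm_nonneg) simp
    with R0[OF that] show ?thesis by (rule order_trans)
  qed
  define \<theta> where "\<theta> = (\<alpha> - \<beta>) / (2 + \<alpha>)"
  have \<theta>: "\<theta> > 0" using \<alpha> by (simp add: \<theta>_def)
  \<comment> \<open>A bound for the resolvent gaps that is uniform in \<epsilon>.\<close>
  define X0 where "X0 = CP\<^sup>2 / \<nu> + CP\<^sup>2 / lam0"
  have X0: "0 \<le> X0" using assms(2) E0.lam_pos by (simp add: X0_def)
  have gap: "0 \<le> resolvent_gap \<Omega> a N \<epsilon>" "resolvent_gap \<Omega> a N \<epsilon> \<le> X0" for \<epsilon>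
    unfolding resolvent_gap_def X0_def
    using resolvent_difference(1,2)[OF ell ell0 CP(2) less_imp_le[OF CP(1)]] by auto
  \<comment> \<open>Since \<kappa> < 1 and the gap is at most \<open>X0\<close>, the gap is at most
    \<Gamma> times its own power \<kappa>, the quantity that controls the distance of the
    attractors.\<close>
  define \<Gamma> where "\<Gamma> = X0 powr (1 - \<kappa>)"
  \<comment> \<open>The range of the comparison parameter \<open>(m0 + 1) * G + t\<close> for t
    \<le> 1.\<close>
  define X where "X = (m0 + 1) * X0 powr \<kappa> + 1"
  have X: "0 \<le> X" using m0 by (simp add: X_def)
  have \<Gamma>: "0 \<le> \<Gamma>" by (simp add: \<Gamma>_def)
  have ellS: "elliptic_coeff \<Omega> b \<nu> (inverse \<nu>)" if "b \<in> S" for b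
    using that ell by (auto simp: S_def)
  have "\<exists>C. pair_rate \<Omega> S (hom_coeff a N) \<beta> \<theta> \<Gamma> (real n) X C" for n :: nat
    unfolding \<theta>_def
    by (rule pair_estimate[OF assms(1) \<alpha> ellS assms(2) ell0 reg _ _ X \<Gamma>]) simp_all
  then obtain Cn where Cn: "\<And>n::nat. pair_rate \<Omega> S (hom_coeff a N) \<beta> \<theta> \<Gamma> (real n) X (Cn n)" by metis
  have Cn0: "0 \<le> Cn n" for n using Cn[of n] by (simp add: pair_rate_def)
  \<comment> \<open>The bound of \<open>attractor_data_bound\<close>, as a function of the norm of
    \<open>g\<close>.\<close>
  define Kf where "Kf s = CP * M0 s + s + M0 s" for s
  \<comment> \<open>The constants \<open>Cn n\<close> are chosen independently and need not increase
    with n; their partial sums do. The 4 comes from \<open>Holder2_enorm_le\<close>.\<close>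
  define M where "M s = 4 * (\<Sum>k\<le>nat \<lceil>Kf s\<rceil>. Cn k) * (m0 + 1) powr \<theta>" for s
  show ?case
  proof (intro exI[of _ M] conjI ballI allI impI, goal_cases)
    case 1
    show ?case
    proof (rule mono_onI)
      fix r s :: real assume rs: "r \<in> {0..}" "s \<in> {0..}" "r \<le> s"
      have "M0 r \<le> M0 s" using M0(1) rs by (auto simp: mono_on_def)
      then have "Kf r \<le> Kf s" unfolding Kf_def using CP(1) rs(3) by (intro add_mono mult_left_mono) auto
      then have "nat \<lceil>Kf r\<rceil> \<le> nat \<lceil>Kf s\<rceil>" by (intro nat_mono ceiling_mono)
      then have "(\<Sum>k\<le>nat \<lceil>Kf r\<rceil>. Cn k) \<le> (\<Sum>k\<le>nat \<lceil>Kf s\<rceil>. Cn k)"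
        by (intro sum_mono2) (auto simp: Cn0)
      then show "M r \<le> M s" unfolding M_def by (intro mult_right_mono mult_left_mono) auto
    qed
  next
    case (2 g ME MZ \<epsilon>)
    let ?s = "L2_norm \<Omega> g"
    have g: "g \<in> L2 \<Omega>" and \<epsilon>: "0 < \<epsilon>" by (fact 2)+
    note hyp = 2(2)
    have sub: "ME \<epsilon> \<subseteq> H10 \<Omega> \<times> H10 \<Omega>" "MZ \<subseteq> H10 \<Omega> \<times> H10 \<Omega>"
      using hyp \<epsilon> by blast+
    have dataE: "\<exists>p q. has_weak_div \<Omega> (flux \<Omega> (osc_coeff a \<epsilon>) (fst \<xi>)) p \<and>
           has_weak_div \<Omega> (flux \<Omega> (osc_coeff a \<epsilon>) (snd \<xi>)) q \<and>
           H10_enorm \<Omega> (\<lambda>x. p x + g x) + L2_enorm \<Omega> q + Holder2_enorm \<Omega> \<alpha> \<xi>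
             \<le> ennreal (M0 ?s)" if "\<xi> \<in> ME \<epsilon>" for \<xi>
      using hyp \<epsilon> that by blast
    have dataZ: "\<exists>p q. has_weak_div \<Omega> (flux \<Omega> (hom_coeff a N) (fst \<xi>)) p \<and>
           has_weak_div \<Omega> (flux \<Omega> (hom_coeff a N) (snd \<xi>)) q \<and>
           H10_enorm \<Omega> (\<lambda>x. p x + g x) + L2_enorm \<Omega> q + H22_enorm \<Omega> \<xi>
             \<le> ennreal (M0 ?s)" if "\<xi> \<in> MZ" for \<xi>
      using hyp that by blast
    have sym: "sym_hdist (\<lambda>\<zeta>. ennreal (energy_m1_norm \<Omega> \<zeta>)) (ME \<epsilon>) MZ
             \<le> ennreal (m0 * resolvent_gap \<Omega> a N \<epsilon> powr \<kappa>)"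
      using hyp \<epsilon> by blast
    define G where "G = resolvent_gap \<Omega> a N \<epsilon> powr \<kappa>"
    define n where "n = nat \<lceil>Kf ?s\<rceil>"
    have G: "0 \<le> G" "G \<le> X0 powr \<kappa>" using gap[of \<epsilon>] \<kappa> by (auto simp: G_def intro!: powr_mono2)
    have gapG: "resolvent_gap \<Omega> a N \<epsilon> \<le> \<Gamma> * G"
      using powr_compare[OF gap, of \<kappa> 1 \<epsilon>] gap(1)[of \<epsilon>] \<kappa> by (simp add: \<Gamma>_def G_def)
    have s0: "0 \<le> ?s" by (rule L2_norm_nonneg)
    have m: "0 \<le> M0 ?s" using M0(2)[OF s0] by simp
    have Kn: "Kf ?s \<le> real n" unfolding n_def by (rule real_nat_ceiling_ge)
    have pair: "Holder2_enorm \<Omega> \<beta> (\<xi> - \<eta>) \<le> ennreal (4 * (Cn n * ((m0 + 1) * G + t) powr \<theta>)) \<and>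
        Holder2_enorm \<Omega> \<beta> (\<eta> - \<xi>) \<le> ennreal (4 * (Cn n * ((m0 + 1) * G + t) powr \<theta>))"
      if \<xi>: "\<xi> \<in> ME \<epsilon>" and \<eta>: "\<eta> \<in> MZ" and t: "0 < t" "t \<le> 1"
        and close: "L2_norm \<Omega> (\<lambda>x. fst \<xi> x - fst \<eta> x) \<le> m0 * G + t" "Hm1_norm \<Omega> (\<lambda>x. snd \<xi> x - snd \<eta> x) \<le> m0 * G + t" for \<xi> \<eta> t
    proof -
      \<comment> \<open>\<open>m0 * G + t\<close> covers the distances; the additional
        \<open>G\<close> makes the parameter large enough for the resolvent gap.\<close>
      let ?x = "(m0 + 1) * G + t"
      obtain p1 p2 where p: "has_weak_div \<Omega> (flux \<Omega> (osc_coeff a \<epsilon>) (fst \<xi>)) p1"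
        "has_weak_div \<Omega> (flux \<Omega> (osc_coeff a \<epsilon>) (snd \<xi>)) p2"
        "H10_enorm \<Omega> (\<lambda>x. p1 x + g x) + L2_enorm \<Omega> p2 + Holder2_enorm \<Omega> \<alpha> \<xi> \<le> ennreal (M0 ?s)"
        using dataE[OF \<xi>] by blast
      obtain q1 q2 where q: "has_weak_div \<Omega> (flux \<Omega> (hom_coeff a N) (fst \<eta>)) q1"
        "has_weak_div \<Omega> (flux \<Omega> (hom_coeff a N) (snd \<eta>)) q2"
        "H10_enorm \<Omega> (\<lambda>x. q1 x + g x) + L2_enorm \<Omega> q2 + H22_enorm \<Omega> \<eta> \<le> ennreal (M0 ?s)"
        using dataZ[OF \<eta>] by blast
      note pb = attractor_data_bound[OF CP(2) less_imp_le[OF CP(1)] g m p(3), folded Kf_def]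
      note qb = attractor_data_bound[OF CP(2) less_imp_le[OF CP(1)] g m q(3), folded Kf_def]
      have x: "0 \<le> ?x" "?x \<le> X" "m0 * G + t \<le> ?x" "G \<le> ?x"
      proof -
        have "0 \<le> m0 * G" using m0 G by simp
        then show "0 \<le> ?x" "m0 * G + t \<le> ?x" "G \<le> ?x" using G t by (auto simp: distrib_right)
        have "(m0 + 1) * G \<le> (m0 + 1) * X0 powr \<kappa>" using m0 G by (intro mult_left_mono) auto
        then show "?x \<le> X" using t by (simp add: X_def)
      qed
      have T: "L2_opnorm \<Omega> (\<lambda>h. dirichlet_inv \<Omega> (osc_coeff a \<epsilon>) h - dirichlet_inv \<Omega> (hom_coeff a N) h) \<le> \<Gamma> * ?x"
        using gapG mult_left_mono[OF x(4) \<Gamma>] unfolding resolvent_gap_def by linarith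
      have "Holder_bound \<Omega> \<beta> (Cn n * ?x powr \<theta>) (\<lambda>x. fst \<xi> x - fst \<eta> x) \<and>
          Holder_bound \<Omega> \<beta> (Cn n * ?x powr \<theta>) (\<lambda>x. snd \<xi> x - snd \<eta> x)"
      proof (rule Cn[of n, unfolded pair_rate_def, THEN conjunct2, rule_format])
        show "osc_coeff a \<epsilon> \<in> S" using \<epsilon> by (simp add: S_def)
        show "{fst \<xi>, snd \<xi>, fst \<eta>, snd \<eta>} \<subseteq> H10 \<Omega>" using sub \<xi> \<eta> by auto
        show "{p1, p2, q1, q2} \<subseteq> {d \<in> L2 \<Omega>. L2_norm \<Omega> d \<le> real n}"
          using pb qb Kn by auto
        show "L2_norm \<Omega> (\<lambda>x. fst \<xi> x - fst \<eta> x) \<le> ?x" "Hm1_norm \<Omega> (\<lambda>x. snd \<xi> x - snd \<eta> x) \<le> ?x"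
          using close x(3) by linarith+
      qed (fact p q x T)+
      moreover from this have "Holder_bound \<Omega> \<beta> (Cn n * ?x powr \<theta>) (\<lambda>x. fst \<eta> x - fst \<xi> x)"
          "Holder_bound \<Omega> \<beta> (Cn n * ?x powr \<theta>) (\<lambda>x. snd \<eta> x - snd \<xi> x)"
        by (auto intro: Holder_bound_uminus)
      moreover have "0 \<le> Cn n * ?x powr \<theta>" by (simp add: Cn0)
      ultimately show ?thesis by (simp add: Holder2_enorm_le)
    qed
    \<comment> \<open>\<open>G\<close> may be 0, where continuity of the real power requires
      \<theta> > 0 and nonnegative bases.\<close>
    have lim: "((\<lambda>t. 4 * (Cn n * ((m0 + 1) * G + t) powr \<theta>)) \<longlongrightarrow> 4 * (Cn n * ((m0 + 1) * G) powr \<theta>)) (at_right 0)"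
    proof -
      have "((\<lambda>t. (m0 + 1) * G + t) \<longlongrightarrow> (m0 + 1) * G + 0) (at_right 0)"
        by (intro tendsto_intros)
      moreover have "\<forall>\<^sub>F t in at_right (0::real). 0 \<le> (m0 + 1) * G + t"
        using eventually_at_right_less[of 0] by eventually_elim (use m0 G in \<open>auto intro!: add_nonneg_nonneg\<close>)
      ultimately have "((\<lambda>t. ((m0 + 1) * G + t) powr \<theta>) \<longlongrightarrow> ((m0 + 1) * G + 0) powr \<theta>) (at_right 0)"
        using \<theta> by (intro tendsto_powr') auto
      then show ?thesis by (intro tendsto_mult tendsto_const) simp
    qed
    have r: "0 \<le> m0 * G" using m0 G by simp
    have "hdist (Holder2_enorm \<Omega> \<beta>) (ME \<epsilon>) MZ \<le> ennreal (4 * (Cn n * ((m0 + 1) * G) powr \<theta>))"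
    proof (rule hdist_transfer[OF _ r _ lim])
      show "hdist (\<lambda>\<zeta>. ennreal (energy_m1_norm \<Omega> \<zeta>)) (ME \<epsilon>) MZ \<le> ennreal (m0 * G)"
        using sym by (simp add: sym_hdist_def G_def)
      show "Holder2_enorm \<Omega> \<beta> (\<xi> - \<eta>) \<le> ennreal (4 * (Cn n * ((m0 + 1) * G + t) powr \<theta>))"
        if "\<xi> \<in> ME \<epsilon>" "\<eta> \<in> MZ" "0 < t" "t \<le> 1" "energy_m1_norm \<Omega> (\<xi> - \<eta>) \<le> m0 * G + t" for \<xi> \<eta> t
        using pair[OF that(1-4)] energy_m1_norm_components[of \<Omega> \<xi> \<eta>] that(5) by linarith
    qed
    moreover have "hdist (Holder2_enorm \<Omega> \<beta>) MZ (ME \<epsilon>) \<le> ennreal (4 * (Cn n * ((m0 + 1) * G) powr \<theta>))"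
    proof (rule hdist_transfer[OF _ r _ lim])
      show "hdist (\<lambda>\<zeta>. ennreal (energy_m1_norm \<Omega> \<zeta>)) MZ (ME \<epsilon>) \<le> ennreal (m0 * G)"
        using sym by (simp add: sym_hdist_def G_def)
      show "Holder2_enorm \<Omega> \<beta> (\<eta> - \<xi>) \<le> ennreal (4 * (Cn n * ((m0 + 1) * G + t) powr \<theta>))"
        if "\<eta> \<in> MZ" "\<xi> \<in> ME \<epsilon>" "0 < t" "t \<le> 1" "energy_m1_norm \<Omega> (\<eta> - \<xi>) \<le> m0 * G + t" for \<xi> \<eta> t
        using pair[OF that(2,1,3,4)] energy_m1_norm_components[of \<Omega> \<eta> \<xi>] that(5)
          L2_norm_minus_commute[of \<Omega> "fst \<xi>" "fst \<eta>"] Hm1_norm_minus_commute[of "snd \<xi>" "snd \<eta>"] by linarith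
    qed
    ultimately have "sym_hdist (Holder2_enorm \<Omega> \<beta>) (ME \<epsilon>) MZ \<le> ennreal (4 * (Cn n * ((m0 + 1) * G) powr \<theta>))"
      by (simp add: sym_hdist_def)
    also have "\<dots> \<le> ennreal (M ?s * resolvent_gap \<Omega> a N \<epsilon> powr ((\<alpha> - \<beta>) / (2 + \<alpha>) * \<kappa>))"
    proof (rule ennreal_leI)
      have "Cn n \<le> (\<Sum>k\<le>n. Cn k)" by (rule member_le_sum) (auto simp: Cn0)
      then have "4 * (Cn n * ((m0 + 1) * G) powr \<theta>) \<le> 4 * ((\<Sum>k\<le>n. Cn k) * ((m0 + 1) * G) powr \<theta>)"
        by (intro mult_left_mono mult_right_mono) auto
      moreover have "G powr \<theta> = resolvent_gap \<Omega> a N \<epsilon> powr ((\<alpha> - \<beta>) / (2 + \<alpha>) * \<kappa>)"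
        by (simp add: G_def powr_powr \<theta>_def mult.commute)
      then have "((m0 + 1) * G) powr \<theta> = (m0 + 1) powr \<theta> * resolvent_gap \<Omega> a N \<epsilon> powr ((\<alpha> - \<beta>) / (2 + \<alpha>) * \<kappa>)"
        by (simp only: powr_mult)
      ultimately show "4 * (Cn n * ((m0 + 1) * G) powr \<theta>) \<le> M ?s * resolvent_gap \<Omega> a N \<epsilon> powr ((\<alpha> - \<beta>) / (2 + \<alpha>) * \<kappa>)"
        by (simp only: M_def n_def mult.assoc)
    qed
    finally show ?case .
  qed
qed

end
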